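(* Let $\lambda,\mu,\nu$ be partitions of length at most four with $|\lambda|+|\mu|=|\nu|$. Then every coefficient of the polynomial $P^{\nu}_{\lambda\mu}(t)$ (in the monomial basis $1,t,t^2,\dots$) is nonnegative. If moreover $c^{\nu}_{\lambda\mu}>0$ and the hive polytope $H(\lambda,\mu,\nu)\subset\mathbb{R}^3$ of size $4$ is three-dimensional, then all four coefficients of $P^{\nu}_{\lambda\mu}(t)$ (those of $1,t,t^2,t^3$) are strictly positive.
   Context: $c^{\nu}_{\lambda\mu}$ is the Littlewood--Richardson coefficient (multiplicity of $s_\nu$ in $s_\lambda s_\mu$). For a positive integer $t$, $t\lambda=(t\lambda_1,t\lambda_2,\dots)$. By a theorem of Derksen and Weyman, $t\mapsto c^{t\nu}_{t\lambda,t\mu}$ agrees for all integers $t\ge1$ with a polynomial, denoted $P^{\nu}_{\lambda\mu}(t)$. Hives. A hive of size $r$ is a real function $h$ on $\{(i,j)\in\mathbb{Z}^2:0\le j\le i\le r\}$ satisfying all rhombus inequalities (whenever all four points lie in the array): $h(i+1,j)+h(i+1,j+1)\ge h(i,j)+h(i+2,j+1)$; $h(i,j)+h(i+1,j+1)\ge h(i+1,j)+h(i,j+1)$; $h(i,j)+h(i+1,j)\ge h(i+1,j+1)+h(i,j-1)$. For partitions $\lambda,\mu,\nu$ of length at most $r$ (padded with zeros to $r$ parts) with $|\lambda|+|\mu|=|\nu|$, the hive polytope $H(\lambda,\mu,\nu)\subset\mathbb{R}^{D}$, $D=\binom{r-1}{2}$, is the set of vectors of interior entries $(h(i,j))_{0<j<i<r}$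 of hives of size $r$ with border values $h(i,0)=\lambda_1+\dots+\lambda_i$, $h(i,i)=\nu_1+\dots+\nu_i$, $h(r,j)=|\lambda|+\mu_1+\dots+\mu_j$. Here $r=4$ and $D=3$. *)

theory Defs
  imports "HOL-Analysis.Analysis" "HOL-Library.Poly_Mapping"
    "HOL-Computational_Algebra.Polynomial"
begin

section \<open>Partitions\<close>

text \<open>A partition is its infinite sequence of parts, zero-padded and indexed from 0.\<close>

definition is_partition :: "(nat \<Rightarrow> nat) \<Rightarrow> bool" where
  "is_partition lam \<longleftrightarrow> antimono lam \<and> finite {i. lam i \<noteq> 0}"

definition part_length :: "(nat \<Rightarrow> nat) \<Rightarrow> nat" where
  "part_length lam = card {i. lam i \<noteq> 0}"

definition part_size :: "(nat \<Rightarrow> nat) \<Rightarrow> nat" where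
  "part_size lam = (\<Sum>i | lam i \<noteq> 0. lam i)"

definition partitions_of :: "nat \<Rightarrow> (nat \<Rightarrow> nat) set" where
  "partitions_of m = {lam. is_partition lam \<and> part_size lam = m}"

definition stretch :: "nat \<Rightarrow> (nat \<Rightarrow> nat) \<Rightarrow> (nat \<Rightarrow> nat)" where
  "stretch t lam = (\<lambda>i. t * lam i)"

section \<open>Schur polynomials and Littlewood--Richardson coefficients\<close>

definition cells :: "(nat \<Rightarrow> nat) \<Rightarrow> (nat \<times> nat) set" where
  "cells lam = {(i, j). j < lam i}"

text \<open>Semistandard tableaux with entries in \<open>{0..<n}\<close>: rows weakly increase, columns strictly
  increase.\<close>

definition ssyt :: "nat \<Rightarrow> (nat \<Rightarrow> nat) \<Rightarrow> (nat \<times> nat \<Rightarrow> nat) set" where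
  "ssyt n lam = {T \<in> cells lam \<rightarrow>\<^sub>E {..<n}.
     (\<forall>i j. (i, j) \<in> cells lam \<and> (i, Suc j) \<in> cells lam \<longrightarrow> T (i, j) \<le> T (i, Suc j)) \<and>
     (\<forall>i j. (i, j) \<in> cells lam \<and> (Suc i, j) \<in> cells lam \<longrightarrow> T (i, j) < T (Suc i, j))}"

text \<open>Multivariate integer polynomials: finitely supported maps from exponent vectors
  to coefficients.\<close>

type_synonym mpolynomial = "(nat \<Rightarrow>\<^sub>0 nat) \<Rightarrow>\<^sub>0 int"

definition mvar :: "nat \<Rightarrow> mpolynomial" where
  "mvar i = Poly_Mapping.single (Poly_Mapping.single i 1) 1"

definition schur :: "nat \<Rightarrow> (nat \<Rightarrow> nat) \<Rightarrow> mpolynomial" where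
  "schur n lam = (\<Sum>T\<in>ssyt n lam. \<Prod>b\<in>cells lam. mvar (T b))"

text \<open>The Schur function of \<open>lam\<close> is the compatible family \<open>(schur n lam)\<^sub>n\<close> in the inverse limit of
  the rings of symmetric polynomials. So an identity of symmetric functions is an identity in
  every number \<open>n\<close> of variables, and \<open>c\<close> below is the family of coefficients of the product of two
  Schur functions in the Schur basis. The coefficients vanish outside degree
  \<open>part_size lam + part_size mu\<close> because the product is homogeneous.\<close>

definition lr_coeff :: "(nat \<Rightarrow> nat) \<Rightarrow> (nat \<Rightarrow> nat) \<Rightarrow> (nat \<Rightarrow> nat) \<Rightarrow> int" where
  "lr_coeff lam mu = (THE c.
     (\<forall>nu. nu \<notin> partitions_of (part_size lam + part_size mu) \<longrightarrow> c nu = 0) \<and>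
     (\<forall>n. schur n lam * schur n mu =
        (\<Sum>nu\<in>partitions_of (part_size lam + part_size mu). of_int (c nu) * schur n nu)))"

section \<open>Hives\<close>

definition hive_array :: "nat \<Rightarrow> (int \<times> int) set" where
  "hive_array r = {(i, j). 0 \<le> j \<and> j \<le> i \<and> i \<le> int r}"

text \<open>Only the values on \<open>hive_array r\<close> matter.\<close>

definition hive :: "nat \<Rightarrow> (int \<times> int \<Rightarrow> real) \<Rightarrow> bool" where
  "hive r h \<longleftrightarrow>
     (\<forall>i j. {(i+1, j), (i+1, j+1), (i, j), (i+2, j+1)} \<subseteq> hive_array r \<longrightarrow>
        h (i+1, j) + h (i+1, j+1) \<ge> h (i, j) + h (i+2, j+1)) \<and>
     (\<forall>i j. {(i, j), (i+1, j+1), (i+1, j), (i, j+1)} \<subseteq> hive_array r \<longrightarrow>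
        h (i, j) + h (i+1, j+1) \<ge> h (i+1, j) + h (i, j+1)) \<and>
     (\<forall>i j. {(i, j), (i+1, j), (i+1, j+1), (i, j-1)} \<subseteq> hive_array r \<longrightarrow>
        h (i, j) + h (i+1, j) \<ge> h (i+1, j+1) + h (i, j-1))"

definition hive_border ::
  "nat \<Rightarrow> (nat \<Rightarrow> nat) \<Rightarrow> (nat \<Rightarrow> nat) \<Rightarrow> (nat \<Rightarrow> nat) \<Rightarrow> (int \<times> int \<Rightarrow> real) \<Rightarrow> bool" where
  "hive_border r lam mu nu h \<longleftrightarrow>
     (\<forall>k\<le>r. h (int k, 0) = real (\<Sum>m<k. lam m) \<and>
            h (int k, int k) = real (\<Sum>m<k. nu m) \<and>
            h (int r, int k) = real (part_size lam + (\<Sum>m<k. mu m)))"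

text \<open>For \<open>r = 4\<close> the interior positions \<open>0 < j < i < 4\<close> are \<open>(2,1)\<close>, \<open>(3,1)\<close>, \<open>(3,2)\<close>.\<close>

definition hive_polytope4 ::
  "(nat \<Rightarrow> nat) \<Rightarrow> (nat \<Rightarrow> nat) \<Rightarrow> (nat \<Rightarrow> nat) \<Rightarrow> (real ^ 3) set" where
  "hive_polytope4 lam mu nu =
     {vector [h (2, 1), h (3, 1), h (3, 2)] | h. hive 4 h \<and> hive_border 4 lam mu nu h}"

end

theory Submission
  imports Defs "HOL-Combinatorics.Permutations"
begin

text \<open>
  The proof counts lattice points and compares the counts of a polytope and of its threefold
  dilate.

  A tableau is encoded as a Gelfand--Tsetlin pattern. Multiplying an alternant by a Schur
  polynomial gives a signed sum over patterns; an involution of Bender--Knuth type (the argument is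
  due to Stembridge) cancels all patterns except those that stay dominant when they are read column
  by column from the right. This is the Littlewood--Richardson rule, theorem \<open>lr_coeff_eq\<close>. For four
  rows the surviving patterns are the integral hives of size four (\<open>bij_hive_of\<close>), so that
  \<open>P(t)\<close> counts the integral points of the \<open>t\<close>-fold dilated hive polytope.

  Let \<open>u, v, w\<close> be the interior entries of a hive. In the coordinates
  \<open>(u + v - w, u + w - v, v + w - u)\<close> the integral points form the lattice of integer triples with
  equal parities, and the normals of all rhombus inequalities are roots of type \<open>C\<^sub>3\<close>: the vectors
  \<open>\<plusminus>2e\<^sub>i\<close> and \<open>\<plusminus>e\<^sub>i \<plusminus> e\<^sub>j\<close>. A root takes even values on the lattice, and every coset of three times
  the lattice has a representative on which all roots have absolute value at most four. Hence every
  lattice point of the dilate \<open>3t\<close> is \<open>3z + d\<close> for a unique lattice point \<open>z\<close> of the dilate \<open>t\<close>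
  and a representative \<open>d\<close> that lies in the tangent cone at \<open>z\<close>. The tangent cone at \<open>3z + d\<close>
  depends only on \<open>d\<close> and on the tangent cone at \<open>z\<close> (\<open>sum_transfer\<close>).

  Passing from \<open>Q(t)\<close> to \<open>a Q(t) - Q(3t)\<close> multiplies the \<open>k\<close>-th coefficient by
  \<open>a - 3\<^sup>k\<close>. For \<open>a = 27, 9, 3\<close> in turn this removes the coefficients of \<open>t\<^sup>3\<close>, \<open>t\<^sup>2\<close> and \<open>t\<close> and keeps
  the signs of the lower ones. The resulting polynomials are sums over lattice points of integers,
  the defects, that depend only on the tangent cone. So every coefficient is nonnegative as soon as
  the defects are, and this is a finite statement about sets of roots. If the polytope has an
  interior point, a set of tight roots lies in an open half space, and up to the symmetries of the
  cube it is one of the 512 subsets of the positive roots; these are checked by evaluation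
  (\<open>all_checks\<close>, \<open>good_cone_full_dimensional\<close>). Otherwise the polytope lies in a plane orthogonal to a
  root, where the analogous defects are estimated directly (\<open>flat_defect_nonneg\<close>).

  If the polytope is three-dimensional, some dilate contains a lattice point in its
  interior, and such points multiply by 27 when the dilation triples, so the leading coefficient is
  positive. Points with exactly one tight root multiply by nine, which gives the coefficient of
  \<open>t\<^sup>2\<close>. A vertex that minimises \<open>x + y + z\<close> has positive third defect and makes the sum of the second
  defects grow, which gives the two remaining coefficients.
\<close>

section \<open>Gelfand--Tsetlin patterns\<close>

text \<open>A pattern is an infinite array. Row \<open>k\<close> is the shape of the entries smaller than \<open>k\<close> of a
  tableau of shape \<open>\<mu>\<close> with entries below \<open>n\<close>, so row \<open>0\<close> is empty and the rows from \<open>n\<close> on equal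
  \<open>\<mu>\<close>. In terms of the tableau, the letter \<open>k\<close> occupies the columns from \<open>x k i\<close> up to but excluding
  \<open>x (Suc k) i\<close> of row \<open>i\<close>.\<close>

definition gt :: "nat \<Rightarrow> (nat \<Rightarrow> nat) \<Rightarrow> (nat \<Rightarrow> nat \<Rightarrow> nat) set" where
  "gt n \<mu> = {x. x 0 = (\<lambda>_. 0) \<and> (\<forall>k\<ge>n. x k = \<mu>) \<and>
     (\<forall>k i. x (Suc k) (Suc i) \<le> x k i \<and> x k i \<le> x (Suc k) i)}"

lemma gt_interlace:
  assumes "x \<in> gt n \<mu>"
  shows "x (Suc k) (Suc i) \<le> x k i" "x k i \<le> x (Suc k) i"
  using assms by (auto simp: gt_def)

lemma gt_mono:
  assumes "x \<in> gt n \<mu>" "k \<le> l"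
  shows "x k i \<le> x l i"
  using assms(2) by (rule lift_Suc_mono_le[rotated]) (rule gt_interlace(2)[OF assms(1)])

lemma gt_zero:
  assumes "x \<in> gt n \<mu>" "k \<le> i"
  shows "x k i = 0"
  using assms(2)
proof (induction k arbitrary: i)
  case 0
  then show ?case using assms(1) by (simp add: gt_def)
next
  case (Suc k)
  then obtain i' where "i = Suc i'" "k \<le> i'" by (cases i) auto
  then show ?case using Suc.IH[of i'] gt_interlace(1)[OF assms(1), of k i'] by simp
qed

lemma gt_decreasing:
  assumes "x \<in> gt n \<mu>"
  shows "x k (Suc i) \<le> x k i"
  using gt_interlace[OF assms] by (meson le_trans)

lemma gt_top: "x \<in> gt n \<mu> \<Longrightarrow> n \<le> k \<Longrightarrow> x k = \<mu>"
  by (simp add: gt_def)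

lemma gt_le: "x \<in> gt n \<mu> \<Longrightarrow> x k i \<le> \<mu> i"
  using gt_mono[of x n \<mu> k "max n k" i] gt_top[of x n \<mu> "max n k"] by simp

text \<open>Of the letters \<open>k\<close>, \<open>wt_above j\<close> counts those in the columns from \<open>j\<close> on and \<open>wt_below j\<close>
  those in the columns before \<open>j\<close>.\<close>

definition wt_above :: "nat \<Rightarrow> (nat \<Rightarrow> nat \<Rightarrow> nat) \<Rightarrow> nat \<Rightarrow> nat" where
  "wt_above j x k = (\<Sum>i\<le>k. max (x (Suc k) i) j - max (x k i) j)"

definition wt_below :: "nat \<Rightarrow> (nat \<Rightarrow> nat \<Rightarrow> nat) \<Rightarrow> nat \<Rightarrow> nat" where
  "wt_below j x k = (\<Sum>i\<le>k. min (x (Suc k) i) j - min (x k i) j)"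

definition wt :: "(nat \<Rightarrow> nat \<Rightarrow> nat) \<Rightarrow> nat \<Rightarrow> nat" where
  "wt x k = (\<Sum>i\<le>k. x (Suc k) i - x k i)"

lemma wt_split:
  assumes "x \<in> gt n \<mu>"
  shows "wt x k = wt_below j x k + wt_above j x k"
  unfolding wt_def wt_below_def wt_above_def sum.distrib[symmetric]
  by (rule sum.cong) (use gt_interlace(2)[OF assms] in \<open>auto simp: min_def max_def le_diff_conv2\<close>)

lemma wt_top: "x \<in> gt n \<mu> \<Longrightarrow> n \<le> k \<Longrightarrow> wt x k = 0"
  by (simp add: wt_def gt_top)

text \<open>The Bender--Knuth involution exchanges the numbers of free letters \<open>k\<close> and \<open>k + 1\<close> in every
  row. On patterns it reflects each entry \<open>b\<close> of row \<open>k + 1\<close> in the interval \<open>[l, h]\<close> that the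
  neighbouring rows allow. Cutting the interval at \<open>j\<close> restricts the exchange to the columns
  before \<open>j\<close>.\<close>

definition reflect :: "nat \<Rightarrow> nat \<Rightarrow> nat \<Rightarrow> nat \<Rightarrow> nat" where
  "reflect j l h b = (if j < b then b else l + min h j - b)"

lemma reflect_bounds:
  assumes "l \<le> b" "b \<le> h"
  shows "l \<le> reflect j l h b" "reflect j l h b \<le> h" "b \<le> j \<Longrightarrow> reflect j l h b \<le> j"
    and "reflect j l h (reflect j l h b) = b" "j \<le> j' \<Longrightarrow> max (reflect j l h b) j' = max b j'"
    and "(j < b \<longrightarrow> j < l) \<Longrightarrow> min (reflect j l h b) j + min b j = min l j + min h j"
  using assms by (auto simp: reflect_def min_def max_def)

definition lo :: "(nat \<Rightarrow> nat \<Rightarrow> nat) \<Rightarrow> nat \<Rightarrow> nat \<Rightarrow> nat" where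
  "lo x k i = max (x k i) (x (Suc (Suc k)) (Suc i))"

definition hi :: "(nat \<Rightarrow> nat \<Rightarrow> nat) \<Rightarrow> nat \<Rightarrow> nat \<Rightarrow> nat" where
  "hi x k i = (if i = 0 then x (Suc (Suc k)) 0 else min (x (Suc (Suc k)) i) (x k (i - 1)))"

definition toggle :: "nat \<Rightarrow> nat \<Rightarrow> (nat \<Rightarrow> nat \<Rightarrow> nat) \<Rightarrow> nat \<Rightarrow> nat \<Rightarrow> nat" where
  "toggle j k x = x(Suc k := (\<lambda>i. reflect j (lo x k i) (hi x k i) (x (Suc k) i)))"

text \<open>The \<open>j\<close>-th column contains no letter \<open>k\<close>. Under this condition the exchange in the columns
  before \<open>j\<close> fits together with the columns from \<open>j\<close> on.\<close>

definition column_free :: "nat \<Rightarrow> nat \<Rightarrow> (nat \<Rightarrow> nat \<Rightarrow> nat) \<Rightarrow> bool" where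
  "column_free j k x \<longleftrightarrow> (\<forall>i. j < x (Suc k) i \<longrightarrow> j < x k i)"

lemma toggle_row: "toggle j k x (Suc k) i = reflect j (lo x k i) (hi x k i) (x (Suc k) i)"
  by (simp add: toggle_def)

lemma toggle_other: "l \<noteq> Suc k \<Longrightarrow> toggle j k x l = x l"
  by (simp add: toggle_def)

lemma lo_hi_toggle: "lo (toggle j k x) k i = lo x k i" "hi (toggle j k x) k i = hi x k i"
  by (simp_all add: lo_def hi_def toggle_other)

context
  fixes n \<mu> x k and j :: nat
  assumes x: "x \<in> gt n \<mu>" and k: "Suc k < n"
begin

lemma lo_hi: "lo x k i \<le> x (Suc k) i" "x (Suc k) i \<le> hi x k i"
  using gt_interlace[OF x] by (cases i; simp add: lo_def hi_def)+

lemma reflect_lo_hi: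
  "lo x k i \<le> toggle j k x (Suc k) i" "toggle j k x (Suc k) i \<le> hi x k i"
  "x (Suc k) i \<le> j \<Longrightarrow> toggle j k x (Suc k) i \<le> j"
  "j \<le> j' \<Longrightarrow> max (toggle j k x (Suc k) i) j' = max (x (Suc k) i) j'"
  "(j < x (Suc k) i \<longrightarrow> j < lo x k i) \<Longrightarrow>
     min (toggle j k x (Suc k) i) j + min (x (Suc k) i) j = min (lo x k i) j + min (hi x k i) j"
  unfolding toggle_row by (rule reflect_bounds[OF lo_hi]; assumption)+

lemma toggle_gt: "toggle j k x \<in> gt n \<mu>"
proof -
  let ?y = "toggle j k x"
  have "?y (Suc l) (Suc i) \<le> ?y l i \<and> ?y l i \<le> ?y (Suc l) i" for l i
  proof -
    consider "l = k" | "l = Suc k" | "l \<noteq> k" "l \<noteq> Suc k" by blast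
    then show ?thesis
    proof cases
      case 1
      then show ?thesis using reflect_lo_hi(1)[of i] reflect_lo_hi(2)[of "Suc i"]
        by (simp add: toggle_other lo_def hi_def)
    next
      case 2
      then show ?thesis using reflect_lo_hi(1)[of i] reflect_lo_hi(2)[of i]
        by (cases i) (simp_all add: toggle_other lo_def hi_def)
    next
      case 3
      then show ?thesis using gt_interlace[OF x] by (simp add: toggle_other)
    qed
  qed
  moreover have "?y 0 = (\<lambda>_. 0)" using x by (simp add: toggle_other gt_def)
  moreover have "?y l = \<mu>" if "n \<le> l" for l using x k that by (subst toggle_other) (auto simp: gt_top)
  ultimately show ?thesis by (simp add: gt_def)
qed

lemma toggle_above: "j \<le> j' \<Longrightarrow> wt_above j' (toggle j k x) l = wt_above j' x l"
proof -
  assume "j \<le> j'"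
  then have "max (toggle j k x l i) j' = max (x l i) j'" for l i
    by (cases "l = Suc k") (simp_all add: reflect_lo_hi(4) toggle_other)
  then show ?thesis by (simp add: wt_above_def)
qed

lemma toggle_toggle: "toggle j k (toggle j k x) = x"
proof (rule ext, rule ext)
  fix l i
  show "toggle j k (toggle j k x) l i = x l i"
    using reflect_bounds(4)[OF lo_hi, of j i] by (cases "l = Suc k") (simp_all add: toggle_row lo_hi_toggle toggle_other)
qed

lemma toggle_min:
  assumes "column_free j k x"
  shows "min (toggle j k x (Suc k) i) j + min (x (Suc k) i) j = min (lo x k i) j + min (hi x k i) j"
  by (rule reflect_lo_hi(5)) (use assms in \<open>auto simp: column_free_def lo_def less_max_iff_disj\<close>)

text \<open>The bounds \<open>lo\<close> and \<open>hi\<close> of one row are a rearrangement of the entries of the two rows next to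
  it, because consecutive intervals share a pair of entries and use its maximum and its minimum.\<close>

lemma sum_lo_hi: "(\<Sum>i\<le>Suc k. min (lo x k i) j + min (hi x k i) j) = (\<Sum>i\<le>Suc k. min (x k i) j + min (x (Suc (Suc k)) i) j)"
proof -
  have z: "x k (Suc k) = 0" "x k k = 0" "x (Suc (Suc k)) (Suc (Suc k)) = 0" using gt_zero[OF x] by auto
  have 1: "min (max a c) j + min (min c a) j = min a j + min c j" for a c :: nat
    by (auto simp: min_def max_def)
  have "(\<Sum>i\<le>Suc k. min (hi x k i) j) = min (x (Suc (Suc k)) 0) j + (\<Sum>i\<le>k. min (min (x (Suc (Suc k)) (Suc i)) (x k i)) j)"
    by (subst sum.atMost_Suc_shift) (simp add: hi_def)
  moreover have "(\<Sum>i\<le>Suc k. min (x (Suc (Suc k)) i) j) = min (x (Suc (Suc k)) 0) j + (\<Sum>i\<le>k. min (x (Suc (Suc k)) (Suc i)) j)"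
    by (subst sum.atMost_Suc_shift) simp
  moreover have "(\<Sum>i\<le>Suc k. min (lo x k i) j) = (\<Sum>i\<le>k. min (lo x k i) j)" "(\<Sum>i\<le>Suc k. min (x k i) j) = (\<Sum>i\<le>k. min (x k i) j)"
    by (simp_all add: z lo_def)
  moreover have "(\<Sum>i\<le>k. min (lo x k i) j) + (\<Sum>i\<le>k. min (min (x (Suc (Suc k)) (Suc i)) (x k i)) j) =
     (\<Sum>i\<le>k. min (x k i) j) + (\<Sum>i\<le>k. min (x (Suc (Suc k)) (Suc i)) j)"
    unfolding sum.distrib[symmetric] lo_def 1 ..
  ultimately show ?thesis unfolding sum.distrib by linarith
qed

end

lemma below_sum:
  assumes "x \<in> gt n \<mu>" "k \<le> N"
  shows "wt_below j x k + (\<Sum>i\<le>N. min (x k i) j) = (\<Sum>i\<le>N. min (x (Suc k) i) j)"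
proof -
  have "(\<Sum>i\<le>N. min (x l i) j) = (\<Sum>i\<le>k. min (x l i) j)" if "l \<le> Suc k" for l
    using assms(2) gt_zero[OF assms(1)] that by (intro sum.mono_neutral_right) auto
  moreover have "wt_below j x k + (\<Sum>i\<le>k. min (x k i) j) = (\<Sum>i\<le>k. min (x (Suc k) i) j)"
    unfolding wt_below_def sum.distrib[symmetric]
    by (intro sum.cong refl le_add_diff_inverse2 min.mono gt_interlace(2)[OF assms(1)] order_refl)
  ultimately show ?thesis by simp
qed

text \<open>By \<open>toggle_min\<close> and \<open>sum_lo_hi\<close>, the truncated sums of the old and of the new row \<open>k + 1\<close> add up
  to those of the rows \<open>k\<close> and \<open>k + 2\<close>. The weights are differences of such sums.\<close>

lemma toggle_below:
  assumes x: "x \<in> gt n \<mu>" and k: "Suc k < n" and free: "column_free j k x"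
  shows "wt_below j (toggle j k x) k = wt_below j x (Suc k)" "wt_below j (toggle j k x) (Suc k) = wt_below j x k"
    "l \<noteq> k \<Longrightarrow> l \<noteq> Suc k \<Longrightarrow> wt_below j (toggle j k x) l = wt_below j x l"
proof -
  let ?y = "toggle j k x" and ?s = "\<lambda>x l. \<Sum>i\<le>Suc k. min (x l i) j"
  note y = toggle_gt[OF x k]
  note o = toggle_other[of _ k j x]
  have "?s ?y (Suc k) + ?s x (Suc k) = ?s x k + ?s x (Suc (Suc k))"
    using sum_lo_hi[OF x k, of j] unfolding sum.distrib[symmetric] toggle_min[OF x k free] by simp
  moreover have "?s ?y k = ?s x k" "?s ?y (Suc (Suc k)) = ?s x (Suc (Suc k))" by (simp_all add: o)
  moreover have "wt_below j x k + ?s x k = ?s x (Suc k)" "wt_below j x (Suc k) + ?s x (Suc k) = ?s x (Suc (Suc k))"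
    "wt_below j ?y k + ?s ?y k = ?s ?y (Suc k)" "wt_below j ?y (Suc k) + ?s ?y (Suc k) = ?s ?y (Suc (Suc k))"
    by (rule below_sum[OF x] below_sum[OF y]; simp)+
  ultimately show "wt_below j ?y k = wt_below j x (Suc k)" "wt_below j ?y (Suc k) = wt_below j x k" by linarith+
  show "wt_below j ?y l = wt_below j x l" if "l \<noteq> k" "l \<noteq> Suc k" using that by (simp add: wt_below_def o)
qed

section \<open>Alternants\<close>

definition monomial :: "nat \<Rightarrow> (nat \<Rightarrow> nat) \<Rightarrow> mpolynomial" where
  "monomial n f = (\<Prod>k<n. mvar k ^ f k)"

definition alternant :: "nat \<Rightarrow> (nat \<Rightarrow> nat) \<Rightarrow> mpolynomial" where
  "alternant n \<alpha> = (\<Sum>\<pi> | \<pi> permutes {..<n}. of_int (sign \<pi>) * monomial n (\<alpha> \<circ> \<pi>))"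

lemma monomial_add: "monomial n (\<lambda>k. f k + g k) = monomial n f * monomial n g"
  by (simp add: monomial_def power_add prod.distrib)

lemma monomial_cong: "(\<And>k. k < n \<Longrightarrow> f k = g k) \<Longrightarrow> monomial n f = monomial n g"
  by (simp add: monomial_def)

lemma alternant_cong: 
  assumes "\<And>k. k < n \<Longrightarrow> \<alpha> k = \<beta> k"
  shows "alternant n \<alpha> = alternant n \<beta>"
  unfolding alternant_def
proof (intro sum.cong refl arg_cong2[of _ _ _ _ "(*)"] monomial_cong)
  fix \<pi> k assume "\<pi> \<in> {\<pi>. \<pi> permutes {..<n}}" "k < n"
  then have "\<pi> k < n" using permutes_in_image[of \<pi> "{..<n}" k] by simp
  then show "(\<alpha> \<circ> \<pi>) k = (\<beta> \<circ> \<pi>) k" by (simp add: assms)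
qed

lemma alternant_transpose:
  assumes "a < n" "b < n" "a \<noteq> b"
  shows "alternant n (\<alpha> \<circ> Transposition.transpose a b) = - alternant n \<alpha>"
proof -
  let ?\<tau> = "Transposition.transpose a b"
  have \<tau>: "?\<tau> permutes {..<n}" using assms by (intro permutes_swap_id) auto
  have "alternant n \<alpha> = (\<Sum>\<pi> | \<pi> permutes {..<n}. of_int (sign (?\<tau> \<circ> \<pi>)) * monomial n (\<alpha> \<circ> (?\<tau> \<circ> \<pi>)))"
    unfolding alternant_def by (rule setum_permutations_compose_left[OF \<tau>])
  also have "\<dots> = (\<Sum>\<pi> | \<pi> permutes {..<n}. - (of_int (sign \<pi>) * monomial n ((\<alpha> \<circ> ?\<tau>) \<circ> \<pi>)))"
  proof (rule sum.cong[OF refl])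
    fix \<pi> assume "\<pi> \<in> {\<pi>. \<pi> permutes {..<n}}"
    then have "sign (?\<tau> \<circ> \<pi>) = sign ?\<tau> * sign \<pi>"
      using \<tau> permutation_permutes by (intro sign_compose) auto
    then show "of_int (sign (?\<tau> \<circ> \<pi>)) * monomial n (\<alpha> \<circ> (?\<tau> \<circ> \<pi>)) = - (of_int (sign \<pi>) * monomial n ((\<alpha> \<circ> ?\<tau>) \<circ> \<pi>))"
      using assms(3) by (simp add: sign_swap_id o_assoc)
  qed
  also have "\<dots> = - alternant n (\<alpha> \<circ> ?\<tau>)" by (simp add: alternant_def sum_negf)
  finally show ?thesis by simp
qed

section \<open>Symmetry of the weights\<close>

lemma gt_le_top:
  assumes "x \<in> gt n \<mu>"
  shows "x k i \<le> \<mu> 0"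
proof -
  have "x k i \<le> x k 0" by (rule lift_Suc_antimono_le[of "x k", OF gt_decreasing[OF assms]]) simp
  also have "\<dots> \<le> \<mu> 0" by (rule gt_le[OF assms])
  finally show ?thesis .
qed

lemma wt_above_top: "x \<in> gt n \<mu> \<Longrightarrow> \<mu> 0 \<le> j \<Longrightarrow> wt_above j x k = 0"
  unfolding wt_above_def using gt_le_top[of x n \<mu>] by (simp add: max_absorb2 le_trans[of _ "\<mu> 0" j])

text \<open>Toggling in all columns is a bijection of the patterns that exchanges the weights of two
  neighbouring letters. No column from \<open>\<mu> 0\<close> on is occupied, so \<open>\<mu> 0\<close> is a cut that affects all
  columns.\<close>

lemma sum_wt_permute_adjacent:
  assumes k: "Suc k < n"
  shows "(\<Sum>x\<in>gt n \<mu>. F (wt x \<circ> Transposition.transpose k (Suc k))) = (\<Sum>x\<in>gt n \<mu>. F (wt x))"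
proof -
  let ?t = "toggle (\<mu> 0) k"
  have free: "column_free (\<mu> 0) k x" if "x \<in> gt n \<mu>" for x
    using gt_le_top[OF that] by (simp add: column_free_def not_less[symmetric])
  have wt: "wt (?t x) = wt x \<circ> Transposition.transpose k (Suc k)" if x: "x \<in> gt n \<mu>" for x
  proof
    fix l
    have "wt y l = wt_below (\<mu> 0) y l" if "y \<in> gt n \<mu>" for y l
      using wt_split[OF that, where j = "\<mu> 0" and k = l] wt_above_top[OF that, of "\<mu> 0"] by simp
    then show "wt (?t x) l = (wt x \<circ> Transposition.transpose k (Suc k)) l"
      using toggle_below[OF x k free[OF x]] toggle_gt[OF x k] x by (auto simp: Transposition.transpose_def)
  qed
  have "bij_betw ?t (gt n \<mu>) (gt n \<mu>)"
    by (rule bij_betw_byWitness[where f' = ?t]) (auto simp: toggle_toggle[OF _ k] toggle_gt[OF _ k])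
  then have "(\<Sum>x\<in>gt n \<mu>. F (wt x)) = (\<Sum>x\<in>gt n \<mu>. F (wt (?t x)))"
    by (rule sum.reindex_bij_betw[symmetric])
  also have "\<dots> = (\<Sum>x\<in>gt n \<mu>. F (wt x \<circ> Transposition.transpose k (Suc k)))"
    by (rule sum.cong) (simp_all add: wt)
  finally show ?thesis by simp
qed

lemma sum_wt_permute_transpose:
  assumes "a < b" "b < n"
  shows "(\<Sum>x\<in>gt n \<mu>. F (wt x \<circ> Transposition.transpose a b)) = (\<Sum>x\<in>gt n \<mu>. F (wt x))"
  using assms
proof (induction b arbitrary: F)
  case (Suc b)
  show ?case
  proof (cases "a = b")
    case True
    then show ?thesis using sum_wt_permute_adjacent[of b n F] Suc.prems by (simp only: True)
  next
    case False
    let ?s = "Transposition.transpose b (Suc b)"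
    have "Transposition.transpose a (Suc b) = ?s \<circ> Transposition.transpose a b \<circ> ?s"
      using False Suc.prems by (auto simp: fun_eq_iff Transposition.transpose_def)
    then have "(\<Sum>x\<in>gt n \<mu>. F (wt x \<circ> Transposition.transpose a (Suc b))) =
        (\<Sum>x\<in>gt n \<mu>. (\<lambda>w. F (w \<circ> Transposition.transpose a b \<circ> ?s)) (wt x \<circ> ?s))"
      by (simp add: o_assoc)
    also have "\<dots> = (\<Sum>x\<in>gt n \<mu>. (\<lambda>w. F (w \<circ> ?s)) (wt x \<circ> Transposition.transpose a b))"
      using Suc.prems by (subst sum_wt_permute_adjacent) auto
    also have "\<dots> = (\<Sum>x\<in>gt n \<mu>. F (wt x \<circ> ?s))"
      using False Suc.prems by (subst Suc.IH) auto
    also have "\<dots> = (\<Sum>x\<in>gt n \<mu>. F (wt x))"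
      using Suc.prems by (subst sum_wt_permute_adjacent) auto
    finally show ?thesis .
  qed
qed simp

lemma sum_wt_permute:
  assumes "\<pi> permutes {..<n}"
  shows "(\<Sum>x\<in>gt n \<mu>. F (wt x \<circ> \<pi>)) = (\<Sum>x\<in>gt n \<mu>. F (wt x))"
  using assms finite_lessThan
proof (induction arbitrary: F rule: permutes_induct)
  case id
  then show ?case by simp
next
  case (swap a b p)
  have "(\<Sum>x\<in>gt n \<mu>. (\<lambda>w. F (w \<circ> p)) (wt x \<circ> Transposition.transpose a b)) = (\<Sum>x\<in>gt n \<mu>. F (wt x \<circ> p))"
  proof (cases a b rule: linorder_cases)
    case less
    then show ?thesis using sum_wt_permute_transpose swap by simp
  next
    case greater
    then show ?thesis using sum_wt_permute_transpose[of b a] swap by (simp add: transpose_commute)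
  qed simp
  then show ?case using swap.IH[of F] by (simp only: comp_assoc)
qed

text \<open>The symmetry of the weights allows each permutation of the alternant to act on the weight of a
  pattern as well.\<close>

lemma alternant_times_sum:
  "alternant n \<alpha> * (\<Sum>x\<in>gt n \<mu>. monomial n (wt x)) = (\<Sum>x\<in>gt n \<mu>. alternant n (\<lambda>k. \<alpha> k + wt x k))"
proof -
  have "alternant n \<alpha> * (\<Sum>x\<in>gt n \<mu>. monomial n (wt x)) =
      (\<Sum>\<pi> | \<pi> permutes {..<n}. of_int (sign \<pi>) * monomial n (\<alpha> \<circ> \<pi>) * (\<Sum>x\<in>gt n \<mu>. monomial n (wt x)))"
    by (simp add: alternant_def sum_distrib_right)
  also have "\<dots> = (\<Sum>\<pi> | \<pi> permutes {..<n}. of_int (sign \<pi>) * monomial n (\<alpha> \<circ> \<pi>) * (\<Sum>x\<in>gt n \<mu>. monomial n (wt x \<circ> \<pi>)))"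
    by (rule sum.cong) (simp_all add: sum_wt_permute)
  also have "\<dots> = (\<Sum>\<pi> | \<pi> permutes {..<n}. \<Sum>x\<in>gt n \<mu>. of_int (sign \<pi>) * monomial n ((\<lambda>k. \<alpha> k + wt x k) \<circ> \<pi>))"
    by (simp add: sum_distrib_left mult.assoc monomial_add[symmetric] o_def)
  also have "\<dots> = (\<Sum>x\<in>gt n \<mu>. alternant n (\<lambda>k. \<alpha> k + wt x k))"
    unfolding alternant_def by (rule sum.swap)
  finally show ?thesis .
qed

section \<open>Cancellation of patterns\<close>

text \<open>Read the columns of the tableau from the right and add their contents to \<open>\<kappa>\<close>. A pair \<open>(j, k)\<close> is
  bad if the parts \<open>k\<close> and \<open>k + 1\<close> of the result are in the wrong order after the columns from \<open>j\<close> on.\<close>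

definition bad_pair :: "(nat \<Rightarrow> nat) \<Rightarrow> (nat \<Rightarrow> nat \<Rightarrow> nat) \<Rightarrow> nat \<Rightarrow> nat \<Rightarrow> bool" where
  "bad_pair \<kappa> x j k \<longleftrightarrow> \<kappa> k + wt_above j x k < \<kappa> (Suc k) + wt_above j x (Suc k)"

definition good :: "(nat \<Rightarrow> nat) \<Rightarrow> (nat \<Rightarrow> nat \<Rightarrow> nat) \<Rightarrow> bool" where
  "good \<kappa> x \<longleftrightarrow> (\<forall>j k. \<not> bad_pair \<kappa> x j k)"

definition column_count :: "nat \<Rightarrow> (nat \<Rightarrow> nat \<Rightarrow> nat) \<Rightarrow> nat \<Rightarrow> nat" where
  "column_count j x k = card {i. i \<le> k \<and> x k i \<le> j \<and> j < x (Suc k) i}"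

lemma wt_above_step:
  assumes "x \<in> gt n \<mu>"
  shows "wt_above j x k = wt_above (Suc j) x k + column_count j x k"
proof -
  have "wt_above j x k = (\<Sum>i\<le>k. (max (x (Suc k) i) (Suc j) - max (x k i) (Suc j)) + (if x k i \<le> j \<and> j < x (Suc k) i then 1 else 0))"
    unfolding wt_above_def by (rule sum.cong) (use gt_interlace(2)[OF assms] in \<open>auto simp: max_def\<close>)
  also have "\<dots> = wt_above (Suc j) x k + (\<Sum>i\<le>k. if x k i \<le> j \<and> j < x (Suc k) i then 1 else 0)"
    by (simp add: wt_above_def sum.distrib)
  also have "(\<Sum>i\<le>k. if x k i \<le> j \<and> j < x (Suc k) i then 1 else 0) = column_count j x k"
    by (simp add: column_count_def sum.If_cases Int_def conj_ac)
  finally show ?thesis .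
qed

text \<open>Columns of a tableau are strict; on patterns this is the interlacing of consecutive rows.\<close>

lemma column_count_le_1:
  assumes "x \<in> gt n \<mu>"
  shows "column_count j x k \<le> 1"
proof -
  have "i = i'" if "x k i \<le> j" "j < x (Suc k) i" "x k i' \<le> j" "j < x (Suc k) i'" for i i'
  proof (rule ccontr)
    have *: False if "i < i'" "x k i \<le> j" "j < x (Suc k) i'" for i i'
    proof -
      have "x (Suc k) i' \<le> x (Suc k) (Suc i)"
        using that(1) by (intro lift_Suc_antimono_le[of "x (Suc k)", OF gt_decreasing[OF assms]]) simp
      also have "\<dots> \<le> x k i" by (rule gt_interlace(1)[OF assms])
      finally show False using that by simp
    qed
    assume "i \<noteq> i'"
    then show False using *[of i i'] *[of i' i] that by linarith
  qed
  moreover have "finite {i. i \<le> k \<and> x k i \<le> j \<and> j < x (Suc k) i}" by simp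
  ultimately have "card {i. i \<le> k \<and> x k i \<le> j \<and> j < x (Suc k) i} \<le> Suc 0"
    by (subst card_le_Suc0_iff_eq) auto
  then show ?thesis by (simp add: column_count_def)
qed

lemma column_count_0:
  assumes "x \<in> gt n \<mu>" "column_count j x k = 0"
  shows "column_free j k x"
  unfolding column_free_def
proof (intro allI impI)
  fix i assume i: "j < x (Suc k) i"
  then have "i \<le> k" using gt_zero[OF assms(1), of "Suc k" i] by (cases "i \<le> k") auto
  moreover have "{i. i \<le> k \<and> x k i \<le> j \<and> j < x (Suc k) i} = {}"
    using assms(2) by (subst (asm) column_count_def) simp
  ultimately show "j < x k i" using i by (auto simp: not_less[symmetric])
qed

text \<open>Choosing the first violation from the right, and in it the smallest letter, depends only on
  the columns from the cut on. The flip changes only the columns before the cut and therefore finds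
  the same cut and letter again.\<close>

definition cut_column :: "(nat \<Rightarrow> nat) \<Rightarrow> (nat \<Rightarrow> nat \<Rightarrow> nat) \<Rightarrow> nat" where
  "cut_column \<kappa> x = (GREATEST j. \<exists>k. bad_pair \<kappa> x j k)"

definition letter :: "(nat \<Rightarrow> nat) \<Rightarrow> (nat \<Rightarrow> nat \<Rightarrow> nat) \<Rightarrow> nat" where
  "letter \<kappa> x = (LEAST k. bad_pair \<kappa> x (cut_column \<kappa> x) k)"

definition flip :: "(nat \<Rightarrow> nat) \<Rightarrow> (nat \<Rightarrow> nat \<Rightarrow> nat) \<Rightarrow> nat \<Rightarrow> nat \<Rightarrow> nat" where
  "flip \<kappa> x = toggle (cut_column \<kappa> x) (letter \<kappa> x) x"

definition staircase :: "nat \<Rightarrow> nat \<Rightarrow> nat" where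
  "staircase n k = n - 1 - k"

context
  fixes n :: nat and \<mu> \<kappa> :: "nat \<Rightarrow> nat"
  assumes \<kappa>: "antimono \<kappa>" "\<And>k. n \<le> k \<Longrightarrow> \<kappa> k = 0"
begin

lemma bad_pair_bound:
  assumes "x \<in> gt n \<mu>" "bad_pair \<kappa> x j k"
  shows "j \<le> \<mu> 0"
proof (rule ccontr)
  assume "\<not> j \<le> \<mu> 0"
  moreover have "\<kappa> (Suc k) \<le> \<kappa> k" using \<kappa>(1) by (simp add: antimono_def)
  ultimately show False using assms by (simp add: bad_pair_def wt_above_top)
qed

context
  fixes x assumes x: "x \<in> gt n \<mu>" and bad: "\<not> good \<kappa> x"
begin

lemma bad_cut_letter: "bad_pair \<kappa> x (cut_column \<kappa> x) (letter \<kappa> x)"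
proof -
  have "\<exists>k. bad_pair \<kappa> x (cut_column \<kappa> x) k"
    unfolding cut_column_def by (rule GreatestI_ex_nat[where b = "\<mu> 0"]) (use bad bad_pair_bound[OF x] in \<open>auto simp: good_def\<close>)
  then show ?thesis unfolding letter_def by (rule LeastI_ex)
qed

lemma bad_pair_le_cut: "bad_pair \<kappa> x j k \<Longrightarrow> j \<le> cut_column \<kappa> x"
  unfolding cut_column_def by (rule Greatest_le_nat[where b = "\<mu> 0"]) (use bad_pair_bound[OF x] in auto)

lemma letter_less: "Suc (letter \<kappa> x) < n"
proof (rule ccontr)
  let ?k = "letter \<kappa> x"
  assume "\<not> Suc ?k < n"
  then have "\<kappa> (Suc ?k) = 0" "wt_above (cut_column \<kappa> x) x (Suc ?k) = 0"
    using \<kappa>(2) gt_top[OF x] by (simp_all add: wt_above_def)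
  then show False using bad_cut_letter by (simp add: bad_pair_def)
qed

text \<open>One column to the right the pair of letters is in order, and a single column contains each
  letter at most once. So the violation is by exactly one, and the cut column does not contain the
  smaller letter.\<close>

lemma letter_column:
  "column_free (cut_column \<kappa> x) (letter \<kappa> x) x"
  "\<kappa> (letter \<kappa> x) + wt_above (cut_column \<kappa> x) x (letter \<kappa> x) + 1 = \<kappa> (Suc (letter \<kappa> x)) + wt_above (cut_column \<kappa> x) x (Suc (letter \<kappa> x))"
proof -
  let ?j = "cut_column \<kappa> x" and ?k = "letter \<kappa> x"
  have 1: "\<not> bad_pair \<kappa> x (Suc ?j) ?k" using bad_pair_le_cut[of "Suc ?j" ?k] by auto
  have 2: "column_count ?j x (Suc ?k) \<le> 1" by (rule column_count_le_1[OF x])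
  have "column_count ?j x ?k = 0 \<and> \<kappa> ?k + wt_above ?j x ?k + 1 = \<kappa> (Suc ?k) + wt_above ?j x (Suc ?k)"
    using bad_cut_letter 1 2 wt_above_step[OF x, of ?j ?k] wt_above_step[OF x, of ?j "Suc ?k"]
    unfolding bad_pair_def by linarith
  then show "column_free ?j ?k x" "\<kappa> ?k + wt_above ?j x ?k + 1 = \<kappa> (Suc ?k) + wt_above ?j x (Suc ?k)"
    using column_count_0[OF x] by auto
qed

lemma flip_gt: "flip \<kappa> x \<in> gt n \<mu>"
  unfolding flip_def by (rule toggle_gt[OF x letter_less])

lemma flip_above: "cut_column \<kappa> x \<le> j \<Longrightarrow> wt_above j (flip \<kappa> x) k = wt_above j x k"
  unfolding flip_def by (rule toggle_above[OF x letter_less])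

lemma flip_bad_pair: "cut_column \<kappa> x \<le> j \<Longrightarrow> bad_pair \<kappa> (flip \<kappa> x) j k \<longleftrightarrow> bad_pair \<kappa> x j k"
  by (simp add: bad_pair_def flip_above)

lemma flip_bad: "\<not> good \<kappa> (flip \<kappa> x)"
  using bad_cut_letter flip_bad_pair[of "cut_column \<kappa> x"] by (auto simp: good_def)

lemma flip_cut: "cut_column \<kappa> (flip \<kappa> x) = cut_column \<kappa> x"
  unfolding cut_column_def[of _ "flip \<kappa> x"]
proof (rule Greatest_equality)
  show "\<exists>k. bad_pair \<kappa> (flip \<kappa> x) (cut_column \<kappa> x) k" using bad_cut_letter flip_bad_pair by auto
  show "j \<le> cut_column \<kappa> x" if "\<exists>k. bad_pair \<kappa> (flip \<kappa> x) j k" for j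
    using that flip_bad_pair[of j] bad_pair_le_cut[of j] by (meson linear)
qed

lemma flip_letter: "letter \<kappa> (flip \<kappa> x) = letter \<kappa> x"
  unfolding letter_def flip_cut using flip_bad_pair[OF order_refl] by presburger

lemma flip_flip: "flip \<kappa> (flip \<kappa> x) = x"
  unfolding flip_def[of _ "flip \<kappa> x"] flip_cut flip_letter
  unfolding flip_def by (rule toggle_toggle[OF x letter_less])

text \<open>The violation by one cancels against the step of the staircase. Hence the flip exchanges two
  exponents of the alternant.\<close>

lemma flip_alternant:
  "alternant n (\<lambda>k. \<kappa> k + staircase n k + wt (flip \<kappa> x) k) = - alternant n (\<lambda>k. \<kappa> k + staircase n k + wt x k)"
proof -
  let ?j = "cut_column \<kappa> x" and ?k = "letter \<kappa> x" and ?y = "flip \<kappa> x"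
  let ?\<alpha> = "\<lambda>x k. \<kappa> k + staircase n k + wt x k"
  have "?\<alpha> ?y l = (?\<alpha> x \<circ> Transposition.transpose ?k (Suc ?k)) l" if "l < n" for l
  proof -
    have w: "wt x l = wt_below ?j x l + wt_above ?j x l" "wt ?y l = wt_below ?j ?y l + wt_above ?j x l" for l
      using wt_split[OF x] wt_split[OF flip_gt, where j = ?j] flip_above[OF order_refl] by simp_all
    have st: "staircase n ?k = staircase n (Suc ?k) + 1" using letter_less by (simp add: staircase_def)
    have b: "wt_below ?j ?y ?k = wt_below ?j x (Suc ?k)" "wt_below ?j ?y (Suc ?k) = wt_below ?j x ?k"
      "l \<noteq> ?k \<Longrightarrow> l \<noteq> Suc ?k \<Longrightarrow> wt_below ?j ?y l = wt_below ?j x l"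
      using toggle_below[OF x letter_less letter_column(1), folded flip_def] by auto
    consider "l = ?k" | "l = Suc ?k" | "l \<noteq> ?k" "l \<noteq> Suc ?k" by blast
    then show ?thesis
      by cases (use w st b letter_column(2) in auto)
  qed
  then have "alternant n (?\<alpha> ?y) = alternant n (?\<alpha> x \<circ> Transposition.transpose ?k (Suc ?k))" by (rule alternant_cong)
  also have "\<dots> = - alternant n (?\<alpha> x)"
    by (rule alternant_transpose) (use letter_less in auto)
  finally show ?thesis .
qed

end

text \<open>Flipping is a sign-reversing involution of the patterns that are not good.\<close>

theorem alternant_times_pattern_sum:
  assumes "finite (gt n \<mu>)"
  shows "alternant n (\<lambda>k. \<kappa> k + staircase n k) * (\<Sum>x\<in>gt n \<mu>. monomial n (wt x)) =
    (\<Sum>x\<in>{x \<in> gt n \<mu>. good \<kappa> x}. alternant n (\<lambda>k. \<kappa> k + staircase n k + wt x k))"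
proof -
  let ?\<alpha> = "\<lambda>x k. \<kappa> k + staircase n k + wt x k"
  let ?B = "{x \<in> gt n \<mu>. \<not> good \<kappa> x}"
  have "bij_betw (flip \<kappa>) ?B ?B"
    by (rule bij_betw_byWitness[where f' = "flip \<kappa>"]) (auto simp: flip_flip flip_gt flip_bad)
  then have "(\<Sum>x\<in>?B. alternant n (?\<alpha> x)) = (\<Sum>x\<in>?B. alternant n (?\<alpha> (flip \<kappa> x)))"
    by (rule sum.reindex_bij_betw[symmetric])
  also have "\<dots> = - (\<Sum>x\<in>?B. alternant n (?\<alpha> x))"
    unfolding sum_negf[symmetric] by (rule sum.cong) (auto simp: flip_alternant)
  finally have "2 * (\<Sum>x\<in>?B. alternant n (?\<alpha> x)) = 0" by (simp add: eq_neg_iff_add_eq_0 mult_2)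
  then have "(\<Sum>x\<in>?B. alternant n (?\<alpha> x)) = 0" by simp
  moreover have "(\<Sum>x\<in>gt n \<mu>. alternant n (?\<alpha> x)) =
      (\<Sum>x\<in>{x \<in> gt n \<mu>. good \<kappa> x}. alternant n (?\<alpha> x)) + (\<Sum>x\<in>?B. alternant n (?\<alpha> x))"
    using assms by (subst sum.union_disjoint[symmetric]) (auto intro!: sum.cong)
  ultimately show ?thesis by (simp add: alternant_times_sum)
qed

end

section \<open>Tableaux and patterns\<close>

lemma partition_antimono: "is_partition \<mu> \<Longrightarrow> antimono \<mu>"
  by (simp add: is_partition_def)

lemma finite_cells:
  assumes "is_partition \<mu>"
  shows "finite (cells \<mu>)"
proof -
  have "cells \<mu> \<subseteq> Sigma {i. \<mu> i \<noteq> 0} (\<lambda>i. {..<\<mu> i})" by (auto simp: cells_def)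
  then show ?thesis by (rule finite_subset) (use assms in \<open>simp add: is_partition_def\<close>)
qed

definition pattern_of :: "(nat \<Rightarrow> nat) \<Rightarrow> (nat \<times> nat \<Rightarrow> nat) \<Rightarrow> nat \<Rightarrow> nat \<Rightarrow> nat" where
  "pattern_of \<mu> T k i = card {j. j < \<mu> i \<and> T (i, j) < k}"

definition tableau_of :: "(nat \<Rightarrow> nat) \<Rightarrow> (nat \<Rightarrow> nat \<Rightarrow> nat) \<Rightarrow> nat \<times> nat \<Rightarrow> nat" where
  "tableau_of \<mu> x = restrict (\<lambda>(i, j). LEAST k. j < x (Suc k) i) (cells \<mu>)"

lemma ssyt_row_mono:
  assumes "T \<in> ssyt n \<mu>" "j \<le> j'" "j' < \<mu> i"
  shows "T (i, j) \<le> T (i, j')"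
  using assms(2,3)
proof (induction j' rule: dec_induct)
  case (step l)
  then have "T (i, l) \<le> T (i, Suc l)" using assms(1) by (auto simp: ssyt_def cells_def)
  then show ?case using step by simp
qed simp

lemma pattern_of_less:
  assumes "T \<in> ssyt n \<mu>" "j < \<mu> i"
  shows "T (i, j) < k \<longleftrightarrow> j < pattern_of \<mu> T k i"
proof -
  let ?A = "{j. j < \<mu> i \<and> T (i, j) < k}"
  have down: "j \<in> ?A" if "j' \<in> ?A" "j \<le> j'" for j j'
    using that ssyt_row_mono[OF assms(1), of j j' i] by auto
  have fin: "finite ?A" by simp
  show ?thesis
  proof
    assume "T (i, j) < k"
    then have "{..j} \<subseteq> ?A" using assms(2) down by auto
    then have "card {..j} \<le> card ?A" using fin by (intro card_mono)
    then show "j < pattern_of \<mu> T k i" by (simp add: pattern_of_def)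
  next
    assume *: "j < pattern_of \<mu> T k i"
    show "T (i, j) < k"
    proof (rule ccontr)
      assume "\<not> T (i, j) < k"
      then have "?A \<subseteq> {..<j}" using down[of _ j] assms(2) by (auto simp: not_less[symmetric])
      then have "card ?A \<le> card {..<j}" by (intro card_mono) auto
      then show False using * by (simp add: pattern_of_def)
    qed
  qed
qed

lemma pattern_of_gt:
  assumes T: "T \<in> ssyt n \<mu>" and \<mu>: "is_partition \<mu>"
  shows "pattern_of \<mu> T \<in> gt n \<mu>"
proof -
  have "pattern_of \<mu> T (Suc k) (Suc i) \<le> pattern_of \<mu> T k i" for k i
  proof -
    have "j < \<mu> i \<and> T (i, j) < k" if "j < \<mu> (Suc i)" "T (Suc i, j) < Suc k" for j
    proof -
      have "\<mu> (Suc i) \<le> \<mu> i" using partition_antimono[OF \<mu>] by (rule antimonoD) simp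
      then have "j < \<mu> i" using that by simp
      then have "T (i, j) < T (Suc i, j)" using T that by (auto simp: ssyt_def cells_def)
      then show ?thesis using that \<open>j < \<mu> i\<close> by simp
    qed
    then show ?thesis unfolding pattern_of_def by (intro card_mono) auto
  qed
  moreover have "pattern_of \<mu> T k i \<le> pattern_of \<mu> T (Suc k) i" for k i
    unfolding pattern_of_def by (intro card_mono) auto
  moreover have "pattern_of \<mu> T k = \<mu>" if "n \<le> k" for k
  proof
    fix i
    have "T (i, j) < k" if "j < \<mu> i" for j
      using T that \<open>n \<le> k\<close> by (fastforce simp: ssyt_def cells_def PiE_def Pi_def)
    then have "{j. j < \<mu> i \<and> T (i, j) < k} = {..<\<mu> i}" by auto
    then show "pattern_of \<mu> T k i = \<mu> i" by (simp add: pattern_of_def)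
  qed
  ultimately show ?thesis by (auto simp: gt_def pattern_of_def[of _ _ 0])
qed

text \<open>The position \<open>(i, j)\<close> belongs to row \<open>k\<close> of the pattern exactly if its entry is smaller than
  \<open>k\<close>; the rows increase with \<open>k\<close>, so the least such \<open>k\<close> determines the entry.\<close>

lemma tableau_of_less:
  assumes x: "x \<in> gt n \<mu>" and j: "j < \<mu> i"
  shows "tableau_of \<mu> x (i, j) < k \<longleftrightarrow> j < x k i"
proof -
  have "n \<noteq> 0"
  proof
    assume "n = 0"
    then have "\<mu> = (\<lambda>_. 0)" using x by (auto simp: gt_def)
    then show False using j by simp
  qed
  then have "j < x (Suc (n - 1)) i" using gt_top[OF x, of n] j by simp
  then have least: "j < x (Suc (tableau_of \<mu> x (i, j))) i"
    using j unfolding tableau_of_def by (simp add: cells_def) (rule LeastI)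
  show ?thesis
  proof
    assume "tableau_of \<mu> x (i, j) < k"
    then show "j < x k i" using least gt_mono[OF x, of "Suc (tableau_of \<mu> x (i, j))" k i] by simp
  next
    assume *: "j < x k i"
    then have "k \<noteq> 0" using x by (intro notI) (simp add: gt_def)
    then have "j < x (Suc (k - 1)) i" using * by simp
    then have "tableau_of \<mu> x (i, j) \<le> k - 1"
      using j unfolding tableau_of_def by (simp add: cells_def Least_le)
    then show "tableau_of \<mu> x (i, j) < k" using \<open>k \<noteq> 0\<close> by simp
  qed
qed

lemma tableau_of_ssyt:
  assumes x: "x \<in> gt n \<mu>" and \<mu>: "is_partition \<mu>"
  shows "tableau_of \<mu> x \<in> ssyt n \<mu>"
proof -
  have range: "tableau_of \<mu> x (i, j) < n" if "j < \<mu> i" for i j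
    using tableau_of_less[OF x that, of n] gt_top[OF x, of n] that by simp
  have row: "tableau_of \<mu> x (i, j) \<le> tableau_of \<mu> x (i, Suc j)" if "Suc j < \<mu> i" for i j
  proof -
    have "Suc j < x (Suc (tableau_of \<mu> x (i, Suc j))) i" using tableau_of_less[OF x that] by blast
    then have "tableau_of \<mu> x (i, j) < Suc (tableau_of \<mu> x (i, Suc j))" using tableau_of_less[OF x, of j i] that by simp
    then show ?thesis by simp
  qed
  have column: "tableau_of \<mu> x (i, j) < tableau_of \<mu> x (Suc i, j)" if "j < \<mu> i" "j < \<mu> (Suc i)" for i j
  proof -
    have "j < x (Suc (tableau_of \<mu> x (Suc i, j))) (Suc i)" using tableau_of_less[OF x that(2)] by blast
    also have "\<dots> \<le> x (tableau_of \<mu> x (Suc i, j)) i" by (rule gt_interlace(1)[OF x])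
    finally show ?thesis using tableau_of_less[OF x that(1)] by blast
  qed
  show ?thesis
    using range row column unfolding ssyt_def
    by (auto simp: cells_def PiE_def Pi_def extensional_def) (auto simp: tableau_of_def cells_def)
qed

lemma bij_pattern_of:
  assumes \<mu>: "is_partition \<mu>"
  shows "bij_betw (pattern_of \<mu>) (ssyt n \<mu>) (gt n \<mu>)"
proof (rule bij_betw_byWitness[where f' = "tableau_of \<mu>"])
  show "\<forall>T\<in>ssyt n \<mu>. tableau_of \<mu> (pattern_of \<mu> T) = T"
  proof (intro ballI ext)
    fix T and b :: "nat \<times> nat" assume T: "T \<in> ssyt n \<mu>"
    obtain i j where b: "b = (i, j)" by (cases b)
    show "tableau_of \<mu> (pattern_of \<mu> T) b = T b"
    proof (cases "j < \<mu> i")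
      case True
      have "tableau_of \<mu> (pattern_of \<mu> T) b < k \<longleftrightarrow> T b < k" for k
        unfolding b using tableau_of_less[OF pattern_of_gt[OF T \<mu>] True] pattern_of_less[OF T True] by simp
      then show ?thesis by (metis less_irrefl nat_neq_iff)
    next
      case False
      then show ?thesis using T by (auto simp: b ssyt_def PiE_def extensional_def cells_def tableau_of_def)
    qed
  qed
  show "\<forall>x\<in>gt n \<mu>. pattern_of \<mu> (tableau_of \<mu> x) = x"
  proof (intro ballI ext)
    fix x k i assume x: "x \<in> gt n \<mu>"
    have "{j. j < \<mu> i \<and> tableau_of \<mu> x (i, j) < k} = {..<x k i}"
      using tableau_of_less[OF x] gt_le[OF x, of k i] by auto
    then show "pattern_of \<mu> (tableau_of \<mu> x) k i = x k i" by (simp add: pattern_of_def)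
  qed
qed (auto simp: pattern_of_gt[OF _ \<mu>] tableau_of_ssyt[OF _ \<mu>])

lemma finite_gt:
  assumes "is_partition \<mu>"
  shows "finite (gt n \<mu>)"
proof -
  have "ssyt n \<mu> \<subseteq> cells \<mu> \<rightarrow>\<^sub>E {..<n}" by (auto simp: ssyt_def)
  then have "finite (ssyt n \<mu>)" by (rule finite_subset) (simp add: finite_PiE finite_cells[OF assms])
  then show ?thesis using bij_betw_finite[OF bij_pattern_of[OF assms]] by blast
qed

text \<open>The letters \<open>k\<close> of the tableau fill the intervals between consecutive rows of the pattern, and
  \<open>wt\<close> is the sum of their lengths.\<close>

lemma prod_mvar:
  assumes T: "T \<in> ssyt n \<mu>" and \<mu>: "is_partition \<mu>"
  shows "(\<Prod>b\<in>cells \<mu>. mvar (T b)) = monomial n (wt (pattern_of \<mu> T))"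
proof -
  let ?x = "pattern_of \<mu> T"
  note x = pattern_of_gt[OF T \<mu>]
  have "T ` cells \<mu> \<subseteq> {..<n}" using T by (auto simp: ssyt_def PiE_def Pi_def)
  then have "(\<Prod>b\<in>cells \<mu>. mvar (T b)) = (\<Prod>k<n. \<Prod>b\<in>{b \<in> cells \<mu>. T b = k}. mvar (T b))"
    by (intro prod.group[symmetric] finite_cells[OF \<mu>]) auto
  also have "\<dots> = (\<Prod>k<n. mvar k ^ card {b \<in> cells \<mu>. T b = k})"
    by (rule prod.cong) simp_all
  moreover have "card {b \<in> cells \<mu>. T b = k} = wt ?x k" for k
  proof -
    have "{b \<in> cells \<mu>. T b = k} = Sigma {..k} (\<lambda>i. {?x k i..<?x (Suc k) i})"
    proof -
      have e: "j < \<mu> i \<and> T (i, j) = k \<longleftrightarrow> i \<le> k \<and> ?x k i \<le> j \<and> j < ?x (Suc k) i" for i j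
      proof (cases "j < \<mu> i")
        case True
        have "T (i, j) = k \<longleftrightarrow> T (i, j) < Suc k \<and> \<not> T (i, j) < k" by auto
        moreover have "i \<le> k" if "j < ?x (Suc k) i" using that gt_zero[OF x, of "Suc k" i] by (cases "i \<le> k") auto
        moreover note pattern_of_less[OF T True, of "Suc k"] pattern_of_less[OF T True, of k]
        ultimately show ?thesis using True by (meson not_less)
      next
        case False
        then show ?thesis using gt_le[OF x, of "Suc k" i] by auto
      qed
      show ?thesis
      proof (rule set_eqI)
        fix b :: "nat \<times> nat"
        obtain i j where "b = (i, j)" by (cases b)
        then show "b \<in> {b \<in> cells \<mu>. T b = k} \<longleftrightarrow> b \<in> Sigma {..k} (\<lambda>i. {?x k i..<?x (Suc k) i})"
          using e[of j i] by (simp add: cells_def)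
      qed
    qed
    then show ?thesis by (simp add: wt_def)
  qed
  ultimately show ?thesis by (simp add: monomial_def)
qed

lemma schur_eq_pattern_sum:
  assumes "is_partition \<mu>"
  shows "schur n \<mu> = (\<Sum>x\<in>gt n \<mu>. monomial n (wt x))"
  unfolding schur_def sum.reindex_bij_betw[OF bij_pattern_of[OF assms], symmetric]
  by (rule sum.cong) (simp_all add: prod_mvar[OF _ assms])

section \<open>Row conditions\<close>

text \<open>Here \<open>a\<close>, \<open>b\<close>, \<open>c\<close> are three consecutive rows of a pattern. The condition at a column \<open>j\<close>
  between \<open>b i\<close> and \<open>b (i - 1)\<close> involves only the rows of the tableau up to the \<open>i\<close>-th, and among
  these columns it is sharpest at the ends of the interval. The conditions at the columns \<open>b i\<close> are
  the row conditions.\<close>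

lemma good_iff_rows_aux:
  fixes a b c :: "nat \<Rightarrow> int" and p q :: int
  assumes ab: "\<And>i. a i \<le> b i" "\<And>i. b (Suc i) \<le> a i" and bc: "\<And>i. b i \<le> c i" "\<And>i. c (Suc i) \<le> b i"
    and zero: "a N = 0" "b N = 0" "c (Suc N) = 0" "\<And>i. 0 \<le> a i"
  shows "(\<forall>j\<ge>0. q + (\<Sum>i\<le>N. max (c i) j - max (b i) j) \<le> p + (\<Sum>i\<le>N. max (b i) j - max (a i) j)) \<longleftrightarrow>
     (\<forall>i\<le>N. q + (\<Sum>m\<le>i. c m - b m) \<le> p + (\<Sum>m<i. b m - a m))"
proof -
  have b_dec: "b j \<le> b i" if "i \<le> j" for i j
    using that by (rule lift_Suc_antimono_le[rotated]) (use ab in \<open>meson order_trans\<close>)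
  \<comment> \<open>the column condition at \<open>j\<close> when \<open>i\<close> rows of the middle shape are longer than \<open>j\<close>\<close>
  have sums: "(\<Sum>m\<le>N. max (c m) j - max (b m) j) = (\<Sum>m<i. c m - b m) + (max (c i) j - j)"
    "(\<Sum>m\<le>N. max (b m) j - max (a m) j) = (\<Sum>m<i. b m - max (a m) j)"
    if i: "i \<le> N" "b i \<le> j" "\<And>m. m < i \<Longrightarrow> j \<le> b m" for i j
  proof -
    have *: "(\<Sum>m\<le>N. f m) = (\<Sum>m<i. f m) + f i" if "\<And>m. i < m \<Longrightarrow> f m = 0" for f :: "nat \<Rightarrow> int"
    proof -
      have "(\<Sum>m\<le>N. f m) = (\<Sum>m\<le>i. f m)" using i(1) that by (intro sum.mono_neutral_right) auto
      then show ?thesis by (simp add: lessThan_Suc_atMost[symmetric])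
    qed
    have c0: "max (c m) j - max (b m) j = 0" if "i < m" for m
    proof -
      have "c m \<le> b (m - 1)" "b m \<le> c m" using bc(2)[of "m - 1"] bc(1) that by simp_all
      moreover have "b (m - 1) \<le> b i" using that by (intro b_dec) simp
      ultimately show ?thesis using i(2) by simp
    qed
    have b0: "max (b m) j - max (a m) j = 0" if "i \<le> m" for m
      using ab(1)[of m] b_dec[OF that] i(2) by simp
    have "(\<Sum>m<i. max (c m) j - max (b m) j) = (\<Sum>m<i. c m - b m)"
    proof (rule sum.cong)
      fix m assume "m \<in> {..<i}"
      then show "max (c m) j - max (b m) j = c m - b m" using i(3)[of m] bc(1)[of m] by simp
    qed simp
    then show "(\<Sum>m\<le>N. max (c m) j - max (b m) j) = (\<Sum>m<i. c m - b m) + (max (c i) j - j)"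
      using i(2) by (subst *) (simp_all add: c0)
    have "(\<Sum>m<i. max (b m) j - max (a m) j) = (\<Sum>m<i. b m - max (a m) j)"
      using i(3) by (intro sum.cong) auto
    then show "(\<Sum>m\<le>N. max (b m) j - max (a m) j) = (\<Sum>m<i. b m - max (a m) j)"
      using b0[of i] by (subst *) (simp_all add: b0)
  qed
  show ?thesis
  proof (intro iffI allI impI)
    fix i assume col: "\<forall>j\<ge>0. q + (\<Sum>i\<le>N. max (c i) j - max (b i) j) \<le> p + (\<Sum>i\<le>N. max (b i) j - max (a i) j)"
      and i: "i \<le> N"
    have "0 \<le> b i" using zero(4) ab(1) order_trans by blast
    then have "q + ((\<Sum>m<i. c m - b m) + (max (c i) (b i) - b i)) \<le> p + (\<Sum>m<i. b m - max (a m) (b i))"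
    proof -
      have *: "b i \<le> b m" if "m < i" for m using that by (intro b_dec) simp
      from col \<open>0 \<le> b i\<close> have "q + (\<Sum>m\<le>N. max (c m) (b i) - max (b m) (b i)) \<le> p + (\<Sum>m\<le>N. max (b m) (b i) - max (a m) (b i))"
        by blast
      moreover note sums(1)[OF i order_refl *] sums(2)[OF i order_refl *]
      ultimately show ?thesis by simp
    qed
    moreover have "(\<Sum>m<i. b m - max (a m) (b i)) = (\<Sum>m<i. b m - a m)"
    proof (rule sum.cong)
      fix m assume "m \<in> {..<i}"
      then have "b i \<le> b (Suc m)" by (intro b_dec) simp
      then show "b m - max (a m) (b i) = b m - a m" using ab(2)[of m] by simp
    qed simp
    ultimately show "q + (\<Sum>m\<le>i. c m - b m) \<le> p + (\<Sum>m<i. b m - a m)"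
      using bc(1)[of i] by (simp add: lessThan_Suc_atMost[symmetric])
  next
    fix j :: int assume rows: "\<forall>i\<le>N. q + (\<Sum>m\<le>i. c m - b m) \<le> p + (\<Sum>m<i. b m - a m)" and j: "0 \<le> j"
    define i where "i = (LEAST i. b i \<le> j)"
    have ex: "b N \<le> j" using zero j by simp
    have i: "b i \<le> j" "i \<le> N" unfolding i_def using ex by (rule LeastI, rule Least_le)
    have less: "j < b m" if "m < i" for m using not_less_Least[of m "\<lambda>i. b i \<le> j"] that by (simp add: i_def)
    have R: "q + (\<Sum>m<i. c m - b m) + (c i - b i) \<le> p + (\<Sum>m<i. b m - a m)"
      using rows i(2) by (simp add: lessThan_Suc_atMost[symmetric] add.assoc)
    have goal: "q + ((\<Sum>m<i. c m - b m) + (max (c i) j - j)) \<le> p + (\<Sum>m<i. b m - max (a m) j)"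
    proof (cases i)
      case 0
      then show ?thesis using R i(1) bc(1)[of 0] by (simp add: max_def)
    next
      case (Suc l)
      have R': "q + (\<Sum>m<i. c m - b m) \<le> p + (\<Sum>m<l. b m - a m)"
        using rows i(2) Suc by (simp add: lessThan_Suc_atMost)
      have "(\<Sum>m<l. b m - max (a m) j) = (\<Sum>m<l. b m - a m)"
      proof (rule sum.cong)
        fix m assume "m \<in> {..<l}"
        then have "j < b (Suc m)" using Suc by (intro less) simp
        then show "b m - max (a m) j = b m - a m" using ab(2)[of m] by simp
      qed simp
      then have "(\<Sum>m<i. b m - max (a m) j) = (\<Sum>m<l. b m - a m) + b l - max (a l) j" by (simp add: Suc)
      moreover have "(\<Sum>m<i. b m - a m) = (\<Sum>m<l. b m - a m) + b l - a l" by (simp add: Suc)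
      moreover have "j < b l" "b i \<le> a l" "b i \<le> c i" using less[of l] ab(2)[of l] bc(1)[of i] Suc by auto
      ultimately show ?thesis using R R' i(1) by (simp add: max_def)
    qed
    show "q + (\<Sum>i\<le>N. max (c i) j - max (b i) j) \<le> p + (\<Sum>i\<le>N. max (b i) j - max (a i) j)"
      using goal sums[OF i(2,1)] less by (simp add: less_imp_le)
  qed
qed

text \<open>The row conditions are the rhombus inequalities of the remaining type; interlacing supplies
  the other two types.\<close>

lemma good_iff_rows:
  assumes x: "x \<in> gt n \<mu>"
  shows "good \<kappa> x \<longleftrightarrow> (\<forall>k. \<forall>i\<le>Suc k. \<kappa> (Suc k) + (\<Sum>m\<le>i. x (Suc (Suc k)) m - x (Suc k) m) \<le> \<kappa> k + (\<Sum>m<i. x (Suc k) m - x k m))"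
proof -
  have "(\<forall>j. \<not> bad_pair \<kappa> x j k) \<longleftrightarrow>
      (\<forall>i\<le>Suc k. \<kappa> (Suc k) + (\<Sum>m\<le>i. x (Suc (Suc k)) m - x (Suc k) m) \<le> \<kappa> k + (\<Sum>m<i. x (Suc k) m - x k m))" for k
  proof -
    let ?a = "\<lambda>i. int (x k i)" and ?b = "\<lambda>i. int (x (Suc k) i)" and ?c = "\<lambda>i. int (x (Suc (Suc k)) i)"
    have z: "x k (Suc k) = 0" "x (Suc k) (Suc k) = 0" using gt_zero[OF x] by auto
    have 1: "int (wt_above j x k) = (\<Sum>i\<le>Suc k. max (?b i) (int j) - max (?a i) (int j))" for j
    proof -
      have "int (wt_above j x k) = (\<Sum>i\<le>k. max (?b i) (int j) - max (?a i) (int j))"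
        unfolding wt_above_def of_nat_sum
        by (rule sum.cong) (use gt_interlace(2)[OF x] in \<open>auto simp: of_nat_diff max.coboundedI1\<close>)
      then show ?thesis by (simp add: z)
    qed
    have 2: "int (wt_above j x (Suc k)) = (\<Sum>i\<le>Suc k. max (?c i) (int j) - max (?b i) (int j))" for j
      unfolding wt_above_def of_nat_sum
      by (rule sum.cong) (use gt_interlace(2)[OF x] in \<open>auto simp: of_nat_diff max.coboundedI1\<close>)
    have 3: "int (\<Sum>m\<le>i. x (Suc (Suc k)) m - x (Suc k) m) = (\<Sum>m\<le>i. ?c m - ?b m)"
      "int (\<Sum>m<i. x (Suc k) m - x k m) = (\<Sum>m<i. ?b m - ?a m)" for i
      unfolding of_nat_sum using gt_interlace(2)[OF x] by (simp_all add: of_nat_diff)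
    have "(\<forall>j. \<not> bad_pair \<kappa> x j k) \<longleftrightarrow> (\<forall>j\<ge>0. int (\<kappa> (Suc k)) + (\<Sum>i\<le>Suc k. max (?c i) j - max (?b i) j)
        \<le> int (\<kappa> k) + (\<Sum>i\<le>Suc k. max (?b i) j - max (?a i) j))"
    proof -
      have all: "(\<forall>j. Q (int j)) \<longleftrightarrow> (\<forall>j\<ge>0. Q j)" for Q by (metis nonneg_int_cases of_nat_0_le_iff)
      show ?thesis unfolding bad_pair_def not_less zle_int[symmetric] of_nat_add 1 2 by (rule all)
    qed
    also have "\<dots> \<longleftrightarrow> (\<forall>i\<le>Suc k. int (\<kappa> (Suc k)) + (\<Sum>m\<le>i. ?c m - ?b m) \<le> int (\<kappa> k) + (\<Sum>m<i. ?b m - ?a m))"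
      by (rule good_iff_rows_aux) (use gt_interlace[OF x] gt_zero[OF x] in auto)
    finally show ?thesis unfolding 3[symmetric] of_nat_add[symmetric] zle_int .
  qed
  then show ?thesis unfolding good_def by blast
qed

section \<open>Partitions\<close>

lemma partition_support:
  assumes "is_partition \<mu>"
  shows "{i. \<mu> i \<noteq> 0} = {..<part_length \<mu>}"
proof -
  have fin: "finite {i. \<mu> i \<noteq> 0}" and anti: "antimono \<mu>" using assms by (auto simp: is_partition_def)
  have down: "\<mu> i \<noteq> 0" if "\<mu> j \<noteq> 0" "i \<le> j" for i j
    using antimonoD[OF anti that(2)] that(1) by simp
  show ?thesis
  proof (cases "{i. \<mu> i \<noteq> 0} = {}")
    case False
    define m where "m = Max {i. \<mu> i \<noteq> 0}"
    have "\<mu> m \<noteq> 0" using Max_in[OF fin False] by (simp add: m_def)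
    moreover have "i \<le> m" if "\<mu> i \<noteq> 0" for i using Max_ge[OF fin] that by (simp add: m_def)
    ultimately have "\<mu> i \<noteq> 0 \<longleftrightarrow> i < Suc m" for i using down[of m i] less_Suc_eq_le[of i m] by blast
    then have "{i. \<mu> i \<noteq> 0} = {..<Suc m}" by blast
    then show ?thesis by (simp add: part_length_def)
  qed (simp add: part_length_def)
qed

lemma part_length_le_iff:
  assumes "is_partition \<mu>"
  shows "part_length \<mu> \<le> n \<longleftrightarrow> (\<forall>k\<ge>n. \<mu> k = 0)"
proof -
  have "(\<mu> k \<noteq> 0) \<longleftrightarrow> k < part_length \<mu>" for k using partition_support[OF assms] by blast
  then show ?thesis by (metis le_less_trans less_le_not_le not_le order_refl)
qed

lemma part_size_eq_sum:
  assumes "\<And>k. n \<le> k \<Longrightarrow> \<mu> k = 0"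
  shows "part_size \<mu> = (\<Sum>k<n. \<mu> k)"
proof -
  have "{i. \<mu> i \<noteq> 0} \<subseteq> {..<n}" using assms by (metis (mono_tags, lifting) lessThan_iff mem_Collect_eq not_le subsetI)
  then show ?thesis unfolding part_size_def by (intro sum.mono_neutral_left) auto
qed

lemma part_le_size:
  assumes "is_partition \<mu>"
  shows "\<mu> i \<le> part_size \<mu>"
proof (cases "\<mu> i = 0")
  case False
  then show ?thesis unfolding part_size_def
    by (intro member_le_sum) (use assms in \<open>auto simp: is_partition_def\<close>)
qed simp

lemma part_length_le_size:
  assumes "is_partition \<mu>"
  shows "part_length \<mu> \<le> part_size \<mu>"
  unfolding part_length_def part_size_def card_eq_sum by (rule sum_mono) auto

lemma partitions_of_zero:
  assumes "\<nu> \<in> partitions_of m" "m \<le> k"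
  shows "\<nu> k = 0"
proof -
  have "part_length \<nu> \<le> m" using assms part_length_le_size by (auto simp: partitions_of_def)
  then show ?thesis using assms part_length_le_iff by (auto simp: partitions_of_def)
qed

lemma finite_partitions_of: "finite (partitions_of m)"
proof -
  have "finite {f. \<forall>i. (i \<in> {..<m} \<longrightarrow> f i \<in> {..m}) \<and> (i \<notin> {..<m} \<longrightarrow> f i = (0::nat))}"
    by (rule finite_set_of_finite_funs) simp_all
  moreover have "partitions_of m \<subseteq> {f. \<forall>i. (i \<in> {..<m} \<longrightarrow> f i \<in> {..m}) \<and> (i \<notin> {..<m} \<longrightarrow> f i = (0::nat))}"
    using partitions_of_zero part_le_size by (auto simp: partitions_of_def not_less)
  ultimately show ?thesis by (rule rev_finite_subset)
qed

section \<open>Linear independence of alternants\<close>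

definition exponent :: "nat \<Rightarrow> (nat \<Rightarrow> nat) \<Rightarrow> (nat \<Rightarrow>\<^sub>0 nat)" where
  "exponent n f = (\<Sum>k<n. Poly_Mapping.single k (f k))"

lemma lookup_of_int_mult:
  fixes p :: "'a::monoid_add \<Rightarrow>\<^sub>0 int"
  shows "Poly_Mapping.lookup (of_int s * p) k = s * Poly_Mapping.lookup p k"
proof (induction s rule: int_induct[where k = 0])
  case (step1 i)
  then show ?case by (simp add: distrib_right Poly_Mapping.lookup_add)
next
  case (step2 i)
  then show ?case by (simp add: left_diff_distrib Poly_Mapping.lookup_minus)
qed simp

lemma lookup_exponent: "Poly_Mapping.lookup (exponent n f) k = (if k < n then f k else 0)"
proof -
  have "Poly_Mapping.lookup (exponent n f) k = (\<Sum>l<n. Poly_Mapping.lookup (Poly_Mapping.single l (f l)) k)"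
    by (simp add: exponent_def Poly_Mapping.lookup_sum)
  also have "\<dots> = (\<Sum>l<n. if l = k then f k else 0)" by (rule sum.cong) (auto simp: Poly_Mapping.lookup_single when_def)
  also have "\<dots> = (if k < n then f k else 0)" by simp
  finally show ?thesis .
qed

lemma exponent_eq_iff: "exponent n f = exponent n g \<longleftrightarrow> (\<forall>k<n. f k = g k)"
proof
  assume "exponent n f = exponent n g"
  then have "Poly_Mapping.lookup (exponent n f) k = Poly_Mapping.lookup (exponent n g) k" for k by simp
  then show "\<forall>k<n. f k = g k" unfolding lookup_exponent by (metis (full_types))
next
  assume "\<forall>k<n. f k = g k"
  then show "exponent n f = exponent n g" by (simp add: exponent_def)
qed

lemma monomial_eq_single: "monomial n f = Poly_Mapping.single (exponent n f) 1"
proof (induction n)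
  case 0
  then show ?case by (simp add: monomial_def exponent_def)
next
  case (Suc n)
  have "mvar n ^ m = Poly_Mapping.single (Poly_Mapping.single n m) 1" for m
    by (induction m) (simp_all add: mvar_def mult_single single_add[symmetric])
  then show ?case using Suc by (simp add: monomial_def exponent_def mult_single add.commute)
qed

text \<open>A strictly increasing sequence of natural numbers satisfies \<open>i \<le> \<pi> i\<close>; both sides have the same
  sum.\<close>

lemma strict_mono_permutation:
  fixes \<pi> :: "nat \<Rightarrow> nat"
  assumes \<pi>: "\<pi> permutes {..<n}" and mono: "\<And>i j. i < j \<Longrightarrow> j < n \<Longrightarrow> \<pi> i < \<pi> j"
  shows "\<pi> = id"
proof -
  have ge: "i \<le> \<pi> i" if "i < n" for i :: nat
    using that
  proof (induction i)
    case (Suc i)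
    then show ?case using mono[of i "Suc i"] by simp
  qed simp
  have "(\<Sum>i<n. i) = (\<Sum>i<n. \<pi> i)" using sum.permute[OF \<pi>, of "\<lambda>i. i"] by (simp add: o_def)
  then have "i = \<pi> i" if "i < n" for i
    using sum_mono_inv[of "\<lambda>i. i" "{..<n}" \<pi> i] ge that by simp
  moreover have "\<pi> i = i" if "\<not> i < n" for i using \<pi> that by (simp add: permutes_def)
  ultimately have "\<pi> i = i" for i by (cases "i < n") simp_all
  then show ?thesis by (simp add: fun_eq_iff)
qed

text \<open>Two strictly decreasing sequences that are permutations of one another are equal, so the
  monomial of \<open>\<beta>\<close> occurs only for \<open>\<alpha> = \<beta>\<close> and the identity permutation.\<close>

lemma lookup_alternant:
  assumes \<alpha>: "\<And>i j. i < j \<Longrightarrow> j < n \<Longrightarrow> \<alpha> j < \<alpha> i" and \<beta>: "\<And>i j. i < j \<Longrightarrow> j < n \<Longrightarrow> \<beta> j < \<beta> i"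
  shows "Poly_Mapping.lookup (alternant n \<alpha>) (exponent n \<beta>) = (if \<forall>k<n. \<alpha> k = \<beta> k then 1 else 0)"
proof -
  have *: "s * (if b then 1 else 0) = (if b then s else 0)" for s :: int and b by simp
  have "Poly_Mapping.lookup (of_int s * monomial n f) (exponent n \<beta>) = (if \<forall>k<n. f k = \<beta> k then s else 0)" for s f
    unfolding lookup_of_int_mult monomial_eq_single Poly_Mapping.lookup_single when_def exponent_eq_iff
    by (rule *)
  then have "Poly_Mapping.lookup (alternant n \<alpha>) (exponent n \<beta>) =
      (\<Sum>\<pi> | \<pi> permutes {..<n}. if \<forall>k<n. \<alpha> (\<pi> k) = \<beta> k then sign \<pi> else 0)"
    by (simp add: alternant_def Poly_Mapping.lookup_sum)
  also have "\<dots> = (\<Sum>\<pi> | \<pi> permutes {..<n}. if \<pi> = id then (if \<forall>k<n. \<alpha> k = \<beta> k then 1 else 0) else 0)"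
  proof (rule sum.cong[OF refl])
    fix \<pi> assume "\<pi> \<in> {\<pi>. \<pi> permutes {..<n}}"
    then have \<pi>: "\<pi> permutes {..<n}" by simp
    have "\<pi> = id" if *: "\<forall>k<n. \<alpha> (\<pi> k) = \<beta> k"
    proof (rule strict_mono_permutation[OF \<pi>])
      fix i j assume ij: "i < j" "j < n"
      have "\<pi> i < n" "\<pi> j < n" using permutes_in_image[OF \<pi>] ij by auto
      have "\<alpha> (\<pi> j) < \<alpha> (\<pi> i)" using \<beta>[OF ij] * ij by simp
      then show "\<pi> i < \<pi> j" using \<alpha>[of "\<pi> j" "\<pi> i"] \<open>\<pi> i < n\<close> by (metis less_asym less_irrefl nat_neq_iff)
    qed
    then show "(if \<forall>k<n. \<alpha> (\<pi> k) = \<beta> k then sign \<pi> else 0) =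
      (if \<pi> = id then (if \<forall>k<n. \<alpha> k = \<beta> k then 1 else 0) else 0)" by auto
  qed
  also have "\<dots> = (if \<forall>k<n. \<alpha> k = \<beta> k then 1 else 0)"
    by (subst sum.delta) (simp_all add: finite_permutations permutes_id)
  finally show ?thesis .
qed

lemma staircase_strict:
  assumes "antimono \<nu>" "i < j" "j < n"
  shows "\<nu> j + staircase n j < \<nu> i + staircase n i"
  using antimonoD[OF assms(1), of i j] assms(2,3) by (simp add: staircase_def)

lemma lookup_partition_alternant:
  assumes "antimono \<nu>" "antimono \<nu>'"
  shows "Poly_Mapping.lookup (alternant n (\<lambda>k. \<nu> k + staircase n k)) (exponent n (\<lambda>k. \<nu>' k + staircase n k)) =
    (if \<forall>k<n. \<nu> k = \<nu>' k then 1 else 0)"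
  by (subst lookup_alternant) (use assms staircase_strict in auto)

lemma alternant_staircase_nonzero: "alternant n (staircase n) \<noteq> 0"
proof
  assume "alternant n (staircase n) = 0"
  then have "Poly_Mapping.lookup (alternant n (\<lambda>k. (\<lambda>_. 0) k + staircase n k)) (exponent n (\<lambda>k. (\<lambda>_. 0) k + staircase n k)) = 0"
    by (simp add: Poly_Mapping.lookup_zero)
  then show False by (subst (asm) lookup_partition_alternant) (simp_all add: antimono_def)
qed

section \<open>The bialternant formula\<close>

text \<open>The case \<open>\<kappa> = 0\<close> of the cancellation. Starting from the empty partition the only good pattern
  is the one of the tableau whose \<open>i\<close>-th row consists of letters \<open>i\<close>.\<close>

lemma bialternant:
  assumes \<mu>: "is_partition \<mu>" and len: "\<And>k. n \<le> k \<Longrightarrow> \<mu> k = 0"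
  shows "alternant n (staircase n) * schur n \<mu> = alternant n (\<lambda>k. \<mu> k + staircase n k)"
proof -
  let ?z = "\<lambda>_::nat. 0::nat"
  \<comment> \<open>the tableau whose \<open>i\<close>-th row consists of letters \<open>i\<close>\<close>
  define x0 where "x0 k i = (if i < k then \<mu> i else 0)" for k i
  have x0: "x0 \<in> gt n \<mu>"
    using antimonoD[OF partition_antimono[OF \<mu>], of i "Suc i" for i] len
    by (auto simp: gt_def x0_def fun_eq_iff not_less)
  have "good ?z x0"
    unfolding good_iff_rows[OF x0]
  proof (intro allI impI)
    fix k i assume "i \<le> Suc k"
    have "(\<Sum>m\<le>i. x0 (Suc (Suc k)) m - x0 (Suc k) m) = (\<Sum>m\<le>i. if m = Suc k then \<mu> (Suc k) else 0)"
      by (rule sum.cong) (auto simp: x0_def)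
    also have "\<dots> \<le> (\<Sum>m<i. if m = k then \<mu> k else 0)"
      using antimonoD[OF partition_antimono[OF \<mu>], of k "Suc k"] \<open>i \<le> Suc k\<close> by simp
    also have "\<dots> = (\<Sum>m<i. x0 (Suc k) m - x0 k m)"
      by (rule sum.cong) (auto simp: x0_def)
    finally show "0 + (\<Sum>m\<le>i. x0 (Suc (Suc k)) m - x0 (Suc k) m) \<le> 0 + (\<Sum>m<i. x0 (Suc k) m - x0 k m)" by simp
  qed
  have unique: "x = x0" if x: "x \<in> gt n \<mu>" and "good ?z x" for x
  proof -
    have const: "x (Suc k) i = x k i" if "i < k" for k i
      using that
    proof (induction i arbitrary: k rule: less_induct)
      case (less i)
      then obtain l where l: "k = Suc l" "i \<le> l" by (cases k) auto
      have "(\<Sum>m\<le>i. x (Suc (Suc l)) m - x (Suc l) m) \<le> (\<Sum>m<i. x (Suc l) m - x l m)"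
        using \<open>good ?z x\<close> l unfolding good_iff_rows[OF x] by simp
      also have "\<dots> = 0" using less.IH l by simp
      finally have "x (Suc (Suc l)) i - x (Suc l) i = 0" by simp
      then show ?case using gt_interlace(2)[OF x, of "Suc l" i] by (simp add: l)
    qed
    have "x l i = x k i" if "i < k" "k \<le> l" for i k l
      using that(2) by (induction rule: dec_induct) (use const that in auto)
    then have "x k i = \<mu> i" if "i < k" for i k
      using that gt_top[OF x, of "max k n"] by (metis max.cobounded1 max.cobounded2)
    then show ?thesis using gt_zero[OF x] by (auto simp: x0_def fun_eq_iff not_less)
  qed
  have goods: "{x \<in> gt n \<mu>. good ?z x} = {x0}" using x0 \<open>good ?z x0\<close> unique by blast
  have "wt x0 k = \<mu> k" for k
  proof -
    have "wt x0 k = (\<Sum>i\<le>k. if i = k then \<mu> k else 0)"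
      unfolding wt_def by (rule sum.cong) (auto simp: x0_def)
    then show ?thesis by simp
  qed
  then show ?thesis
    using alternant_times_pattern_sum[of ?z n \<mu>] finite_gt[OF \<mu>, of n]
    by (simp add: schur_eq_pattern_sum[OF \<mu>] goods antimono_def add.commute)
qed

section \<open>The Littlewood--Richardson rule\<close>

lemma schur_zero:
  assumes "is_partition \<nu>" "n \<le> k" "\<nu> k \<noteq> 0"
  shows "schur n \<nu> = 0"
proof -
  have "gt n \<nu> = {}" using gt_zero[of _ n \<nu> n k] gt_top[of _ n \<nu> n] assms by force
  then show ?thesis by (simp add: schur_eq_pattern_sum[OF assms(1)])
qed

definition lr_patterns :: "nat \<Rightarrow> (nat \<Rightarrow> nat) \<Rightarrow> (nat \<Rightarrow> nat) \<Rightarrow> (nat \<Rightarrow> nat) \<Rightarrow> (nat \<Rightarrow> nat \<Rightarrow> nat) set" where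
  "lr_patterns n \<kappa> \<mu> \<nu> = {x \<in> gt n \<mu>. good \<kappa> x \<and> (\<forall>k. \<kappa> k + wt x k = \<nu> k)}"

text \<open>If \<open>\<nu>\<close> has at most \<open>n\<close> parts, the letters from \<open>n\<close> on have weight zero and the corresponding
  rows of a pattern repeat.\<close>

lemma lr_patterns_stable:
  assumes "\<And>k. n \<le> k \<Longrightarrow> \<nu> k = 0" "n \<le> m"
  shows "lr_patterns m \<kappa> \<mu> \<nu> = lr_patterns n \<kappa> \<mu> \<nu>"
proof -
  have "x \<in> gt m \<mu> \<longleftrightarrow> x \<in> gt n \<mu>" if "\<forall>k. \<kappa> k + wt x k = \<nu> k" for x
  proof
    assume x: "x \<in> gt m \<mu>"
    have step: "x (Suc k) = x k" if "n \<le> k" for k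
    proof
      fix i
      have "wt x k = 0" using assms(1)[OF that] \<open>\<forall>k. _ = \<nu> k\<close> by (metis add_is_0)
      then have "x (Suc k) i - x k i = 0" if "i \<le> k" using that by (simp add: wt_def)
      then show "x (Suc k) i = x k i"
        using gt_interlace(2)[OF x, of k i] gt_zero[OF x, of "Suc k" i] gt_zero[OF x, of k i]
        by (cases "i \<le> k") simp_all
    qed
    have "x l = x n" if "n \<le> l" for l using that by (induction rule: dec_induct) (simp_all add: step)
    then have "x k = \<mu>" if "n \<le> k" for k using that gt_top[OF x order_refl] assms(2) by metis
    then show "x \<in> gt n \<mu>" using x by (simp add: gt_def)
  next
    assume "x \<in> gt n \<mu>"
    then show "x \<in> gt m \<mu>" using assms(2) by (simp add: gt_def)
  qed
  then show ?thesis by (auto simp: lr_patterns_def)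
qed

lemma sum_wt: "x \<in> gt n \<mu> \<Longrightarrow> (\<Sum>k<m. wt x k) = (\<Sum>i<m. x m i)"
proof (induction m)
  case (Suc m)
  have "(\<Sum>i<m. x m i) = (\<Sum>i\<le>m. x m i)" using gt_zero[OF Suc.prems, of m m] by (simp flip: lessThan_Suc_atMost)
  then have "(\<Sum>k<Suc m. wt x k) = (\<Sum>i\<le>m. x m i + (x (Suc m) i - x m i))"
    using Suc by (simp add: wt_def sum.distrib)
  also have "\<dots> = (\<Sum>i<Suc m. x (Suc m) i)"
    using gt_interlace(2)[OF Suc.prems] by (simp add: lessThan_Suc_atMost)
  finally show ?case .
qed simp

lemma good_partition:
  assumes x: "x \<in> gt n \<mu>" and "good \<kappa> x" and \<kappa>: "is_partition \<kappa>" "\<And>k. n \<le> k \<Longrightarrow> \<kappa> k = 0"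
  shows "(\<lambda>k. \<kappa> k + wt x k) \<in> partitions_of (part_size \<kappa> + part_size \<mu>)"
proof -
  let ?\<nu> = "\<lambda>k. \<kappa> k + wt x k"
  have zero: "?\<nu> k = 0" if "n \<le> k" for k using \<kappa>(2) wt_top[OF x] that by simp
  have "wt_above 0 x = wt x" by (auto simp: wt_above_def wt_def)
  then have "?\<nu> (Suc k) \<le> ?\<nu> k" for k
    using \<open>good \<kappa> x\<close> unfolding good_def bad_pair_def by (metis not_less)
  then have "antimono ?\<nu>" by (simp add: antimono_iff_le_Suc)
  moreover have "finite {i. ?\<nu> i \<noteq> 0}"
  proof (rule finite_subset)
    show "{i. ?\<nu> i \<noteq> 0} \<subseteq> {..<n}"
    proof
      fix i assume "i \<in> {i. ?\<nu> i \<noteq> 0}"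
      then show "i \<in> {..<n}" using zero[of i] by (cases "n \<le> i") simp_all
    qed
  qed simp
  moreover have "\<mu> k = 0" if "n \<le> k" for k using gt_zero[OF x that] gt_top[OF x order_refl] by simp
  then have "part_size ?\<nu> = part_size \<kappa> + part_size \<mu>"
    using sum_wt[OF x, of n] gt_top[OF x order_refl] part_size_eq_sum[of n ?\<nu>, OF zero]
      part_size_eq_sum[of n \<kappa>, OF \<kappa>(2)] part_size_eq_sum[of n \<mu>] by (simp add: sum.distrib)
  ultimately show ?thesis by (simp add: partitions_of_def is_partition_def)
qed

text \<open>After multiplication by the staircase alternant this is the cancellation theorem, with the good
  patterns grouped by the partition that they lead to; the alternant can be cancelled because it is
  nonzero in an integral domain. By stability the patterns can be taken with \<open>m\<close> letters for
  every \<open>n\<close>. If \<open>\<kappa>\<close> has more than \<open>n\<close> parts, both sides vanish.\<close>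

theorem schur_product:
  assumes \<kappa>: "is_partition \<kappa>" and \<mu>: "is_partition \<mu>"
  defines "m \<equiv> part_size \<kappa> + part_size \<mu>"
  shows "schur n \<kappa> * schur n \<mu> = (\<Sum>\<nu>\<in>partitions_of m. of_int (int (card (lr_patterns m \<kappa> \<mu> \<nu>))) * schur n \<nu>)"
proof (cases "\<forall>k\<ge>n. \<kappa> k = 0")
  case True
  let ?A = "alternant n (staircase n)" and ?a = "\<lambda>\<nu>. alternant n (\<lambda>k. \<nu> k + staircase n k)"
  let ?G = "{x \<in> gt n \<mu>. good \<kappa> x}" and ?\<nu> = "\<lambda>x k. \<kappa> k + wt x k"
  have fin: "finite ?G" using finite_gt[OF \<mu>] by simp
  have "?A * (schur n \<kappa> * schur n \<mu>) = ?a \<kappa> * schur n \<mu>"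
    using bialternant[OF \<kappa>, of n] True by (simp add: mult.assoc[symmetric])
  also have "\<dots> = (\<Sum>x\<in>?G. ?a (?\<nu> x))"
    using alternant_times_pattern_sum[of \<kappa> n \<mu>] finite_gt[OF \<mu>] True partition_antimono[OF \<kappa>]
    by (simp add: schur_eq_pattern_sum[OF \<mu>] add_ac)
  also have "\<dots> = (\<Sum>\<nu>\<in>partitions_of m. \<Sum>x\<in>{x \<in> ?G. ?\<nu> x = \<nu>}. ?a (?\<nu> x))"
  proof (rule sum.group[symmetric, OF fin finite_partitions_of])
    show "?\<nu> ` ?G \<subseteq> partitions_of m"
      unfolding m_def using good_partition[OF _ _ \<kappa>] True by blast
  qed
  also have "\<dots> = (\<Sum>\<nu>\<in>partitions_of m. of_nat (card (lr_patterns n \<kappa> \<mu> \<nu>)) * ?a \<nu>)"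
  proof (rule sum.cong[OF refl])
    fix \<nu>
    have "{x \<in> ?G. ?\<nu> x = \<nu>} = lr_patterns n \<kappa> \<mu> \<nu>" by (simp add: lr_patterns_def fun_eq_iff conj_ac)
    moreover have "(\<Sum>x\<in>{x \<in> ?G. ?\<nu> x = \<nu>}. ?a (?\<nu> x)) = (\<Sum>x\<in>{x \<in> ?G. ?\<nu> x = \<nu>}. ?a \<nu>)"
      by (rule sum.cong) auto
    ultimately show "(\<Sum>x\<in>{x \<in> ?G. ?\<nu> x = \<nu>}. ?a (?\<nu> x)) = of_nat (card (lr_patterns n \<kappa> \<mu> \<nu>)) * ?a \<nu>"
      by simp
  qed
  also have "\<dots> = (\<Sum>\<nu>\<in>partitions_of m. ?A * (of_int (int (card (lr_patterns m \<kappa> \<mu> \<nu>))) * schur n \<nu>))"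
  proof (rule sum.cong[OF refl])
    fix \<nu> assume \<nu>: "\<nu> \<in> partitions_of m"
    then have part: "is_partition \<nu>" by (simp add: partitions_of_def)
    show "of_nat (card (lr_patterns n \<kappa> \<mu> \<nu>)) * ?a \<nu> = ?A * (of_int (int (card (lr_patterns m \<kappa> \<mu> \<nu>))) * schur n \<nu>)"
    proof (cases "\<forall>k\<ge>n. \<nu> k = 0")
      case True
      have "lr_patterns n \<kappa> \<mu> \<nu> = lr_patterns m \<kappa> \<mu> \<nu>"
        using lr_patterns_stable[of n \<nu> m] lr_patterns_stable[of m \<nu> n] partitions_of_zero[OF \<nu>] True
        by (cases "n \<le> m") auto
      then show ?thesis using bialternant[OF part, of n] True by (simp add: mult_ac)
    next
      case False
      then obtain k where k: "n \<le> k" "\<nu> k \<noteq> 0" by blast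
      have "x \<notin> lr_patterns n \<kappa> \<mu> \<nu>" for x
      proof
        assume "x \<in> lr_patterns n \<kappa> \<mu> \<nu>"
        then have "x \<in> gt n \<mu>" "\<kappa> k + wt x k = \<nu> k" by (simp_all add: lr_patterns_def)
        then show False using wt_top[of x n \<mu> k] \<open>\<forall>k\<ge>n. \<kappa> k = 0\<close> k by simp
      qed
      then have "lr_patterns n \<kappa> \<mu> \<nu> = {}" by blast
      then show ?thesis using schur_zero[OF part k] by simp
    qed
  qed
  also have "\<dots> = ?A * (\<Sum>\<nu>\<in>partitions_of m. of_int (int (card (lr_patterns m \<kappa> \<mu> \<nu>))) * schur n \<nu>)"
    by (simp add: sum_distrib_left)
  finally show ?thesis using alternant_staircase_nonzero[of n] by simp
next
  case False
  then obtain k where k: "n \<le> k" "\<kappa> k \<noteq> 0" by blast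
  have "of_int (int (card (lr_patterns m \<kappa> \<mu> \<nu>))) * schur n \<nu> = 0" if "\<nu> \<in> partitions_of m" for \<nu>
  proof (cases "lr_patterns m \<kappa> \<mu> \<nu> = {}")
    case False
    then obtain x where "\<kappa> k + wt x k = \<nu> k" unfolding lr_patterns_def by blast
    then have "\<nu> k \<noteq> 0" using k(2) by simp
    then have "schur n \<nu> = 0" using that k(1) by (intro schur_zero) (auto simp: partitions_of_def)
    then show ?thesis by simp
  qed simp
  then show ?thesis using schur_zero[OF \<kappa> k] by (simp only: mult_zero_left sum.neutral_const cong: sum.cong)
qed

text \<open>The coefficients in the definition are unique: for \<open>m\<close> variables and partitions of \<open>m\<close> the
  alternants are linearly independent.\<close>

theorem lr_coeff_eq:
  assumes \<kappa>: "is_partition \<kappa>" and \<mu>: "is_partition \<mu>" and \<nu>: "\<nu> \<in> partitions_of (part_size \<kappa> + part_size \<mu>)"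
    and n: "\<And>k. n \<le> k \<Longrightarrow> \<nu> k = 0"
  shows "lr_coeff \<kappa> \<mu> \<nu> = int (card (lr_patterns n \<kappa> \<mu> \<nu>))"
proof -
  define m where "m = part_size \<kappa> + part_size \<mu>"
  define c where "c \<nu> = (if \<nu> \<in> partitions_of m then int (card (lr_patterns m \<kappa> \<mu> \<nu>)) else 0)" for \<nu>
  define Q where "Q c \<longleftrightarrow> (\<forall>nu. nu \<notin> partitions_of m \<longrightarrow> c nu = 0) \<and>
     (\<forall>n. schur n \<kappa> * schur n \<mu> = (\<Sum>nu\<in>partitions_of m. of_int (c nu) * schur n nu))" for c :: "(nat \<Rightarrow> nat) \<Rightarrow> int"
  have "Q c" unfolding Q_def using schur_product[OF \<kappa> \<mu>] by (simp add: c_def m_def)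
  moreover have "d = c" if "Q d" for d
  proof
    fix \<nu>
    show "d \<nu> = c \<nu>"
    proof (cases "\<nu> \<in> partitions_of m")
      case True
      let ?A = "alternant m (staircase m)" and ?a = "\<lambda>\<nu>. alternant m (\<lambda>k. \<nu> k + staircase m k)"
      have coeff: "Poly_Mapping.lookup (?A * (schur m \<kappa> * schur m \<mu>)) (exponent m (\<lambda>k. \<nu> k + staircase m k)) = e \<nu>" if "Q e" for e
      proof -
        have "?A * (schur m \<kappa> * schur m \<mu>) = (\<Sum>\<nu>'\<in>partitions_of m. of_int (e \<nu>') * ?a \<nu>')"
        proof -
          have "?A * (schur m \<kappa> * schur m \<mu>) = (\<Sum>\<nu>'\<in>partitions_of m. of_int (e \<nu>') * (?A * schur m \<nu>'))"
            using that by (simp add: Q_def sum_distrib_left mult_ac)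
          also have "\<dots> = (\<Sum>\<nu>'\<in>partitions_of m. of_int (e \<nu>') * ?a \<nu>')"
            by (rule sum.cong) (simp_all add: bialternant partitions_of_zero, simp add: partitions_of_def bialternant partitions_of_zero)
          finally show ?thesis .
        qed
        moreover have "Poly_Mapping.lookup (?a \<nu>') (exponent m (\<lambda>k. \<nu> k + staircase m k)) = (if \<nu>' = \<nu> then 1 else 0)" if "\<nu>' \<in> partitions_of m" for \<nu>'
        proof -
          have "(\<forall>k<m. \<nu>' k = \<nu> k) \<longleftrightarrow> \<nu>' = \<nu>"
            using partitions_of_zero[OF that] partitions_of_zero[OF True] by (metis ext not_le)
          then show ?thesis
            using that True by (subst lookup_partition_alternant) (auto simp: partitions_of_def is_partition_def)
        qed
        ultimately have "Poly_Mapping.lookup (?A * (schur m \<kappa> * schur m \<mu>)) (exponent m (\<lambda>k. \<nu> k + staircase m k)) =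
            (\<Sum>\<nu>'\<in>partitions_of m. e \<nu>' * (if \<nu>' = \<nu> then 1 else 0))"
          by (simp only: Poly_Mapping.lookup_sum lookup_of_int_mult cong: sum.cong)
        also have "\<dots> = (\<Sum>\<nu>'\<in>partitions_of m. if \<nu>' = \<nu> then e \<nu> else 0)" by (rule sum.cong) auto
        also have "\<dots> = e \<nu>" using True finite_partitions_of by simp
        finally show ?thesis .
      qed
      show ?thesis using coeff[OF \<open>Q d\<close>] coeff[OF \<open>Q c\<close>] by simp
    next
      case False
      then show ?thesis using that by (simp add: Q_def c_def)
    qed
  qed
  ultimately have "(THE c. Q c) = c" by (rule the_equality)
  then have "lr_coeff \<kappa> \<mu> \<nu> = int (card (lr_patterns m \<kappa> \<mu> \<nu>))"
    using \<nu> by (simp add: lr_coeff_def Q_def m_def c_def)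
  moreover have "lr_patterns n \<kappa> \<mu> \<nu> = lr_patterns m \<kappa> \<mu> \<nu>"
    using lr_patterns_stable[of n \<nu> m] lr_patterns_stable[of m \<nu> n] partitions_of_zero[OF \<nu>] n
    by (cases "n \<le> m") (auto simp: m_def)
  ultimately show ?thesis by simp
qed

section \<open>Cones and their defects\<close>

type_synonym vec3 = "int \<times> int \<times> int"

fun ip :: "vec3 \<Rightarrow> vec3 \<Rightarrow> int" where
  "ip (a, b, c) (x, y, z) = a * x + b * y + c * z"

text \<open>The body-centred cubic lattice.\<close>

definition bcc :: "vec3 set" where
  "bcc = {(x, y, z). even (x - y) \<and> even (y - z)}"

text \<open>A cone is given by a set of roots, the inner normals of its facets. These are the roots of type
  \<open>C\<^sub>3\<close>; they have even inner products with the points of \<open>bcc\<close>.\<close>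

definition roots :: "vec3 set" where
  "roots = {(x, y, z). \<bar>x\<bar> + \<bar>y\<bar> + \<bar>z\<bar> = 2}"

text \<open>Representatives of the 27 cosets of \<open>3 * bcc\<close> in \<open>bcc\<close>, one of each as short as possible. All
  their inner products with roots have absolute value at most four.\<close>

definition reps :: "vec3 set" where
  "reps = {(x, y, z) \<in> bcc. \<bar>x\<bar> \<le> 2 \<and> \<bar>y\<bar> \<le> 2 \<and> \<bar>z\<bar> \<le> 2 \<and> \<bar>x\<bar> + \<bar>y\<bar> + \<bar>z\<bar> \<le> 4}"

definition dirs :: "vec3 set \<Rightarrow> vec3 set" where
  "dirs S = {d \<in> reps. \<forall>n\<in>S. 0 \<le> ip n d}"

definition face :: "vec3 set \<Rightarrow> vec3 \<Rightarrow> vec3 set" where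
  "face S d = {n \<in> S. ip n d = 0}"

text \<open>For a function \<open>f\<close> of the tangent cone at a lattice point, \<open>transfer f S\<close> collects \<open>f\<close> over the
  points \<open>3z + d\<close> that replace a point \<open>z\<close> with tangent cone \<open>S\<close> when the polytope is dilated by
  three. The roots that are tight at \<open>3z + d\<close> are \<open>face S d\<close>.\<close>

definition transfer :: "(vec3 set \<Rightarrow> int) \<Rightarrow> vec3 set \<Rightarrow> int" where
  "transfer f S = (\<Sum>d\<in>dirs S. f (face S d))"

text \<open>The contributions of a point with tangent cone \<open>S\<close> to \<open>27 P(t) - P(3t)\<close> and to the polynomials
  that arise from it with the factors 9 and 3, where \<open>P\<close> counts lattice points.\<close>

definition defect1 :: "vec3 set \<Rightarrow> int" where
  "defect1 S = 27 - transfer (\<lambda>_. 1) S"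

definition defect2 :: "vec3 set \<Rightarrow> int" where
  "defect2 S = 9 * defect1 S - transfer defect1 S"

definition defect3 :: "vec3 set \<Rightarrow> int" where
  "defect3 S = 3 * defect2 S - transfer defect2 S"

definition rays :: "vec3 list" where
  "rays = [(2,0,0), (0,2,0), (0,0,2), (-2,0,0), (0,-2,0), (0,0,-2),
   (2,2,0), (2,0,2), (0,2,2), (-2,-2,0), (-2,0,-2), (0,-2,-2),
   (2,-2,0), (2,0,-2), (0,2,-2), (-2,2,0), (-2,0,2), (0,-2,2),
   (1,1,1), (-1,1,1), (1,-1,1), (1,1,-1), (-1,-1,-1), (1,-1,-1), (-1,1,-1), (-1,-1,1)]"

definition positive_roots :: "vec3 list" where
  "positive_roots = [(2,0,0), (0,2,0), (0,0,2), (1,1,0), (1,0,1), (0,1,1), (1,-1,0), (1,0,-1), (0,1,-1)]"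

lemma small_int_cases: "\<bar>x::int\<bar> \<le> 2 \<longleftrightarrow> x \<in> set [-2, -1, 0, 1, 2]"
  by (simp add: abs_if) presburger

lemma reps_eq: "reps = insert (0, 0, 0) (set rays)"
proof -
  have *: "\<forall>x\<in>set [-2, -1, 0, 1, 2]. \<forall>y\<in>set [-2, -1, 0, 1, 2]. \<forall>z\<in>set [-2, -1, 0, 1, 2 :: int].
     even (x - y) \<and> even (y - z) \<and> \<bar>x\<bar> + \<bar>y\<bar> + \<bar>z\<bar> \<le> 4 \<longleftrightarrow> (x, y, z) \<in> set ((0, 0, 0) # rays)"
    by code_simp
  have **: "\<forall>(x, y, z)\<in>set rays. \<bar>x\<bar> \<le> 2 \<and> \<bar>y\<bar> \<le> 2 \<and> \<bar>z\<bar> \<le> 2"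
    by code_simp
  have "(x, y, z) \<in> reps \<longleftrightarrow> (x, y, z) \<in> insert (0, 0, 0) (set rays)" for x y z
  proof (cases "\<bar>x\<bar> \<le> 2 \<and> \<bar>y\<bar> \<le> 2 \<and> \<bar>z\<bar> \<le> 2")
    case True
    then have "x \<in> set [-2, -1, 0, 1, 2]" "y \<in> set [-2, -1, 0, 1, 2]" "z \<in> set [-2, -1, 0, 1, 2]"
      by (simp_all only: small_int_cases)
    from *[rule_format, OF this] True show ?thesis by (simp add: reps_def bcc_def)
  next
    case False
    moreover have "(x, y, z) \<noteq> (0, 0, 0)" using False by auto
    moreover have "(x, y, z) \<notin> set rays" using False bspec[OF **, of "(x, y, z)"] by auto
    ultimately show ?thesis by (auto simp: reps_def)
  qed
  then show ?thesis by auto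
qed

lemma roots_eq: "roots = set positive_roots \<union> uminus ` set positive_roots"
proof -
  have *: "\<forall>x\<in>set [-2, -1, 0, 1, 2]. \<forall>y\<in>set [-2, -1, 0, 1, 2]. \<forall>z\<in>set [-2, -1, 0, 1, 2 :: int].
     \<bar>x\<bar> + \<bar>y\<bar> + \<bar>z\<bar> = 2 \<longleftrightarrow> (x, y, z) \<in> set positive_roots \<or> (-x, -y, -z) \<in> set positive_roots"
    by code_simp
  have **: "\<forall>(x, y, z)\<in>set positive_roots. \<bar>x\<bar> \<le> 2 \<and> \<bar>y\<bar> \<le> 2 \<and> \<bar>z\<bar> \<le> 2"
    by code_simp
  have "v \<in> uminus ` set positive_roots \<longleftrightarrow> - v \<in> set positive_roots" for v
    by (metis imageE imageI minus_minus)
  moreover have "(x, y, z) \<in> roots \<longleftrightarrow> (x, y, z) \<in> set positive_roots \<or> (-x, -y, -z) \<in> set positive_roots" for x y z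
  proof (cases "\<bar>x\<bar> \<le> 2 \<and> \<bar>y\<bar> \<le> 2 \<and> \<bar>z\<bar> \<le> 2")
    case True
    then have "x \<in> set [-2, -1, 0, 1, 2]" "y \<in> set [-2, -1, 0, 1, 2]" "z \<in> set [-2, -1, 0, 1, 2]"
      by (simp_all only: small_int_cases)
    from *[rule_format, OF this] show ?thesis by (simp add: roots_def)
  next
    case False
    moreover have "(x, y, z) \<notin> set positive_roots" using False bspec[OF **, of "(x, y, z)"] by auto
    moreover have "(-x, -y, -z) \<notin> set positive_roots" using False bspec[OF **, of "(-x, -y, -z)"] by auto
    ultimately show ?thesis by (auto simp: roots_def)
  qed
  ultimately show ?thesis by auto
qed

lemma distinct_rays: "distinct rays" "(0, 0, 0) \<notin> set rays"
  by code_simp+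

lemma finite_reps [simp]: "finite reps" by (simp add: reps_eq)
lemma finite_roots [simp]: "finite roots" by (simp add: roots_eq)
lemma card_reps: "card reps = 27"
  using distinct_rays by (simp add: reps_eq distinct_card) (simp add: rays_def)

lemma finite_dirs [simp]: "finite (dirs S)" by (simp add: dirs_def)

lemma ip_zero [simp]: "ip n (0, 0, 0) = 0" by (cases n) simp
lemma face_zero [simp]: "face S (0, 0, 0) = S" by (simp add: face_def)
lemma face_subset: "face S d \<subseteq> S" by (auto simp: face_def)

subsection \<open>The finite check\<close>

datatype sign = Neg | Zer | Pos

text \<open>For evaluation a root is represented by the signs of its inner products with the 26 nonzero
  representatives, and a set of roots by the list of these rows. The pointwise minimum of the rows
  (\<open>meet_rows\<close>) tells for each representative whether it lies outside, on the boundary or in the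
  interior of the cone.\<close>

definition sign_of :: "int \<Rightarrow> sign" where
  "sign_of k = (if k < 0 then Neg else if k = 0 then Zer else Pos)"

lemma sign_of_simps: "sign_of k = Neg \<longleftrightarrow> k < 0" "sign_of k = Zer \<longleftrightarrow> k = 0" "sign_of k = Pos \<longleftrightarrow> k > 0"
  by (auto simp: sign_of_def)

fun smin :: "sign \<Rightarrow> sign \<Rightarrow> sign" where
  "smin Neg s = Neg"
| "smin Pos s = s"
| "smin Zer Neg = Neg"
| "smin Zer Zer = Zer"
| "smin Zer Pos = Zer"

fun meet_row :: "sign list \<Rightarrow> sign list \<Rightarrow> sign list" where
  "meet_row (s # ss) (t # ts) = smin s t # meet_row ss ts"
| "meet_row ss ts = []"

fun meet_rows :: "sign list list \<Rightarrow> sign list" where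
  "meet_rows [] = [Pos, Pos, Pos, Pos, Pos, Pos, Pos, Pos, Pos, Pos, Pos, Pos, Pos,
     Pos, Pos, Pos, Pos, Pos, Pos, Pos, Pos, Pos, Pos, Pos, Pos, Pos]"
| "meet_rows (r # rs) = meet_row r (meet_rows rs)"

fun state_sum :: "int \<Rightarrow> int \<Rightarrow> sign list \<Rightarrow> int" where
  "state_sum z p [] = 0"
| "state_sum z p (Neg # ss) = state_sum z p ss"
| "state_sum z p (Zer # ss) = z + state_sum z p ss"
| "state_sum z p (Pos # ss) = p + state_sum z p ss"

text \<open>A row is processed together with a copy from which the leading signs are removed step by step.
  The rows whose copy starts with \<open>Zer\<close> then form the face of the current representative.\<close>

definition zero_heads :: "(sign list \<times> sign list) list \<Rightarrow> sign list list" where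
  "zero_heads ps = map fst (filter (\<lambda>p. hd (snd p) = Zer) ps)"

fun column_sum :: "(sign list list \<Rightarrow> int) \<Rightarrow> (sign list \<times> sign list) list \<Rightarrow> sign list \<Rightarrow> int" where
  "column_sum f ps [] = 0"
| "column_sum f ps (s # ss) =
     (if s = Neg then column_sum f (map (apsnd tl) ps) ss
      else f (zero_heads ps) + column_sum f (map (apsnd tl) ps) ss)"

fun column_ex :: "(sign list list \<Rightarrow> bool) \<Rightarrow> (sign list \<times> sign list) list \<Rightarrow> sign list \<Rightarrow> bool" where
  "column_ex f ps [] = False"
| "column_ex f ps (s # ss) =
     (s \<noteq> Neg \<and> f (zero_heads ps) \<or> column_ex f (map (apsnd tl) ps) ss)"

fun common_neg :: "sign list \<Rightarrow> sign list \<Rightarrow> bool" where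
  "common_neg (Neg # fs) (s # ss) = (s \<noteq> Neg \<or> common_neg fs ss)"
| "common_neg (Zer # fs) (s # ss) = common_neg fs ss"
| "common_neg (Pos # fs) (s # ss) = common_neg fs ss"
| "common_neg fs ss = False"

definition root_rows :: "sign list list" where
  "root_rows =
    [[Pos, Zer, Zer, Neg, Zer, Zer, Pos, Pos, Zer, Neg, Neg, Zer, Pos, Pos, Zer, Neg, Neg, Zer, Pos, Neg, Pos, Pos, Neg, Pos, Neg, Neg],
     [Zer, Pos, Zer, Zer, Neg, Zer, Pos, Zer, Pos, Neg, Zer, Neg, Neg, Zer, Pos, Pos, Zer, Neg, Pos, Pos, Neg, Pos, Neg, Neg, Pos, Neg],
     [Zer, Zer, Pos, Zer, Zer, Neg, Zer, Pos, Pos, Zer, Neg, Neg, Zer, Neg, Neg, Zer, Pos, Pos, Pos, Pos, Pos, Neg, Neg, Neg, Neg, Pos],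
     [Pos, Pos, Zer, Neg, Neg, Zer, Pos, Pos, Pos, Neg, Neg, Neg, Zer, Pos, Pos, Zer, Neg, Neg, Pos, Zer, Zer, Pos, Neg, Zer, Zer, Neg],
     [Pos, Zer, Pos, Neg, Zer, Neg, Pos, Pos, Pos, Neg, Neg, Neg, Pos, Zer, Neg, Neg, Zer, Pos, Pos, Zer, Pos, Zer, Neg, Zer, Neg, Zer],
     [Zer, Pos, Pos, Zer, Neg, Neg, Pos, Pos, Pos, Neg, Neg, Neg, Neg, Neg, Zer, Pos, Pos, Zer, Pos, Pos, Zer, Zer, Neg, Neg, Zer, Zer],
     [Pos, Neg, Zer, Neg, Pos, Zer, Zer, Pos, Neg, Zer, Neg, Pos, Pos, Pos, Neg, Neg, Neg, Pos, Zer, Neg, Pos, Zer, Zer, Pos, Neg, Zer],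
     [Pos, Zer, Neg, Neg, Zer, Pos, Pos, Zer, Neg, Neg, Zer, Pos, Pos, Pos, Pos, Neg, Neg, Neg, Zer, Neg, Zer, Pos, Zer, Pos, Zer, Neg],
     [Zer, Pos, Neg, Zer, Neg, Pos, Pos, Neg, Zer, Neg, Pos, Zer, Neg, Pos, Pos, Pos, Neg, Neg, Zer, Zer, Neg, Pos, Zer, Zer, Pos, Neg]]"

definition functional_rows :: "sign list list" where
  "functional_rows =
    [[Pos, Pos, Pos, Neg, Neg, Neg, Pos, Pos, Pos, Neg, Neg, Neg, Zer, Zer, Zer, Zer, Zer, Zer, Pos, Pos, Pos, Pos, Neg, Neg, Neg, Neg],
     [Pos, Pos, Neg, Neg, Neg, Pos, Pos, Zer, Zer, Neg, Zer, Zer, Zer, Pos, Pos, Zer, Neg, Neg, Pos, Neg, Neg, Pos, Neg, Pos, Pos, Neg],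
     [Pos, Neg, Pos, Neg, Pos, Neg, Zer, Pos, Zer, Zer, Neg, Zer, Pos, Zer, Neg, Neg, Zer, Pos, Pos, Neg, Pos, Neg, Neg, Pos, Neg, Pos],
     [Pos, Neg, Neg, Neg, Pos, Pos, Zer, Zer, Neg, Zer, Zer, Pos, Pos, Pos, Zer, Neg, Neg, Zer, Neg, Neg, Pos, Pos, Pos, Pos, Neg, Neg],
     [Neg, Pos, Pos, Pos, Neg, Neg, Zer, Zer, Pos, Zer, Zer, Neg, Neg, Neg, Zer, Pos, Pos, Zer, Pos, Pos, Neg, Neg, Neg, Neg, Pos, Pos],
     [Neg, Pos, Neg, Pos, Neg, Pos, Zer, Neg, Zer, Zer, Pos, Zer, Neg, Zer, Pos, Pos, Zer, Neg, Neg, Pos, Neg, Pos, Pos, Neg, Pos, Neg],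
     [Neg, Neg, Pos, Pos, Pos, Neg, Neg, Zer, Zer, Pos, Zer, Zer, Zer, Neg, Neg, Zer, Pos, Pos, Neg, Pos, Pos, Neg, Pos, Neg, Neg, Pos],
     [Neg, Neg, Neg, Pos, Pos, Pos, Neg, Neg, Neg, Pos, Pos, Pos, Zer, Zer, Zer, Zer, Zer, Zer, Neg, Neg, Neg, Neg, Pos, Pos, Pos, Pos]]"

definition row_count :: "sign list list \<Rightarrow> int" where
  "row_count rs = 1 + state_sum 1 1 (meet_rows rs)"

text \<open>With \<open>T\<close> the number of representatives in a cone, the second defect is
  \<open>9 (27 - T) - (27 T - T - s) = 243 - 35 T + s\<close>, where \<open>s\<close> adds up the counts of the faces at
  nonzero representatives.\<close>

definition row_defect2_aux :: "sign list list \<Rightarrow> sign list \<Rightarrow> int" where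
  "row_defect2_aux rs st = 243 - 35 * (1 + state_sum 1 1 st) + column_sum row_count (map (\<lambda>r. (r, r)) rs) st"

definition row_defect2 :: "sign list list \<Rightarrow> int" where
  "row_defect2 rs = row_defect2_aux rs (meet_rows rs)"

text \<open>The second defect of the tangent cone at \<open>3z + d\<close> for \<open>d \<noteq> 0\<close>. Such a cone contains the line
  through \<open>d\<close>, and for it the iterated sum collapses to a count of representatives with weight 3 on
  the boundary and 6 in the interior. This is verified in \<open>wedge_check\<close> and keeps the evaluation of
  the third defect cheap.\<close>

definition wedge_defect :: "sign list list \<Rightarrow> int" where
  "wedge_defect rs = (if rs = [] then 0 else 78 - state_sum 3 6 (meet_rows rs))"

text \<open>A transcription of \<open>good_cone\<close> below; \<open>a\<close> and \<open>b\<close> stand for the second and the third defect.\<close>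

definition check_values :: "sign list list \<Rightarrow> sign list \<Rightarrow> int \<Rightarrow> int \<Rightarrow> bool" where
  "check_values rs st a b \<longleftrightarrow> 0 \<le> a \<and> 0 \<le> b \<and> b \<le> 2 * a \<and>
     (length rs < 2 \<or> b < 2 * a \<and> column_ex (\<lambda>qs. qs \<noteq> [] \<and> length qs < length rs) (map (\<lambda>r. (r, r)) rs) st) \<and>
     (0 < b \<or> column_ex (\<lambda>qs. length qs = length rs) (map (\<lambda>r. (r, r)) rs) st \<or>
        list_all (\<lambda>f. common_neg f st) functional_rows)"

definition check_defect2 :: "sign list list \<Rightarrow> sign list \<Rightarrow> int \<Rightarrow> bool" where
  "check_defect2 rs st a = check_values rs st a (2 * a - column_sum wedge_defect (map (\<lambda>r. (r, r)) rs) st)"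

definition check_states :: "sign list list \<Rightarrow> sign list \<Rightarrow> bool" where
  "check_states rs st = check_defect2 rs st (row_defect2_aux rs st)"

definition check :: "sign list list \<Rightarrow> bool" where
  "check rs = check_states rs (meet_rows rs)"

lemma wedge_check: "list_all (\<lambda>d. list_all (\<lambda>rs. row_defect2 rs = wedge_defect rs)
    (subseqs (map snd (filter (\<lambda>p. ip (fst p) d = 0) (zip positive_roots root_rows))))) rays"
  by code_simp

subsection \<open>Rows\<close>

definition row :: "vec3 \<Rightarrow> sign list" where
  "row n = map (\<lambda>d. sign_of (ip n d)) rays"

lemma root_rows_eq: "root_rows = map row positive_roots"
  unfolding row_def by code_simp

definition meet :: "vec3 list \<Rightarrow> vec3 \<Rightarrow> sign" where
  "meet L d = foldr (\<lambda>n. smin (sign_of (ip n d))) L Pos"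

lemma smin_iff: "smin s t = Neg \<longleftrightarrow> s = Neg \<or> t = Neg" "smin s t = Pos \<longleftrightarrow> s = Pos \<and> t = Pos"
  "smin s t = Zer \<longleftrightarrow> s \<noteq> Neg \<and> t \<noteq> Neg \<and> (s = Zer \<or> t = Zer)"
  by (cases s; cases t; simp)+

lemma meet_Neg: "meet L d = Neg \<longleftrightarrow> (\<exists>n\<in>set L. ip n d < 0)"
  by (induction L) (auto simp: meet_def smin_iff sign_of_simps)

lemma meet_row_map: "meet_row (map f ds) (map g ds) = map (\<lambda>d. smin (f d) (g d)) ds"
  by (induction ds) auto

lemma meet_rows_row: "meet_rows (map row L) = map (meet L) rays"
proof (induction L)
  case Nil
  show ?case by (simp add: meet_def rays_def)
next
  case (Cons n L)
  then show ?case by (simp add: row_def meet_row_map) (simp add: meet_def)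
qed

abbreviation face_list :: "vec3 list \<Rightarrow> vec3 \<Rightarrow> vec3 list" where
  "face_list L d \<equiv> filter (\<lambda>n. ip n d = 0) L"

lemma set_face_list: "set (face_list L d) = face (set L) d"
  by (auto simp: face_def)

lemma zero_heads_map: "zero_heads (map (\<lambda>n. (row n, sign_of (ip n d) # ss n)) L) = map row (face_list L d)"
  by (induction L) (auto simp: zero_heads_def sign_of_simps)

lemma column_sum_map:
  "column_sum f (map (\<lambda>n. (row n, map (\<lambda>d. sign_of (ip n d)) ds)) L) (map (meet L) ds) =
     (\<Sum>d\<leftarrow>filter (\<lambda>d. meet L d \<noteq> Neg) ds. f (map row (face_list L d)))"
proof (induction ds)
  case (Cons d ds)
  have "map (apsnd tl) (map (\<lambda>n. (row n, map (\<lambda>d. sign_of (ip n d)) (d # ds))) L) =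
      map (\<lambda>n. (row n, map (\<lambda>d. sign_of (ip n d)) ds)) L" by simp
  then show ?case using Cons.IH by (simp add: zero_heads_map o_def)
qed simp

lemma column_sum_rows:
  "column_sum f (map (\<lambda>r. (r, r)) (map row L)) (map (meet L) rays) =
     (\<Sum>d\<leftarrow>filter (\<lambda>d. meet L d \<noteq> Neg) rays. f (map row (face_list L d)))"
  using column_sum_map[of f rays L] by (simp add: row_def o_def)

lemma column_ex_map:
  "column_ex f (map (\<lambda>n. (row n, map (\<lambda>d. sign_of (ip n d)) ds)) L) (map (meet L) ds) \<longleftrightarrow>
     (\<exists>d\<in>set ds. meet L d \<noteq> Neg \<and> f (map row (face_list L d)))"
proof (induction ds)
  case (Cons d ds)
  have "map (apsnd tl) (map (\<lambda>n. (row n, map (\<lambda>d. sign_of (ip n d)) (d # ds))) L) =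
      map (\<lambda>n. (row n, map (\<lambda>d. sign_of (ip n d)) ds)) L" by simp
  then show ?case using Cons.IH by (simp add: zero_heads_map o_def)
qed simp

lemma column_ex_rows:
  "column_ex f (map (\<lambda>r. (r, r)) (map row L)) (map (meet L) rays) \<longleftrightarrow>
     (\<exists>d\<in>set rays. meet L d \<noteq> Neg \<and> f (map row (face_list L d)))"
  using column_ex_map[of f rays L] by (simp add: row_def o_def)

lemma state_sum_map:
  "state_sum z p (map s ds) = (\<Sum>d\<leftarrow>filter (\<lambda>d. s d \<noteq> Neg) ds. if s d = Zer then z else p)"
proof (induction ds)
  case (Cons d ds)
  then show ?case by (cases "s d") simp_all
qed simp

lemma common_neg_map:
  "common_neg (map (\<lambda>d. sign_of (g d)) ds) (map s ds) \<longleftrightarrow> (\<exists>d\<in>set ds. g d < 0 \<and> s d \<noteq> Neg)"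
proof (induction ds)
  case (Cons d ds)
  show ?case
  proof (cases "sign_of (g d)")
    case Neg
    then show ?thesis using Cons.IH sign_of_simps(1)[of "g d"] by auto
  next
    case Zer
    then show ?thesis using Cons.IH sign_of_simps(2)[of "g d"] by auto
  next
    case Pos
    then show ?thesis using Cons.IH sign_of_simps(3)[of "g d"] by auto
  qed
qed simp

lemma dirs_eq: "dirs (set L) = insert (0, 0, 0) (set (filter (\<lambda>d. meet L d \<noteq> Neg) rays))"
  by (auto simp: dirs_def reps_eq meet_Neg not_less)

lemma transfer_eq: "transfer f (set L) = f (set L) + (\<Sum>d\<leftarrow>filter (\<lambda>d. meet L d \<noteq> Neg) rays. f (face (set L) d))"
proof -
  have "(\<Sum>d\<leftarrow>filter (\<lambda>d. meet L d \<noteq> Neg) rays. f (face (set L) d)) =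
      (\<Sum>d\<in>set (filter (\<lambda>d. meet L d \<noteq> Neg) rays). f (face (set L) d))"
    using distinct_rays by (subst sum_list_distinct_conv_sum_set) auto
  moreover have "(0, 0, 0) \<notin> set (filter (\<lambda>d. meet L d \<noteq> Neg) rays)" using distinct_rays by simp
  ultimately show ?thesis unfolding transfer_def dirs_eq by (subst sum.insert) auto
qed

lemma row_count_eq: "row_count (map row L) = transfer (\<lambda>_. 1) (set L)"
proof -
  have *: "(if x then 1 else 1) = (1 :: int)" for x by simp
  show ?thesis unfolding row_count_def transfer_eq meet_rows_row state_sum_map * ..
qed

lemma row_defect2_eq: "row_defect2 (map row L) = defect2 (set L)"
proof -
  define l where "l = filter (\<lambda>d. meet L d \<noteq> Neg) rays"
  let ?t = "\<lambda>d. transfer (\<lambda>_. 1) (face (set L) d)"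
  have "row_defect2 (map row L) = 243 - 35 * row_count (map row L) + (\<Sum>d\<leftarrow>l. ?t d)"
    unfolding row_defect2_def row_defect2_aux_def meet_rows_row column_sum_rows l_def
    by (simp only: row_count_eq set_face_list) (simp only: row_count_def meet_rows_row flip: row_count_eq)
  moreover have "transfer defect1 (set L) = defect1 (set L) + (\<Sum>d\<leftarrow>l. 27 - ?t d)"
    unfolding transfer_eq[of defect1] defect1_def l_def ..
  moreover have "transfer (\<lambda>_. 1) (set L) = 1 + (\<Sum>d\<leftarrow>l. 1)"
    unfolding l_def by (rule transfer_eq)
  moreover have "(\<Sum>d\<leftarrow>l. 27 - ?t d) = 27 * (\<Sum>d\<leftarrow>l. 1) - (\<Sum>d\<leftarrow>l. ?t d)"
    by (induction l) auto
  ultimately show ?thesis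
    unfolding row_count_eq by (simp add: defect2_def defect1_def)
qed

lemma in_subseqs_filter: "filter P xs \<in> set (subseqs xs)"
  by (induction xs) (auto simp: Let_def)

lemma map_in_subseqs: "ys \<in> set (subseqs xs) \<Longrightarrow> map f ys \<in> set (subseqs (map f xs))"
  by (induction xs arbitrary: ys) (auto simp: Let_def)

lemma defect2_face:
  assumes L: "L \<in> set (subseqs positive_roots)" and d: "d \<in> set rays"
  shows "defect2 (face (set L) d) = wedge_defect (map row (face_list L d))"
proof -
  have "face_list xs d \<in> set (subseqs (face_list ys d))" if "xs \<in> set (subseqs ys)" for xs ys :: "vec3 list"
    using that by (induction ys arbitrary: xs) (auto simp: Let_def)
  from this[OF L] have "map row (face_list L d) \<in> set (subseqs (map row (face_list positive_roots d)))"
    by (rule map_in_subseqs)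
  also have "map row (face_list positive_roots d) = map snd (filter (\<lambda>p. ip (fst p) d = 0) (zip positive_roots root_rows))"
  proof -
    have "map f (filter P xs) = map snd (filter (\<lambda>p. P (fst p)) (zip xs (map f xs)))" for f :: "vec3 \<Rightarrow> sign list" and P xs
      by (induction xs) auto
    then show ?thesis unfolding root_rows_eq .
  qed
  finally have "row_defect2 (map row (face_list L d)) = wedge_defect (map row (face_list L d))"
    using wedge_check d unfolding list_all_iff by blast
  then show ?thesis unfolding row_defect2_eq set_face_list .
qed

lemma defect3_altdef: "defect3 (set L) = 2 * defect2 (set L) - (\<Sum>d\<leftarrow>filter (\<lambda>d. meet L d \<noteq> Neg) rays. defect2 (face (set L) d))"
  unfolding defect3_def transfer_eq by simp

text \<open>The coefficients of the functionals in the last clause of \<open>good_cone\<close>; the symmetries of the cube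
  permute them.\<close>

definition signs3 :: "vec3 set" where
  "signs3 = {(x, y, z). \<bar>x\<bar> = 1 \<and> \<bar>y\<bar> = 1 \<and> \<bar>z\<bar> = 1}"

lemma functional_rows_eq:
  "functional_rows = map row [(1,1,1), (1,1,-1), (1,-1,1), (1,-1,-1), (-1,1,1), (-1,1,-1), (-1,-1,1), (-1,-1,-1)]"
  unfolding row_def by code_simp

text \<open>Nonnegative second and third defects make the coefficients of \<open>t\<close> and \<open>1\<close> nonnegative. The
  other clauses serve strict positivity. Since \<open>2 * defect2 S - defect3 S\<close> equals
  \<open>transfer defect2 S - defect2 S\<close>, the sum of the second defects grows strictly at a cone with at
  least two roots. A representative with a nonempty proper face leads from a boundary point to one
  with fewer tight roots. The last clause says that at a vertex where one of the eight functionals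
  \<open>\<plusminus>x \<plusminus> y \<plusminus> z\<close> is minimal the third defect does not vanish.\<close>

definition good_cone :: "vec3 set \<Rightarrow> bool" where
  "good_cone S \<longleftrightarrow> 0 \<le> defect2 S \<and> 0 \<le> defect3 S \<and> defect3 S \<le> 2 * defect2 S \<and>
     (2 \<le> card S \<longrightarrow> defect3 S < 2 * defect2 S \<and> (\<exists>d\<in>dirs S. face S d \<noteq> {} \<and> face S d \<noteq> S)) \<and>
     (defect3 S = 0 \<longrightarrow> (\<exists>d\<in>reps - {(0,0,0)}. face S d = S) \<or> (\<forall>f\<in>signs3. \<exists>d\<in>dirs S. ip f d < 0))"

lemma good_cone_if_check:
  assumes L: "L \<in> set (subseqs positive_roots)" and "check (map row L)"
  shows "good_cone (set L)"
proof -
  let ?S = "set L"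
  have "distinct positive_roots" by code_simp
  then have "distinct L" using L by (rule subseqs_distinctD[rotated])
  then have card: "length L = card ?S" by (simp add: distinct_card)
  have "column_sum wedge_defect (map (\<lambda>r. (r, r)) (map row L)) (map (meet L) rays)
      = (\<Sum>d\<leftarrow>filter (\<lambda>d. meet L d \<noteq> Neg) rays. defect2 (face ?S d))"
    unfolding column_sum_rows using defect2_face[OF L] by (intro arg_cong[of _ _ sum_list] map_cong) auto
  then have *: "check_values (map row L) (map (meet L) rays) (defect2 ?S) (defect3 ?S)"
    using assms(2) unfolding check_def check_states_def check_defect2_def defect3_altdef row_defect2_eq[symmetric]
       row_defect2_def meet_rows_row by simp
  have 1: "\<exists>d\<in>dirs ?S. face ?S d \<noteq> {} \<and> face ?S d \<noteq> ?S"
    if "column_ex (\<lambda>qs. qs \<noteq> [] \<and> length qs < length (map row L)) (map (\<lambda>r. (r, r)) (map row L)) (map (meet L) rays)"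
  proof -
    from that obtain d where d: "d \<in> set rays" "meet L d \<noteq> Neg" "face_list L d \<noteq> []" "length (face_list L d) < length L"
      unfolding column_ex_rows by auto
    have "face ?S d \<noteq> {}" using d(3) unfolding set_face_list[symmetric] set_empty .
    moreover have "face ?S d \<noteq> ?S"
      using d(4) unfolding face_def by (metis (mono_tags, lifting) filter_True less_irrefl mem_Collect_eq)
    ultimately show ?thesis using d(1,2) by (intro bexI[of _ d]) (auto simp: dirs_eq)
  qed
  have 2: "\<exists>d\<in>reps - {(0,0,0)}. face ?S d = ?S"
    if "column_ex (\<lambda>qs. length qs = length (map row L)) (map (\<lambda>r. (r, r)) (map row L)) (map (meet L) rays)"
  proof -
    from that obtain d where d: "d \<in> set rays" "length (face_list L d) = length L"
      unfolding column_ex_rows by auto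
    have "face ?S d = ?S"
      using d(2) unfolding set_face_list[symmetric] by (metis filter_id_conv length_filter_less less_irrefl)
    then show ?thesis using d(1) distinct_rays by (intro bexI[of _ d]) (auto simp: reps_eq)
  qed
  have 3: "\<forall>f\<in>signs3. \<exists>d\<in>dirs ?S. ip f d < 0"
    if "list_all (\<lambda>f. common_neg f (map (meet L) rays)) functional_rows"
  proof
    fix f assume "f \<in> signs3"
    then have "f \<in> set [(1,1,1), (1,1,-1), (1,-1,1), (1,-1,-1), (-1,1,1), (-1,1,-1), (-1,-1,1), (-1,-1,-1)]"
      by (auto simp: signs3_def abs_if split: if_splits)
    then have "common_neg (row f) (map (meet L) rays)"
      using that unfolding functional_rows_eq list_all_iff set_map by blast
    then obtain d where "d \<in> set rays" "ip f d < 0" "meet L d \<noteq> Neg"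
      unfolding row_def common_neg_map by blast
    then show "\<exists>d\<in>dirs ?S. ip f d < 0" by (intro bexI[of _ d]) (auto simp: dirs_eq)
  qed
  from * show ?thesis
    unfolding check_values_def good_cone_def length_map card[symmetric]
    using 1 2 3 by (auto simp: card)
qed

text \<open>Evaluation for all subsets of the positive roots, divided by their intersection with the first
  three roots.\<close>

lemma checks_111: "list_all (\<lambda>S. check ([root_rows ! 0, root_rows ! 1, root_rows ! 2] @ S)) (subseqs (drop 3 root_rows))"
  by code_simp

lemma checks_110: "list_all (\<lambda>S. check ([root_rows ! 0, root_rows ! 1] @ S)) (subseqs (drop 3 root_rows))"
  by code_simp

lemma checks_101: "list_all (\<lambda>S. check ([root_rows ! 0, root_rows ! 2] @ S)) (subseqs (drop 3 root_rows))"
  by code_simp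

lemma checks_100: "list_all (\<lambda>S. check ([root_rows ! 0] @ S)) (subseqs (drop 3 root_rows))"
  by code_simp

lemma checks_011: "list_all (\<lambda>S. check ([root_rows ! 1, root_rows ! 2] @ S)) (subseqs (drop 3 root_rows))"
  by code_simp

lemma checks_010: "list_all (\<lambda>S. check ([root_rows ! 1] @ S)) (subseqs (drop 3 root_rows))"
  by code_simp

lemma checks_001: "list_all (\<lambda>S. check ([root_rows ! 2] @ S)) (subseqs (drop 3 root_rows))"
  by code_simp

lemma checks_000: "list_all (\<lambda>S. check ([] @ S)) (subseqs (drop 3 root_rows))"
  by code_simp

lemma list_all_subseqs_append:
  "list_all P (subseqs (xs @ ys)) \<longleftrightarrow> list_all (\<lambda>zs. list_all (\<lambda>S. P (zs @ S)) (subseqs ys)) (subseqs xs)"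
proof (induction xs arbitrary: P)
  case (Cons x xs)
  have step: "list_all Q (subseqs (x # zs)) \<longleftrightarrow> list_all (\<lambda>S. Q (x # S)) (subseqs zs) \<and> list_all Q (subseqs zs)" for zs Q
    by (auto simp add: Let_def list_all_iff)
  show ?case unfolding append_Cons step Cons by simp
qed simp

lemma all_checks: "list_all check (subseqs root_rows)"
proof -
  have *: "subseqs [a, b, c] = [[a,b,c],[a,b],[a,c],[a],[b,c],[b],[c],[]]" for a b c :: "sign list"
    by (simp add: Let_def)
  have "root_rows = [root_rows ! 0, root_rows ! 1, root_rows ! 2] @ drop 3 root_rows"
    by (simp add: root_rows_def)
  then have "list_all check (subseqs root_rows) \<longleftrightarrow>
      list_all check (subseqs ([root_rows ! 0, root_rows ! 1, root_rows ! 2] @ drop 3 root_rows))"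
    by (rule arg_cong)
  also have "\<dots>"
    unfolding list_all_subseqs_append * list.pred_inject using checks_111 checks_110 checks_101 checks_100 checks_011 checks_010 checks_001 checks_000 by simp
  finally show ?thesis .
qed

theorem good_cone_positive:
  assumes "S \<subseteq> set positive_roots"
  shows "good_cone S"
proof -
  define L where "L = filter (\<lambda>n. n \<in> S) positive_roots"
  have L: "L \<in> set (subseqs positive_roots)" unfolding L_def by (rule in_subseqs_filter)
  have "check (map row L)"
    using all_checks map_in_subseqs[OF L, of row] by (auto simp: root_rows_eq list_all_iff)
  with L have "good_cone (set L)" by (rule good_cone_if_check)
  also have "set L = S" using assms by (auto simp: L_def)
  finally show ?thesis .
qed

subsection \<open>Symmetry\<close>

text \<open>Signed permutations of the coordinates move every set of roots in an open half space into the
  positive roots. Only their involutive generators are used, so a symmetry is its own inverse.\<close>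

definition symmetry :: "(vec3 \<Rightarrow> vec3) \<Rightarrow> bool" where
  "symmetry g \<longleftrightarrow> g \<circ> g = id \<and> (\<forall>n d. ip (g n) (g d) = ip n d) \<and> g (0, 0, 0) = (0, 0, 0) \<and>
     g ` reps \<subseteq> reps \<and> g ` roots \<subseteq> roots \<and> g ` signs3 \<subseteq> signs3"

lemma symmetry_swap12: "symmetry (\<lambda>(x, y, z). (y, x, z))"
  and symmetry_swap23: "symmetry (\<lambda>(x, y, z). (x, z, y))"
  and symmetry_flip1: "symmetry (\<lambda>(x, y, z). (- x, y, z))"
  and symmetry_flip2: "symmetry (\<lambda>(x, y, z). (x, - y, z))"
  and symmetry_flip3: "symmetry (\<lambda>(x, y, z). (x, y, - z))"
  by (auto simp: symmetry_def fun_eq_iff reps_def bcc_def roots_def signs3_def)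

context
  fixes g assumes g: "symmetry g"
begin

lemma g_g [simp]: "g (g v) = v"
  using g unfolding symmetry_def by (metis comp_apply id_apply)

lemma g_inj: "inj_on g A"
  by (rule inj_on_inverseI[of _ g]) simp

lemma ip_g: "ip (g n) (g d) = ip n d"
  using g unfolding symmetry_def by blast

lemma dirs_g: "dirs (g ` S) = g ` dirs S"
proof -
  have reps: "g d \<in> reps" if "d \<in> reps" for d using g that by (auto simp: symmetry_def)
  show ?thesis
  proof
    show "g ` dirs S \<subseteq> dirs (g ` S)" by (auto simp: dirs_def reps ip_g)
    show "dirs (g ` S) \<subseteq> g ` dirs S"
    proof
      fix d assume "d \<in> dirs (g ` S)"
      then have "g d \<in> dirs S" using reps ip_g[of _ "g d"] by (auto simp: dirs_def)
      then show "d \<in> g ` dirs S" by (metis g_g imageI)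
    qed
  qed
qed

lemma face_g: "face (g ` S) (g d) = g ` face S d"
  by (auto simp: face_def ip_g)

lemma transfer_g:
  assumes "\<And>S. f (g ` S) = f S"
  shows "transfer f (g ` S) = transfer f S"
  unfolding transfer_def dirs_g using g_inj by (simp add: sum.reindex face_g assms)

lemma defect1_g: "defect1 (g ` S) = defect1 S"
  unfolding defect1_def by (simp add: transfer_g)

lemma defect2_g: "defect2 (g ` S) = defect2 S"
  unfolding defect2_def by (simp add: transfer_g defect1_g)

lemma defect3_g: "defect3 (g ` S) = defect3 S"
  unfolding defect3_def by (simp add: transfer_g defect2_g)

lemma good_cone_g: 
  assumes "good_cone (g ` S)"
  shows "good_cone S"
proof -
  have card: "card (g ` S) = card S" using g_inj by (rule card_image)
  have img: "g ` A = g ` B \<longleftrightarrow> A = B" for A B by (rule inj_image_eq_iff) (rule g_inj)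
  have ex: "(\<exists>d\<in>dirs (g ` S). Q d) \<longleftrightarrow> (\<exists>d\<in>dirs S. Q (g d))" for Q
    by (auto simp: dirs_g)
  have reps: "g d \<in> reps" if "d \<in> reps" for d using g that by (auto simp: symmetry_def)
  have zero: "g d = (0, 0, 0) \<longleftrightarrow> d = (0, 0, 0)" for d
    using g by (metis g_g symmetry_def)
  have pointed: "\<exists>d\<in>reps - {(0,0,0)}. face S d = S" if "\<exists>d\<in>reps - {(0,0,0)}. face (g ` S) d = g ` S"
  proof -
    from that obtain d where d: "d \<in> reps" "d \<noteq> (0,0,0)" "face (g ` S) d = g ` S" by auto
    have "face S (g d) = S" using d(3) face_g[of S "g d"] img by auto
    moreover have "g d \<in> reps - {(0,0,0)}" using d reps zero by blast
    ultimately show ?thesis by blast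
  qed
  have signs: "\<forall>f\<in>signs3. \<exists>d\<in>dirs S. ip f d < 0" if *: "\<forall>f\<in>signs3. \<exists>d\<in>dirs (g ` S). ip f d < 0"
  proof
    fix f assume "f \<in> signs3"
    then have "g f \<in> signs3" using g unfolding symmetry_def by blast
    with * have "\<exists>d\<in>dirs (g ` S). ip (g f) d < 0" by (rule bspec)
    then show "\<exists>d\<in>dirs S. ip f d < 0" unfolding ex ip_g .
  qed
  note a = assms[unfolded good_cone_def defect2_g defect3_g card]
  have "\<exists>d\<in>dirs S. face S d \<noteq> {} \<and> face S d \<noteq> S"
    if "\<exists>d\<in>dirs (g ` S). face (g ` S) d \<noteq> {} \<and> face (g ` S) d \<noteq> g ` S"
    using that unfolding ex face_g img image_is_empty .
  then show ?thesis
    unfolding good_cone_def using a pointed signs by blast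
qed

lemma good_cones_g:
  assumes "\<And>S. S \<subseteq> roots \<Longrightarrow> \<forall>n\<in>S. 0 < ip n (g p) \<Longrightarrow> good_cone S"
    and "S \<subseteq> roots" "\<forall>n\<in>S. 0 < ip n p"
  shows "good_cone S"
proof (rule good_cone_g, rule assms(1))
  show "g ` S \<subseteq> roots" using assms(2) g unfolding symmetry_def by blast
  show "\<forall>n\<in>g ` S. 0 < ip n (g p)" using assms(3) by (simp add: ip_g)
qed

end

text \<open>The positive roots are exactly those that are positive on the points of the open chamber
  \<open>0 < c < b < a\<close>.\<close>

lemma good_cone_dominant:
  assumes p: "0 < c" "c < b" "b < a" and S: "S \<subseteq> roots" "\<forall>n\<in>S. 0 < ip n (a, b, c)"
  shows "good_cone S"
proof (rule good_cone_positive, rule subsetI)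
  fix n assume n: "n \<in> S"
  then have "0 < ip n (a, b, c)" using S by blast
  moreover have "\<not> 0 < ip (- m) (a, b, c)" if "m \<in> set positive_roots" for m
    using that p by (auto simp: positive_roots_def)
  ultimately have "n \<notin> uminus ` set positive_roots" by auto
  then show "n \<in> set positive_roots" using n S(1) by (auto simp: roots_eq)
qed

lemma good_cone_generic:
  assumes p: "a \<noteq> 0" "b \<noteq> 0" "c \<noteq> 0" "\<bar>a\<bar> \<noteq> \<bar>b\<bar>" "\<bar>a\<bar> \<noteq> \<bar>c\<bar>" "\<bar>b\<bar> \<noteq> \<bar>c\<bar>"
    and S: "S \<subseteq> roots" "\<forall>n\<in>S. 0 < ip n (a, b, c)"
  shows "good_cone S"
proof -
  define G where "G p \<longleftrightarrow> (\<forall>S\<subseteq>roots. (\<forall>n\<in>S. 0 < ip n p) \<longrightarrow> good_cone S)" for p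
  have sym: "G p" if "symmetry g" "G (g p)" for g p
    using good_cones_g[OF that(1)] that(2) unfolding G_def by blast
  have swap12: "G (y, x, z) \<Longrightarrow> G (x, y, z)" for x y z using sym[OF symmetry_swap12] by simp
  have swap23: "G (x, z, y) \<Longrightarrow> G (x, y, z)" for x y z using sym[OF symmetry_swap23] by simp
  have flip1: "G (- x, y, z) \<Longrightarrow> G (x, y, z)" for x y z using sym[OF symmetry_flip1] by simp
  have flip2: "G (x, - y, z) \<Longrightarrow> G (x, y, z)" for x y z using sym[OF symmetry_flip2] by simp
  have flip3: "G (x, y, - z) \<Longrightarrow> G (x, y, z)" for x y z using sym[OF symmetry_flip3] by simp
  have dom: "G (x, y, z)" if "0 < z" "z < y" "y < x" for x y z
    using good_cone_dominant[OF that] by (auto simp: G_def)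
  have pos: "G (x, y, z)" if xyz: "0 < x" "0 < y" "0 < z" "x \<noteq> y" "x \<noteq> z" "y \<noteq> z" for x y z
  proof -
    consider "z < y" "y < x" | "y < z" "z < x" | "z < x" "x < y" | "x < z" "z < y" | "y < x" "x < z" | "x < y" "y < z"
      using xyz(4-6) by linarith
    then show ?thesis
    proof cases
      case 1 then show ?thesis using dom xyz by blast
    next
      case 2 then show ?thesis using dom swap23 xyz by blast
    next
      case 3 then show ?thesis using dom swap12 xyz by blast
    next
      case 4 then show ?thesis using dom swap12 swap23 xyz by blast
    next
      case 5 then show ?thesis using dom swap12 swap23 xyz by blast
    next
      case 6 then show ?thesis using dom swap12 swap23 xyz by blast
    qed
  qed
  have "G (\<bar>a\<bar>, \<bar>b\<bar>, \<bar>c\<bar>)" using p by (intro pos) auto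
  then have "G (a, \<bar>b\<bar>, \<bar>c\<bar>)" using flip1 by (cases "0 \<le> a") auto
  then have "G (a, b, \<bar>c\<bar>)" using flip2 by (cases "0 \<le> b") auto
  then have "G (a, b, c)" using flip3 by (cases "0 \<le> c") auto
  then show ?thesis using S by (simp add: G_def)
qed

text \<open>A point with positive inner products can be moved off the reflecting planes. Scaling by 10
  leaves room for the perturbation \<open>(3, 2, 1)\<close>, which changes the inner product with a root by at
  most 6.\<close>

theorem good_cone_full_dimensional:
  assumes S: "S \<subseteq> roots" and p: "\<forall>n\<in>S. 0 < ip n p"
  shows "good_cone S"
proof -
  obtain a b c where [simp]: "p = (a, b, c)" by (cases p)
  let ?q = "(10 * a + 3, 10 * b + 2, 10 * c + 1)"
  have ne: "10 * x + k \<noteq> 0" "\<bar>10 * x + k\<bar> \<noteq> \<bar>10 * y + l\<bar>" 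
    if "0 < k" "k < 4" "0 < l" "l < 4" "k \<noteq> l" for x y k l :: int
    using that by presburger+
  have "0 < ip n ?q" if "n \<in> S" for n
  proof -
    obtain x y z where n: "n = (x, y, z)" by (cases n)
    have "\<bar>x\<bar> + \<bar>y\<bar> + \<bar>z\<bar> = 2" using that S n by (auto simp: roots_def)
    then have "-6 \<le> 3 * x + 2 * y + z" by linarith
    moreover have "1 \<le> ip n p" using p that by force
    ultimately show ?thesis by (simp add: n algebra_simps)
  qed
  then have *: "\<forall>n\<in>S. 0 < ip n ?q" by blast
  show ?thesis
    by (rule good_cone_generic[OF _ _ _ _ _ _ S *]) (rule ne[where l = 1] ne[where l = 2] ne[where l = 3]; simp)+
qed

\<comment> \<open>from here on quantifiers over lattice vectors are not split into their coordinates\<close>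
declare split_paired_All [simp del] split_paired_Ex [simp del]

section \<open>Cones in a plane\<close>

definition plane_rays :: "vec3 \<Rightarrow> vec3 \<Rightarrow> vec3 list" where
  "plane_rays e f = [e, e + f, f, f - e, - e, - (e + f), - f, - (f - e)]"

lemma ip_add: "ip n (x + y) = ip n x + ip n y"
  and ip_diff: "ip n (x - y) = ip n x - ip n y"
  and ip_uminus: "ip n (- x) = - ip n x"
  and ip_uminus_left: "ip (- n) x = - ip n x"
  by (cases n; cases x; cases y; simp add: algebra_simps)+

definition octant_pair :: "int \<Rightarrow> int \<Rightarrow> bool" where
  "octant_pair x y \<longleftrightarrow> x = 0 \<or> y = 0 \<or> x = y \<or> x = - y"

text \<open>In the plane orthogonal to a root, the eight nonzero representatives form a ring
  \<open>e, e + f, f, f - e, ...\<close> like the neighbours of a point of the square lattice, and every root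
  restricts to a functional whose kernel contains one of them.\<close>

definition plane_frame :: "vec3 \<Rightarrow> vec3 \<Rightarrow> vec3 \<Rightarrow> bool" where
  "plane_frame n e f \<longleftrightarrow> distinct (plane_rays e f) \<and>
     (\<forall>d\<in>set rays. ip n d = 0 \<longleftrightarrow> d \<in> set (plane_rays e f)) \<and> set (plane_rays e f) \<subseteq> set rays \<and>
     (\<forall>m\<in>set positive_roots. octant_pair (ip m e) (ip m f))"

lemma plane_frames:
  "list_all (\<lambda>(n, e, f). plane_frame n e f)
    [((2,0,0), (0,2,0), (0,0,2)), ((0,2,0), (2,0,0), (0,0,2)), ((0,0,2), (2,0,0), (0,2,0)),
     ((1,1,0), (1,-1,1), (-1,1,1)), ((1,0,1), (1,1,-1), (-1,1,1)), ((0,1,1), (1,1,-1), (1,-1,1)),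
     ((1,-1,0), (1,1,1), (-1,-1,1)), ((1,0,-1), (1,1,1), (-1,1,-1)), ((0,1,-1), (1,1,1), (1,-1,-1))]"
  by code_simp

lemma plane_frame_exists:
  assumes "n \<in> roots"
  obtains e f where "plane_frame n e f"
proof -
  have *: "\<exists>e f. plane_frame m e f" if "m \<in> set positive_roots" for m
    using that plane_frames unfolding positive_roots_def by (auto intro: exI)
  have "plane_frame (- m) e f" if "plane_frame m e f" for m e f
    using that by (simp add: plane_frame_def ip_uminus_left)
  then show ?thesis using assms * that unfolding roots_eq by blast
qed

text \<open>The analogue of the second defect in dimension two, with the factors 9 and 3 in place of 27
  and 9.\<close>

definition flat_defect :: "vec3 set \<Rightarrow> int" where
  "flat_defect S = 3 * (9 - transfer (\<lambda>_. 1) S) - transfer (\<lambda>S. 9 - transfer (\<lambda>_. 1) S) S"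

text \<open>The eight arguments stand for the directions of the plane in cyclic order; each says that some
  root vanishes at the direction and is positive to its left. A direction lies outside the cone or
  contributes 2, and 3 more for each side of its line that a root vanishing on the line cuts off.\<close>

lemma sector_inequality:
  fixes a :: "bool \<Rightarrow> bool \<Rightarrow> bool \<Rightarrow> bool \<Rightarrow> bool \<Rightarrow> int"
  assumes a: "\<And>p q r u v. a p q r u v = (if p \<or> q \<or> r then 0 else 2 + (if u then 3 else 0) + (if v then 3 else 0))"
  shows "a h3 h4 h5 h2 h6 + a h4 h5 h6 h3 h7 + a h5 h6 h7 h4 h0 + a h6 h7 h0 h5 h1 +
      a h7 h0 h1 h6 h2 + a h0 h1 h2 h7 h3 + a h1 h2 h3 h0 h4 + a h2 h3 h4 h1 h5 \<le> 16"
  unfolding a by (cases h0; cases h1; cases h2; cases h3; cases h4; cases h5; cases h6; cases h7; simp)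

context
  fixes n e f assumes frame: "plane_frame n e f"
begin

lemma transfer_plane:
  assumes flat: "\<And>d. d \<in> dirs S \<Longrightarrow> ip n d = 0" and ps: "set (plane_rays e f) = set ps" "length ps = 8"
  shows "transfer g S = g S + (\<Sum>d\<leftarrow>ps. if \<forall>m\<in>S. 0 \<le> ip m d then g (face S d) else 0)"
proof -
  have "card (set (plane_rays e f)) = 8"
    using frame by (subst distinct_card) (simp_all add: plane_frame_def plane_rays_def)
  then have "distinct ps" using ps by (simp add: card_distinct)
  have "dirs S = insert (0, 0, 0) {d \<in> set ps. \<forall>m\<in>S. 0 \<le> ip m d}"
    using flat frame unfolding ps(1)[symmetric] by (auto simp: dirs_def reps_eq plane_frame_def)
  moreover have "(0, 0, 0) \<notin> {d \<in> set ps. \<forall>m\<in>S. 0 \<le> ip m d}"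
    using distinct_rays frame unfolding ps(1)[symmetric] by (auto simp: plane_frame_def)
  ultimately have "transfer g S = g S + (\<Sum>d\<in>{d \<in> set ps. \<forall>m\<in>S. 0 \<le> ip m d}. g (face S d))"
    unfolding transfer_def by simp
  also have "(\<Sum>d\<in>{d \<in> set ps. \<forall>m\<in>S. 0 \<le> ip m d}. g (face S d)) =
      (\<Sum>d\<leftarrow>ps. if \<forall>m\<in>S. 0 \<le> ip m d then g (face S d) else 0)"
    using \<open>distinct ps\<close> by (subst sum.inter_filter) (simp_all add: sum_list_distinct_conv_sum_set)
  finally show ?thesis .
qed

text \<open>At a nonzero point \<open>u\<close> of the plane the cone is the whole plane, a half plane bounded by the line
  of \<open>u\<close>, or this line: of the six directions off the line the roots that vanish at \<open>u\<close> remove three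
  on either side.\<close>

lemma count_half_planes:
  assumes flat: "\<And>d. d \<in> dirs (face S u) \<Longrightarrow> ip n d = 0"
    and ps: "set (plane_rays e f) = set [u, p1, p2, p3, - u, - p1, - p2, - p3]"
    and sg: "\<And>m. ip m u = 0 \<Longrightarrow> sgn (ip m p1) = sgn (ip m p2) \<and> sgn (ip m p3) = sgn (ip m p2)"
  shows "transfer (\<lambda>_. 1) (face S u) = 9 - (if \<exists>m\<in>S. ip m u = 0 \<and> 0 < ip m p2 then 3 else 0)
     - (if \<exists>m\<in>S. ip m u = 0 \<and> ip m p2 < 0 then 3 else 0)"
proof -
  have *: "(\<forall>m\<in>face S u. 0 \<le> ip m p) \<longleftrightarrow> \<not> (\<exists>m\<in>S. ip m u = 0 \<and> ip m p2 < 0)"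
    and **: "(\<forall>m\<in>face S u. 0 \<le> ip m (- p)) \<longleftrightarrow> \<not> (\<exists>m\<in>S. ip m u = 0 \<and> 0 < ip m p2)"
    if "p = p1 \<or> p = p2 \<or> p = p3" for p
  proof -
    have "ip m p < 0 \<longleftrightarrow> ip m p2 < 0" "0 < ip m p \<longleftrightarrow> 0 < ip m p2" if "ip m u = 0" for m
      using sg[OF that] \<open>p = p1 \<or> p = p2 \<or> p = p3\<close> by (metis sgn_less sgn_greater)+
    then show "(\<forall>m\<in>face S u. 0 \<le> ip m p) \<longleftrightarrow> \<not> (\<exists>m\<in>S. ip m u = 0 \<and> ip m p2 < 0)"
      "(\<forall>m\<in>face S u. 0 \<le> ip m (- p)) \<longleftrightarrow> \<not> (\<exists>m\<in>S. ip m u = 0 \<and> 0 < ip m p2)"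
      by (auto simp: face_def ip_uminus not_less[symmetric])
  qed
  have "\<forall>m\<in>face S u. 0 \<le> ip m u" "\<forall>m\<in>face S u. 0 \<le> ip m (- u)"
    by (auto simp: face_def ip_uminus)
  moreover have "transfer (\<lambda>_. 1) (face S u) = 1 + (\<Sum>d\<leftarrow>[u, p1, p2, p3, - u, - p1, - p2, - p3].
      if \<forall>m\<in>face S u. 0 \<le> ip m d then 1 else 0)"
    by (rule transfer_plane[OF flat ps]) simp_all
  ultimately show ?thesis by (simp add: * ** del: bex_simps)
qed

text \<open>The flat defect is \<open>18 - 2 T - r\<close>, where \<open>T\<close> counts the representatives in the cone and \<open>r\<close>
  adds up \<open>9\<close> minus the counts of the faces. With the origin taken out of \<open>T\<close> this is 16 minus the
  sum in the sector inequality. The hypothesis that the face at any \<open>d\<close> stays in the plane expresses that the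
  polytope itself lies in a plane.\<close>

lemma flat_defect_nonneg:
  assumes S: "S \<subseteq> roots" and flat: "\<And>d d'. d \<in> dirs S \<Longrightarrow> d' \<in> dirs (face S d) \<Longrightarrow> ip n d' = 0"
  shows "0 \<le> flat_defect S"
proof -
  let ?k = "transfer (\<lambda>_. 1)"
  have zero: "(0,0,0) \<in> dirs S" by (simp add: dirs_def reps_eq)
  have flat0: "ip n d = 0" if "d \<in> dirs S" for d
    using flat[OF zero] that by simp
  have oct: "octant_pair (ip m e) (ip m f)" if "m \<in> S" for m
  proof -
    have "m \<in> roots" using that S by blast
    then show ?thesis using frame
      by (auto simp: roots_eq plane_frame_def ip_uminus_left octant_pair_def simp del: uminus_Pair)
  qed
  have ray: "d \<in> reps" if "d \<in> set (plane_rays e f)" for d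
    using frame that by (auto simp: plane_frame_def reps_eq)
  have flat1: "ip n d' = 0" if "d \<in> set (plane_rays e f)" "\<forall>m\<in>S. 0 \<le> ip m d" "d' \<in> dirs (face S d)" for d d'
    using that ray by (intro flat[of d]) (auto simp: dirs_def)
  define h where "h u v \<longleftrightarrow> (\<exists>m\<in>S. ip m u = 0 \<and> 0 < ip m v)" for u v
  have summand: "(if \<forall>m\<in>S. 0 \<le> ip m d then 2 + (9 - ?k (face S d)) else 0) =
      (if h p1 p3 \<or> h p2 (- d) \<or> h p3 (- p1) then 0 else 2 + (if h d p2 then 3 else 0) + (if h (- d) (- p2) then 3 else 0))"
    if st: "set (plane_rays e f) = set [d, p1, p2, p3, - d, - p1, - p2, - p3]"
      and sg: "\<And>m. ip m d = 0 \<Longrightarrow> sgn (ip m p1) = sgn (ip m p2) \<and> sgn (ip m p3) = sgn (ip m p2)"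
      and cl: "\<And>m. m \<in> S \<Longrightarrow> ip m d < 0 \<longleftrightarrow> ip m p1 = 0 \<and> 0 < ip m p3 \<or> ip m p2 = 0 \<and> ip m d < 0 \<or> ip m p3 = 0 \<and> ip m p1 < 0"
    for d p1 p2 p3
  proof -
    have "(\<forall>m\<in>S. 0 \<le> ip m d) \<longleftrightarrow> \<not> (h p1 p3 \<or> h p2 (- d) \<or> h p3 (- p1))"
      using cl unfolding h_def ip_uminus neg_0_less_iff_less by (meson not_less)
    moreover have "?k (face S d) = 9 - (if h d p2 then 3 else 0) - (if h (- d) (- p2) then 3 else 0)"
      if adm: "\<forall>m\<in>S. 0 \<le> ip m d"
    proof -
      have "d \<in> set (plane_rays e f)" using st by simp
      from count_half_planes[OF flat1[OF this adm] st sg] show ?thesis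
        unfolding h_def ip_uminus by simp
    qed
    ultimately show ?thesis by simp
  qed
  define g k where "g = e + f" and "k = f - e"
  have ps: "plane_rays e f = [e, g, f, k, - e, - g, - f, - k]"
    by (simp add: plane_rays_def g_def k_def)
  have gk: "ip m g = ip m e + ip m f" "ip m k = ip m f - ip m e" for m
    by (simp_all add: g_def k_def ip_add ip_diff)
  note o = oct[unfolded octant_pair_def]
  have sums: "(\<Sum>d\<leftarrow>plane_rays e f. if \<forall>m\<in>S. 0 \<le> ip m d then 2 + (9 - ?k (face S d)) else 0) \<le> 16"
  proof -
    define a :: "bool \<Rightarrow> bool \<Rightarrow> bool \<Rightarrow> bool \<Rightarrow> bool \<Rightarrow> int"
      where "a p q r u v = (if p \<or> q \<or> r then 0 else 2 + (if u then 3 else 0) + (if v then 3 else 0))" for p q r u v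
    have set: "set (plane_rays e f) = {e, g, f, k, - e, - g, - f, - k}" by (simp add: ps)
    note s = summand[folded a_def]
    have s0: "(if \<forall>m\<in>S. 0 \<le> ip m e then 2 + (9 - ?k (face S e)) else 0) = a (h g k) (h f (- e)) (h k (- g)) (h e f) (h (- e) (- f))"
      by (rule s[of "e" "g" "f" "k", simplified]; (use o in \<open>force simp: set gk ip_uminus sgn_if\<close>)?)
    have s1: "(if \<forall>m\<in>S. 0 \<le> ip m g then 2 + (9 - ?k (face S g)) else 0) = a (h f (- e)) (h k (- g)) (h (- e) (- f)) (h g k) (h (- g) (- k))"
      by (rule s[of "g" "f" "k" "(- e)", simplified]; (use o in \<open>force simp: set gk ip_uminus sgn_if\<close>)?)
    have s2: "(if \<forall>m\<in>S. 0 \<le> ip m f then 2 + (9 - ?k (face S f)) else 0) = a (h k (- g)) (h (- e) (- f)) (h (- g) (- k)) (h f (- e)) (h (- f) e)"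
      by (rule s[of "f" "k" "(- e)" "(- g)", simplified]; (use o in \<open>force simp: set gk ip_uminus sgn_if\<close>)?)
    have s3: "(if \<forall>m\<in>S. 0 \<le> ip m k then 2 + (9 - ?k (face S k)) else 0) = a (h (- e) (- f)) (h (- g) (- k)) (h (- f) e) (h k (- g)) (h (- k) g)"
      by (rule s[of "k" "(- e)" "(- g)" "(- f)", simplified]; (use o in \<open>force simp: set gk ip_uminus sgn_if\<close>)?)
    have s4: "(if \<forall>m\<in>S. 0 \<le> ip m (- e) then 2 + (9 - ?k (face S (- e))) else 0) = a (h (- g) (- k)) (h (- f) e) (h (- k) g) (h (- e) (- f)) (h e f)"
      by (rule s[of "(- e)" "(- g)" "(- f)" "(- k)", simplified]; (use o in \<open>force simp: set gk ip_uminus sgn_if\<close>)?)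
    have s5: "(if \<forall>m\<in>S. 0 \<le> ip m (- g) then 2 + (9 - ?k (face S (- g))) else 0) = a (h (- f) e) (h (- k) g) (h e f) (h (- g) (- k)) (h g k)"
      by (rule s[of "(- g)" "(- f)" "(- k)" "e", simplified]; (use o in \<open>force simp: set gk ip_uminus sgn_if\<close>)?)
    have s6: "(if \<forall>m\<in>S. 0 \<le> ip m (- f) then 2 + (9 - ?k (face S (- f))) else 0) = a (h (- k) g) (h e f) (h g k) (h (- f) e) (h f (- e))"
      by (rule s[of "(- f)" "(- k)" "e" "g", simplified]; (use o in \<open>force simp: set gk ip_uminus sgn_if\<close>)?)
    have s7: "(if \<forall>m\<in>S. 0 \<le> ip m (- k) then 2 + (9 - ?k (face S (- k))) else 0) = a (h e f) (h g k) (h f (- e)) (h (- k) g) (h k (- g))"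
      by (rule s[of "(- k)" "e" "g" "f", simplified]; (use o in \<open>force simp: set gk ip_uminus sgn_if\<close>)?)
    show ?thesis unfolding ps using sector_inequality[of a, OF a_def] by (simp add: s0 s1 s2 s3 s4 s5 s6 s7 add.assoc)
  qed
  have "?k S = 1 + (\<Sum>d\<leftarrow>plane_rays e f. if \<forall>m\<in>S. 0 \<le> ip m d then 1 else 0)"
    by (rule transfer_plane[OF flat0]) (simp_all add: plane_rays_def)
  moreover have "transfer (\<lambda>S. 9 - ?k S) S = 9 - ?k S + (\<Sum>d\<leftarrow>plane_rays e f. if \<forall>m\<in>S. 0 \<le> ip m d then 9 - ?k (face S d) else 0)"
    by (rule transfer_plane[OF flat0]) (simp_all add: plane_rays_def)
  moreover have "(\<Sum>d\<leftarrow>ds. if Q d then 2 + r d else 0) = 2 * (\<Sum>d\<leftarrow>ds. if Q d then 1 else 0) + (\<Sum>d\<leftarrow>ds. if Q d then r d else 0)"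
    for ds :: "vec3 list" and Q and r :: "vec3 \<Rightarrow> int" by (induction ds) auto
  note this[of "\<lambda>d. \<forall>m\<in>S. 0 \<le> ip m d" "\<lambda>d. 9 - ?k (face S d)"]
  ultimately show ?thesis using sums unfolding flat_defect_def by simp
qed

end

section \<open>Lattice points of a threefold dilate\<close>

fun triple_plus :: "vec3 \<Rightarrow> vec3 \<Rightarrow> vec3" where
  "triple_plus (x, y, z) (a, b, c) = (3 * x + a, 3 * y + b, 3 * z + c)"

lemma ip_triple_plus: "ip n (triple_plus z d) = 3 * ip n z + ip n d"
  by (cases n; cases z; cases d) (simp add: algebra_simps)

lemma triple_plus_bcc: "z \<in> bcc \<Longrightarrow> d \<in> bcc \<Longrightarrow> triple_plus z d \<in> bcc"
  by (cases z; cases d) (simp add: bcc_def)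

lemma reps_bcc: "reps \<subseteq> bcc"
  by (auto simp: reps_def)

text \<open>Division by three with residues \<open>-1, 0, 1\<close>. If the quotients have different parities, the
  residues are not all odd; then replacing the residues \<open>1\<close> and \<open>-1\<close> by \<open>-2\<close> and \<open>2\<close> repairs the parities and leaves
  at most two nonzero residues.\<close>

lemma triple_plus_exists:
  assumes "y \<in> bcc"
  obtains z d where "z \<in> bcc" "d \<in> reps" "y = triple_plus z d"
proof -
  obtain a b c where y: "y = (a, b, c)" by (cases y)
  have par: "even (a - b)" "even (b - c)" using assms by (auto simp: y bcc_def)
  define q where "q x = (if x mod 3 = 2 then x div 3 + 1 else x div 3)" for x :: int
  define r where "r x = (if x mod 3 = 2 then - 1 else x mod 3)" for x :: int
  have qr: "x = 3 * q x + r x" "r x = -1 \<or> r x = 0 \<or> r x = 1" for x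
    unfolding q_def r_def by presburger+
  show ?thesis
  proof (cases "even (q a - q b) \<and> even (q b - q c)")
    case True
    show ?thesis
    proof (rule that[of "(q a, q b, q c)" "(r a, r b, r c)"])
      show "y = triple_plus (q a, q b, q c) (r a, r b, r c)" using qr(1) by (simp add: y)
      show "(q a, q b, q c) \<in> bcc" using True by (simp add: bcc_def)
      have "even (r a - r b)" "even (r b - r c)"
        using True par qr(1)[of a] qr(1)[of b] qr(1)[of c] by presburger+
      then show "(r a, r b, r c) \<in> reps" using qr(2)[of a] qr(2)[of b] qr(2)[of c]
        by (auto simp: reps_def bcc_def)
    qed
  next
    case False
    \<comment> \<open>now some residue is 0 and some is not; shift the nonzero odd ones by 3\<close>
    define s where "s x = (if r x = 0 then 0 else - 2 * r x)" for x
    define p where "p x = (if r x = 0 then q x else q x + r x)" for x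
    have ps: "x = 3 * p x + s x" for x using qr(1)[of x] by (auto simp: p_def s_def)
    have "even (s x)" for x by (simp add: s_def)
    then have "even (p x - p y)" if "even (x - y)" for x y
      using that ps[of x] ps[of y] by (metis dvd_diff_right_iff even_add even_diff even_mult_iff odd_numeral)
    then have "even (p a - p b)" "even (p b - p c)"
      using par by blast+
    have "r a = 0 \<or> r b = 0 \<or> r c = 0"
    proof (rule ccontr)
      assume "\<not> ?thesis"
      then have "odd (r a)" "odd (r b)" "odd (r c)" using qr(2)[of a] qr(2)[of b] qr(2)[of c] by auto
      then show False using False par qr(1)[of a] qr(1)[of b] qr(1)[of c] by presburger
    qed
    show ?thesis
    proof (rule that[of "(p a, p b, p c)" "(s a, s b, s c)"])
      show "y = triple_plus (p a, p b, p c) (s a, s b, s c)" using ps by (simp add: y)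
      show "(p a, p b, p c) \<in> bcc" using \<open>even (p a - p b)\<close> \<open>even (p b - p c)\<close> by (simp add: bcc_def)
      show "(s a, s b, s c) \<in> reps"
        using \<open>r a = 0 \<or> r b = 0 \<or> r c = 0\<close> qr(2)[of a] qr(2)[of b] qr(2)[of c]
        by (auto simp: reps_def bcc_def s_def)
    qed
  qed
qed

text \<open>Two representatives of one coset would differ by \<open>\<plusminus>3\<close> in every coordinate. One of them has
  odd coordinates, hence sum of absolute values at most three, and then the other has sum at least
  six.\<close>

lemma triple_plus_unique:
  assumes "z \<in> bcc" "z' \<in> bcc" "d \<in> reps" "d' \<in> reps" "triple_plus z d = triple_plus z' d'"
  shows "z = z'" "d = d'"
proof -
  obtain x1 x2 x3 y1 y2 y3 where z: "z = (x1, x2, x3)" "z' = (y1, y2, y3)" by (cases z; cases z')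
  obtain d1 d2 d3 e1 e2 e3 where d: "d = (d1, d2, d3)" "d' = (e1, e2, e3)" by (cases d; cases d')
  have eq: "3 * (x1 - y1) = e1 - d1" "3 * (x2 - y2) = e2 - d2" "3 * (x3 - y3) = e3 - d3"
    using assms(5) by (simp_all add: z d)
  have d_reps: "even (d1 - d2)" "even (d2 - d3)" "\<bar>d1\<bar> \<le> 2" "\<bar>d2\<bar> \<le> 2" "\<bar>d3\<bar> \<le> 2" "\<bar>d1\<bar> + \<bar>d2\<bar> + \<bar>d3\<bar> \<le> 4"
    and e_reps: "even (e1 - e2)" "even (e2 - e3)" "\<bar>e1\<bar> \<le> 2" "\<bar>e2\<bar> \<le> 2" "\<bar>e3\<bar> \<le> 2" "\<bar>e1\<bar> + \<bar>e2\<bar> + \<bar>e3\<bar> \<le> 4"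
    using assms(3,4) by (auto simp: reps_def bcc_def d)
  have par: "even (x1 - y1 - (x2 - y2))" "even (x2 - y2 - (x3 - y3))"
    using assms(1,2) by (auto simp: bcc_def z)
  have bound: "\<bar>x - y\<bar> \<le> 1" if "3 * (x - y) = e - d" "\<bar>d\<bar> \<le> 2" "\<bar>e\<bar> \<le> 2" for x y e d :: int
    using that by presburger
  have bd: "\<bar>x1 - y1\<bar> \<le> 1" "\<bar>x2 - y2\<bar> \<le> 1" "\<bar>x3 - y3\<bar> \<le> 1"
    using bound[OF eq(1)] bound[OF eq(2)] bound[OF eq(3)] d_reps(3-5) e_reps(3-5) by blast+
  have "x1 - y1 = 0 \<and> x2 - y2 = 0 \<and> x3 - y3 = 0"
  proof (rule ccontr)
    assume "\<not> ?thesis"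
    then have *: "\<bar>x1 - y1\<bar> = 1" "\<bar>x2 - y2\<bar> = 1" "\<bar>x3 - y3\<bar> = 1" using bd par by presburger+
    have "\<bar>e - d\<bar> = 3" if "3 * (x - y) = e - d" "\<bar>x - y\<bar> = 1" for x y e d :: int
      using that by presburger
    then have **: "\<bar>e1 - d1\<bar> = 3" "\<bar>e2 - d2\<bar> = 3" "\<bar>e3 - d3\<bar> = 3"
      using eq * by blast+
    have sums: "\<bar>d1\<bar> + \<bar>e1\<bar> \<ge> 3" "\<bar>d2\<bar> + \<bar>e2\<bar> \<ge> 3" "\<bar>d3\<bar> + \<bar>e3\<bar> \<ge> 3" using ** by auto
    have small: "\<bar>x\<bar> \<le> 1" if "odd x" "\<bar>x\<bar> \<le> 2" for x :: int
      using that by presburger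
    consider "odd e1" "odd e2" "odd e3" | "odd d1" "odd d2" "odd d3"
    proof -
      have "odd e1 \<longleftrightarrow> even d1" using **(1) by presburger
      then show thesis using d_reps(1,2) e_reps(1,2) that by auto
    qed
    then show False
    proof cases
      case 1
      then have "\<bar>e1\<bar> \<le> 1" "\<bar>e2\<bar> \<le> 1" "\<bar>e3\<bar> \<le> 1" using small e_reps by blast+
      then show False using sums d_reps(6) by linarith
    next
      case 2
      then have "\<bar>d1\<bar> \<le> 1" "\<bar>d2\<bar> \<le> 1" "\<bar>d3\<bar> \<le> 1" using small d_reps by blast+
      then show False using sums e_reps(6) by linarith
    qed
  qed
  then show "z = z'" "d = d'" using eq by (simp_all add: z d)
qed

text \<open>All quantities are even, so an inequality that is strict has a slack of at least two; tripled,
  this compensates a value of at least \<open>-4\<close>.\<close>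

lemma triple_compare:
  fixes k u v :: int
  assumes "even u" "even k" "even v" "\<bar>v\<bar> \<le> 4"
  shows "3 * k \<le> 3 * u + v \<longleftrightarrow> k < u \<or> k = u \<and> 0 \<le> v" "3 * u + v = 3 * k \<longleftrightarrow> u = k \<and> v = 0"
  using assms by presburger+

lemma even_ip:
  assumes "n \<in> roots" "z \<in> bcc"
  shows "even (ip n z)"
proof -
  obtain a b c x y w where [simp]: "n = (a, b, c)" "z = (x, y, w)" by (cases n; cases z)
  have "even (a + b + c)" using assms(1) by (simp add: roots_def) presburger
  moreover have "even (x - y)" "even (y - w)" using assms(2) by (auto simp: bcc_def)
  moreover have "ip n z = (a + b + c) * x - b * (x - y) - c * (x - y + (y - w))" by (simp add: algebra_simps)
  ultimately show ?thesis by simp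
qed

lemma abs_ip_reps:
  assumes "n \<in> roots" "d \<in> reps"
  shows "\<bar>ip n d\<bar> \<le> 4"
proof -
  obtain a b c x y w where [simp]: "n = (a, b, c)" "d = (x, y, w)" by (cases n; cases d)
  have "\<bar>ip n d\<bar> \<le> \<bar>a * x\<bar> + \<bar>b * y\<bar> + \<bar>c * w\<bar>" by simp
  also have "\<dots> \<le> \<bar>a\<bar> * 2 + \<bar>b\<bar> * 2 + \<bar>c\<bar> * 2"
    unfolding abs_mult using assms(2) by (intro add_mono mult_left_mono) (auto simp: reps_def)
  also have "\<dots> = 4" using assms(1) by (auto simp: roots_def)
  finally show ?thesis .
qed

text \<open>A polyhedron whose facet normals are roots. Even bounds reflect that roots take even values on
  the lattice.\<close>

locale root_polytope =
  fixes A :: "vec3 set" and \<beta> :: "vec3 \<Rightarrow> int"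
  assumes roots: "A \<subseteq> roots" and even_\<beta>: "\<And>n. n \<in> A \<Longrightarrow> even (\<beta> n)"
begin

definition pts :: "nat \<Rightarrow> vec3 set" where
  "pts t = {z \<in> bcc. \<forall>n\<in>A. int t * \<beta> n \<le> ip n z}"

definition tight :: "nat \<Rightarrow> vec3 \<Rightarrow> vec3 set" where
  "tight t z = {n \<in> A. ip n z = int t * \<beta> n}"

lemma finite_A: "finite A" using roots finite_roots by (rule finite_subset)
lemma tight_subset: "tight t z \<subseteq> A" by (auto simp: tight_def)
lemma tight_roots: "tight t z \<subseteq> roots" using tight_subset roots by blast

lemma triple_plus_constraint:
  assumes "n \<in> A" "z \<in> bcc" "d \<in> reps"
  shows "int (3 * t) * \<beta> n \<le> ip n (triple_plus z d) \<longleftrightarrow>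
      int t * \<beta> n < ip n z \<or> int t * \<beta> n = ip n z \<and> 0 \<le> ip n d"
    and "ip n (triple_plus z d) = int (3 * t) * \<beta> n \<longleftrightarrow> ip n z = int t * \<beta> n \<and> ip n d = 0"
proof -
  have "n \<in> roots" using assms(1) roots by blast
  then have *: "even (ip n z)" "even (int t * \<beta> n)" "even (ip n d)" "\<bar>ip n d\<bar> \<le> 4"
    using assms even_ip[of n z] abs_ip_reps[of n d] even_ip[of n d] reps_bcc even_\<beta> by auto
  have "int (3 * t) * \<beta> n = 3 * (int t * \<beta> n)" by simp
  then show "int (3 * t) * \<beta> n \<le> ip n (triple_plus z d) \<longleftrightarrow>
      int t * \<beta> n < ip n z \<or> int t * \<beta> n = ip n z \<and> 0 \<le> ip n d"
    "ip n (triple_plus z d) = int (3 * t) * \<beta> n \<longleftrightarrow> ip n z = int t * \<beta> n \<and> ip n d = 0"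
    using triple_compare[OF *] unfolding ip_triple_plus by presburger+
qed

lemma triple_plus_pts:
  assumes "z \<in> bcc" "d \<in> reps"
  shows "triple_plus z d \<in> pts (3 * t) \<longleftrightarrow> z \<in> pts t \<and> d \<in> dirs (tight t z)"
proof -
  have "triple_plus z d \<in> bcc" using assms triple_plus_bcc reps_bcc by blast
  then have "triple_plus z d \<in> pts (3 * t) \<longleftrightarrow>
     (\<forall>n\<in>A. int t * \<beta> n < ip n z \<or> int t * \<beta> n = ip n z \<and> 0 \<le> ip n d)"
    unfolding pts_def using triple_plus_constraint(1)[OF _ assms] by auto
  also have "\<dots> \<longleftrightarrow> z \<in> pts t \<and> d \<in> dirs (tight t z)"
    using assms by (fastforce simp: pts_def dirs_def tight_def le_less)
  finally show ?thesis .
qed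

lemma tight_triple_plus:
  assumes "z \<in> bcc" "d \<in> reps"
  shows "tight (3 * t) (triple_plus z d) = face (tight t z) d"
  using triple_plus_constraint(2)[OF _ assms] by (auto simp: tight_def face_def)

lemma pts_bcc: "pts t \<subseteq> bcc" by (auto simp: pts_def)

lemma pts_triple: "pts (3 * t) = (\<lambda>(z, d). triple_plus z d) ` (SIGMA z:pts t. dirs (tight t z))"
proof
  show "pts (3 * t) \<subseteq> (\<lambda>(z, d). triple_plus z d) ` (SIGMA z:pts t. dirs (tight t z))"
  proof
    fix y assume y: "y \<in> pts (3 * t)"
    obtain z d where zd: "z \<in> bcc" "d \<in> reps" "y = triple_plus z d"
      using y pts_bcc by (blast elim: triple_plus_exists)
    then show "y \<in> (\<lambda>(z, d). triple_plus z d) ` (SIGMA z:pts t. dirs (tight t z))"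
      using y triple_plus_pts by (intro image_eqI[of _ _ "(z, d)"]) auto
  qed
  show "(\<lambda>(z, d). triple_plus z d) ` (SIGMA z:pts t. dirs (tight t z)) \<subseteq> pts (3 * t)"
  proof
    fix y assume "y \<in> (\<lambda>(z, d). triple_plus z d) ` (SIGMA z:pts t. dirs (tight t z))"
    then obtain z d where zd: "z \<in> pts t" "d \<in> dirs (tight t z)" "y = triple_plus z d"
      by (auto simp del: triple_plus.simps)
    then show "y \<in> pts (3 * t)"
      using triple_plus_pts[of z d t] pts_bcc by (auto simp: dirs_def)
  qed
qed

text \<open>The bridge between global counts and local cones.\<close>

lemma sum_transfer:
  assumes "finite (pts t)"
  shows "(\<Sum>y\<in>pts (3 * t). f (tight (3 * t) y)) = (\<Sum>z\<in>pts t. transfer f (tight t z))"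
proof -
  have inj: "inj_on (\<lambda>(z, d). triple_plus z d) (SIGMA z:pts t. dirs (tight t z))"
  proof (rule inj_onI, clarify)
    fix z d z' d'
    assume "z \<in> pts t" "d \<in> dirs (tight t z)" "z' \<in> pts t" "d' \<in> dirs (tight t z')" "triple_plus z d = triple_plus z' d'"
    then show "z = z' \<and> d = d'"
      using triple_plus_unique[of z z' d d'] pts_bcc by (auto simp: dirs_def)
  qed
  have "(\<Sum>y\<in>pts (3 * t). f (tight (3 * t) y)) =
      (\<Sum>(z, d)\<in>(SIGMA z:pts t. dirs (tight t z)). f (tight (3 * t) (triple_plus z d)))"
    unfolding pts_triple by (subst sum.reindex[OF inj]) (simp add: case_prod_unfold)
  also have "\<dots> = (\<Sum>(z, d)\<in>(SIGMA z:pts t. dirs (tight t z)). f (face (tight t z) d))"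
  proof (rule sum.cong, rule refl, clarify)
    fix z d assume "z \<in> pts t" "d \<in> dirs (tight t z)"
    then show "f (tight (3 * t) (triple_plus z d)) = f (face (tight t z) d)"
      using pts_bcc by (subst tight_triple_plus) (auto simp: dirs_def)
  qed
  also have "\<dots> = (\<Sum>z\<in>pts t. transfer f (tight t z))"
    unfolding transfer_def using assms by (subst sum.Sigma) auto
  finally show ?thesis .
qed

lemma scaled_add_pts:
  assumes "z \<in> pts t" "w \<in> pts u"
  shows "z + w \<in> pts (t + u)"
proof -
  have "z + w \<in> bcc" using assms pts_bcc by (cases z; cases w) (auto simp: bcc_def pts_def)
  moreover have "int (t + u) * \<beta> n \<le> ip n (z + w)" if "n \<in> A" for n
    using assms that by (auto simp: pts_def ip_add distrib_right intro: add_mono)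
  ultimately show ?thesis by (simp add: pts_def)
qed

lemma tight_add:
  assumes "z \<in> pts t" "w \<in> pts u"
  shows "tight (t + u) (z + w) = tight t z \<inter> tight u w"
proof -
  have "ip n (z + w) = int (t + u) * \<beta> n \<longleftrightarrow> ip n z = int t * \<beta> n \<and> ip n w = int u * \<beta> n" if "n \<in> A" for n
  proof -
    have "int t * \<beta> n \<le> ip n z" "int u * \<beta> n \<le> ip n w" using assms that by (auto simp: pts_def)
    then show ?thesis by (auto simp: ip_add algebra_simps)
  qed
  then show ?thesis by (auto simp: tight_def)
qed

text \<open>Subtracting multiples of \<open>z\<close> from an interior point gives a vector on which all tight roots are
  positive.\<close>

lemma good_cone_tight:
  assumes q: "q \<in> pts u" "tight u q = {}" and z: "z \<in> pts t" and t: "0 < t"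
  shows "good_cone (tight t z)"
proof -
  obtain q1 q2 q3 z1 z2 z3 where [simp]: "q = (q1, q2, q3)" "z = (z1, z2, z3)" by (cases q; cases z)
  let ?p = "(int t * q1 - int u * z1, int t * q2 - int u * z2, int t * q3 - int u * z3)"
  have "\<forall>n\<in>tight t z. 0 < ip n ?p"
  proof
    fix n assume n: "n \<in> tight t z"
    obtain a b c where [simp]: "n = (a, b, c)" by (cases n)
    have "n \<in> A" "ip n z = int t * \<beta> n" using n by (auto simp: tight_def)
    moreover have "int u * \<beta> n < ip n q" using q \<open>n \<in> A\<close> by (force simp: pts_def tight_def)
    ultimately have "int t * (int u * \<beta> n) < int t * ip n q" "ip n z = int t * \<beta> n" using t by simp_all
    moreover have "ip n ?p = int t * ip n q - int u * ip n z" by (simp add: algebra_simps)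
    ultimately show "0 < ip n ?p" by (simp add: algebra_simps)
  qed
  then show ?thesis by (rule good_cone_full_dimensional[OF tight_roots])
qed

end

section \<open>Nonnegative coefficients\<close>

lemma coeff_ge_limit:
  fixes Q :: "real poly"
  assumes deg: "degree Q \<le> m" and ge: "\<And>K. \<exists>n\<ge>K. c * real n ^ m \<le> poly Q (real n)"
  shows "c \<le> coeff Q m"
proof (rule ccontr)
  assume "\<not> c \<le> coeff Q m"
  define R where "R = Q - monom c m"
  have R: "coeff R m < 0" "degree R \<le> m"
    using \<open>\<not> c \<le> coeff Q m\<close> deg unfolding R_def by (simp_all add: degree_diff_le degree_monom_le)
  then have "degree R = m" by (metis le_antisym le_degree order_less_irrefl)
  then have "lead_coeff (- R) > 0" using R by simp
  then obtain x where x: "\<And>y. x \<le> y \<Longrightarrow> lead_coeff (- R) \<le> poly (- R) y"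
    using poly_pinfty_gt_lc by blast
  obtain n where n: "n \<ge> nat \<lceil>x\<rceil>" "c * real n ^ m \<le> poly Q (real n)" using ge by blast
  have "poly (- R) (real n) > 0" using x[of "real n"] n(1) \<open>lead_coeff (- R) > 0\<close> by linarith
  then show False using n(2) by (simp add: R_def poly_monom)
qed

lemma coeff_nonneg_limit:
  fixes Q :: "real poly"
  assumes "degree Q \<le> m" "\<And>n. n \<ge> 1 \<Longrightarrow> 0 \<le> poly Q (real n)"
  shows "0 \<le> coeff Q m"
proof (rule coeff_ge_limit[OF assms(1)])
  show "\<exists>n\<ge>K. 0 * real n ^ m \<le> poly Q (real n)" for K
    using assms(2)[of "max 1 K"] by (intro exI[of _ "max 1 K"]) simp
qed

definition tripling :: "real \<Rightarrow> real poly \<Rightarrow> real poly" where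
  "tripling a Q = smult a Q - pcompose Q [:0, 3:]"

lemma poly_tripling: "poly (tripling a Q) (real n) = a * poly Q (real n) - poly Q (real (3 * n))"
  by (simp add: tripling_def poly_pcompose mult.commute)

lemma coeff_tripling: "coeff (tripling a Q) k = (a - 3 ^ k) * coeff Q k"
  by (simp add: tripling_def coeff_pcompose_linear algebra_simps)

context root_polytope
begin

lemma sum_tripling:
  assumes "finite (pts t)" "\<And>t. 0 < t \<Longrightarrow> poly Q (real t) = of_int (\<Sum>z\<in>pts t. f (tight t z))" "0 < t"
  shows "poly (tripling (of_int a) Q) (real t) = of_int (\<Sum>z\<in>pts t. a * f (tight t z) - transfer f (tight t z))"
proof -
  have "0 < 3 * t" using assms(3) by simp
  then have "poly Q (real (3 * t)) = of_int (\<Sum>z\<in>pts t. transfer f (tight t z))"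
    by (simp only: assms(2) sum_transfer[OF assms(1), of f])
  then show ?thesis unfolding poly_tripling assms(2)[OF \<open>0 < t\<close>]
    by (simp add: sum_subtractf sum_distrib_left)
qed

end

lemma defect1_nonneg: "0 \<le> defect1 S"
proof -
  have "card (dirs S) \<le> 27" unfolding card_reps[symmetric] by (rule card_mono) (auto simp: dirs_def)
  then show ?thesis by (simp add: defect1_def transfer_def)
qed

lemma defect1_pos:
  assumes "S \<subseteq> roots" "S \<noteq> {}"
  shows "0 < defect1 S"
proof -
  obtain n where n: "n \<in> S" using assms(2) by blast
  have "n \<in> roots" using n assms(1) by blast
  have "\<exists>d\<in>reps. ip n d < 0"
    using \<open>n \<in> roots\<close> unfolding roots_eq
  proof
    assume "n \<in> set positive_roots"
    then show ?thesis by (auto simp: positive_roots_def reps_eq rays_def)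
  next
    assume "n \<in> uminus ` set positive_roots"
    then show ?thesis by (auto simp: positive_roots_def reps_eq rays_def)
  qed
  then have "dirs S \<subset> reps" using n by (force simp: dirs_def)
  then have "card (dirs S) < 27" unfolding card_reps[symmetric] by (rule psubset_card_mono[OF finite_reps])
  then show ?thesis by (simp add: defect1_def transfer_def)
qed

locale counting_polynomial = root_polytope +
  fixes P :: "real poly"
  assumes finite_pts: "\<And>t. 0 < t \<Longrightarrow> finite (pts t)"
    and poly_P: "\<And>t. 0 < t \<Longrightarrow> poly P (real t) = real (card (pts t))"
begin

abbreviation "Q1 \<equiv> tripling 27 P"
abbreviation "Q2 \<equiv> tripling 9 Q1"
abbreviation "Q3 \<equiv> tripling 3 Q2"

lemma poly_P_sum: "0 < t \<Longrightarrow> poly P (real t) = of_int (\<Sum>z\<in>pts t. 1)"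
  using poly_P by simp

lemma poly_Q1: "0 < t \<Longrightarrow> poly Q1 (real t) = of_int (\<Sum>z\<in>pts t. defect1 (tight t z))"
  using sum_tripling[OF finite_pts, of _ P "\<lambda>_. 1" 27] poly_P_sum by (simp add: defect1_def)

lemma poly_Q2: "0 < t \<Longrightarrow> poly Q2 (real t) = of_int (\<Sum>z\<in>pts t. defect2 (tight t z))"
  using sum_tripling[OF finite_pts, of _ Q1 defect1 9] poly_Q1 by (simp add: defect2_def)

lemma poly_Q3: "0 < t \<Longrightarrow> poly Q3 (real t) = of_int (\<Sum>z\<in>pts t. defect3 (tight t z))"
  using sum_tripling[OF finite_pts, of _ Q2 defect2 3] poly_Q2 by (simp add: defect3_def)

lemma poly_P_nonneg: "1 \<le> t \<Longrightarrow> 0 \<le> poly P (real t)"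
  using poly_P by simp

lemma poly_Q1_nonneg: "1 \<le> t \<Longrightarrow> 0 \<le> poly Q1 (real t)"
  using poly_Q1[of t] by (simp add: sum_nonneg defect1_nonneg)

text \<open>Both \<open>P\<close> and \<open>27 P(t) - P(3t)\<close> are nonnegative at the positive integers. If the degree exceeded
  three, their leading coefficients would have opposite signs.\<close>

lemma degree_P: "degree P \<le> 3"
proof (rule ccontr)
  assume "\<not> degree P \<le> 3"
  define k where "k = degree P"
  have "degree Q1 \<le> k" unfolding k_def by (rule degree_le) (simp add: coeff_tripling coeff_eq_0)
  then have "0 \<le> coeff Q1 k" using poly_Q1_nonneg by (rule coeff_nonneg_limit)
  moreover have "0 \<le> coeff P k" using poly_P_nonneg by (intro coeff_nonneg_limit) (simp_all add: k_def)
  moreover have "(3::real) ^ 4 \<le> 3 ^ k" using \<open>\<not> degree P \<le> 3\<close> by (intro power_increasing) (simp_all add: k_def)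
  then have "27 - (3::real) ^ k < 0" by simp
  ultimately have "coeff P k = 0"
    unfolding coeff_tripling by (metis mult_le_0_iff not_less order_antisym zero_le_mult_iff)
  then have "P = 0" by (simp add: k_def)
  then show False using \<open>\<not> degree P \<le> 3\<close> by simp
qed

lemma coeff_P_high: "3 < k \<Longrightarrow> coeff P k = 0"
  using degree_P by (intro coeff_eq_0) simp

lemma coeff_P_3: "0 \<le> coeff P 3"
  using degree_P poly_P_nonneg by (rule coeff_nonneg_limit)

lemma degree_tripling:
  assumes "degree Q \<le> Suc m"
  shows "degree (tripling (3 ^ Suc m) Q) \<le> m"
proof (rule degree_le, intro allI impI)
  fix k assume "m < k"
  then have "k = Suc m \<or> Suc m < k" by auto
  then show "coeff (tripling (3 ^ Suc m) Q) k = 0"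
    using assms by (auto simp: coeff_tripling coeff_eq_0)
qed

lemma degree_Q1: "degree Q1 \<le> 2"
  using degree_tripling[of P 2] degree_P by (simp add: numeral_eq_Suc)

lemma degree_Q2: "degree Q2 \<le> 1"
  using degree_tripling[of Q1 1] degree_Q1 by (simp add: numeral_eq_Suc)

lemma degree_Q3: "degree Q3 \<le> 0"
  using degree_tripling[of Q2 0] degree_Q2 by simp

lemma coeff_P_nonneg_if:
  assumes "0 \<le> coeff P 0" "0 \<le> coeff P 1" "0 \<le> coeff P 2"
  shows "0 \<le> coeff P k"
proof -
  have "k = 0 \<or> k = 1 \<or> k = 2 \<or> k = 3 \<or> 3 < k" by auto
  then show ?thesis using assms coeff_P_3 coeff_P_high by auto
qed

lemma coeff_P_2: "0 \<le> coeff P 2"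
  using coeff_nonneg_limit[OF degree_Q1 poly_Q1_nonneg] by (simp add: coeff_tripling)

lemma coeffs_nonneg_full:
  assumes good: "\<And>t z. 0 < t \<Longrightarrow> z \<in> pts t \<Longrightarrow> good_cone (tight t z)"
  shows "0 \<le> coeff P k"
proof -
  have *: "0 \<le> poly Q2 (real t)" "0 \<le> poly Q3 (real t)" if "1 \<le> t" for t
  proof -
    have "0 \<le> defect2 (tight t z)" "0 \<le> defect3 (tight t z)" if "z \<in> pts t" for z
      using good[OF _ that] \<open>1 \<le> t\<close> by (simp_all add: good_cone_def)
    then show "0 \<le> poly Q2 (real t)" "0 \<le> poly Q3 (real t)"
      using poly_Q2[of t] poly_Q3[of t] that by (simp_all add: sum_nonneg)
  qed
  have "0 \<le> coeff Q2 1" using degree_Q2 *(1) by (rule coeff_nonneg_limit)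
  then have p1: "0 \<le> coeff P 1" by (simp add: coeff_tripling)
  have "0 \<le> coeff Q3 0" using degree_Q3 *(2) by (rule coeff_nonneg_limit)
  then have p0: "0 \<le> coeff P 0" by (simp add: coeff_tripling)
  from p0 p1 coeff_P_2 show ?thesis by (rule coeff_P_nonneg_if)
qed

text \<open>If one root is tight everywhere, the representatives that occur lie in the plane orthogonal to
  it, and the factors 9 and 3 suffice.\<close>

lemma coeffs_nonneg_flat:
  assumes n: "n \<in> A" and flat: "\<And>t z. 0 < t \<Longrightarrow> z \<in> pts t \<Longrightarrow> n \<in> tight t z"
  shows "0 \<le> coeff P k"
proof -
  have "n \<in> roots" using n roots by blast
  then obtain e f where frame: "plane_frame n e f" by (rule plane_frame_exists)
  have dirs0: "ip n d = 0" if z: "0 < t" "z \<in> pts t" and d: "d \<in> dirs (tight t z)" for t z d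
  proof -
    have *: "z \<in> bcc" "d \<in> reps" using z d pts_bcc by (auto simp: dirs_def)
    then have "triple_plus z d \<in> pts (3 * t)" using triple_plus_pts z d by blast
    then have "n \<in> tight (3 * t) (triple_plus z d)" using flat z by simp
    then show ?thesis using * by (simp add: tight_triple_plus face_def)
  qed
  define R1 R2 where "R1 = tripling 9 P" and "R2 = tripling 3 R1"
  define r where "r S = 9 - transfer (\<lambda>_. 1) S" for S
  have R1: "poly R1 (real t) = of_int (\<Sum>z\<in>pts t. r (tight t z))" if "0 < t" for t
    using sum_tripling[OF finite_pts, of _ P "\<lambda>_. 1" 9] poly_P_sum that by (simp add: r_def R1_def)
  have R2: "poly R2 (real t) = of_int (\<Sum>z\<in>pts t. flat_defect (tight t z))" if "0 < t" for t
    using sum_tripling[OF finite_pts, of _ R1 r 3] R1 that by (simp add: r_def[abs_def] R2_def flat_defect_def)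
  have r: "0 \<le> r (tight t z)" if "0 < t" "z \<in> pts t" for t z
  proof -
    have "card (dirs (tight t z)) \<le> card (insert (0,0,0) (set (plane_rays e f)))"
      using dirs0[OF that] frame by (intro card_mono) (auto simp: dirs_def reps_eq plane_frame_def)
    also have "\<dots> \<le> 1 + length (plane_rays e f)"
      using card_length[of "plane_rays e f"] by (simp add: card_insert_if del: set_simps)
    finally show ?thesis by (simp add: r_def transfer_def plane_rays_def)
  qed
  have R1_nonneg: "0 \<le> poly R1 (real t)" if "1 \<le> t" for t
    using R1[of t] r[of t] that by (simp add: sum_nonneg)
  have R2_nonneg: "0 \<le> poly R2 (real t)" if "1 \<le> t" for t
  proof -
    have "0 \<le> flat_defect (tight t z)" if "z \<in> pts t" for z
    proof (rule flat_defect_nonneg[OF frame tight_roots])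
      fix d d' assume d: "d \<in> dirs (tight t z)" "d' \<in> dirs (face (tight t z) d)"
      have *: "z \<in> bcc" "d \<in> reps" using that d pts_bcc by (auto simp: dirs_def)
      then have "triple_plus z d \<in> pts (3 * t)" using triple_plus_pts that d by blast
      moreover have "d' \<in> dirs (tight (3 * t) (triple_plus z d))" using d * by (simp add: tight_triple_plus)
      ultimately show "ip n d' = 0" using dirs0[of "3 * t"] \<open>1 \<le> t\<close> by simp
    qed
    then show ?thesis using R2[of t] that by (simp add: sum_nonneg)
  qed
  have c1: "coeff R1 k = (9 - 3 ^ k) * coeff P k" for k by (simp add: R1_def coeff_tripling)
  have c2: "coeff R2 k = (3 - 3 ^ k) * coeff R1 k" for k by (simp add: R2_def coeff_tripling)
  have "degree R1 \<le> 3" by (rule degree_le) (simp add: c1 coeff_P_high)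
  then have "0 \<le> coeff R1 3" using R1_nonneg by (rule coeff_nonneg_limit)
  then have p3: "coeff P 3 = 0" using coeff_P_3 by (simp add: c1)
  have "degree P \<le> 2"
  proof (rule degree_le, intro allI impI)
    fix k :: nat assume "2 < k"
    then have "k = 3 \<or> 3 < k" by auto
    then show "coeff P k = 0" using p3 coeff_P_high by auto
  qed
  then have "degree R1 \<le> 1" using degree_tripling[of P 1] by (simp add: R1_def numeral_eq_Suc)
  then have "0 \<le> coeff R1 1" using R1_nonneg by (rule coeff_nonneg_limit)
  have "degree R2 \<le> 0" using degree_tripling[of R1 0] \<open>degree R1 \<le> 1\<close> by (simp add: R2_def)
  then have "0 \<le> coeff R2 0" using R2_nonneg by (rule coeff_nonneg_limit)
  with \<open>0 \<le> coeff R1 1\<close>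
  have "0 \<le> coeff P 0" "0 \<le> coeff P 1" by (simp_all add: c1 c2)
  then show ?thesis using coeff_P_2 by (rule coeff_P_nonneg_if)
qed

text \<open>The sum of two lattice points of dilates is a lattice point of the sum of the dilates, with the
  intersection of the tight sets. So if for every root some point is not tight, then some dilate
  has an interior lattice point.\<close>

theorem coeffs_nonneg: "0 \<le> coeff P k"
proof (cases "\<exists>u q. 0 < u \<and> q \<in> pts u \<and> tight u q = {}")
  case True
  then show ?thesis using good_cone_tight coeffs_nonneg_full by blast
next
  case no_interior: False
  show ?thesis
  proof (cases "\<exists>t z. 0 < t \<and> z \<in> pts t")
    case False
    then have "pts t = {}" if "0 < t" for t using that by blast
    then have "poly P (real t) = 0" if "0 < t" for t using that poly_P by simp
    then have "real ` {0<..} \<subseteq> {x. poly P x = 0}" by auto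
    moreover have "infinite (real ` {0<..})" by (simp add: finite_image_iff inj_on_def infinite_Ioi)
    ultimately have "P = 0" using poly_roots_finite finite_subset by blast
    then show ?thesis by simp
  next
    case True
    have "\<exists>n\<in>A. \<forall>t z. 0 < t \<longrightarrow> z \<in> pts t \<longrightarrow> n \<in> tight t z"
    proof (rule ccontr)
      assume "\<not> ?thesis"
      then have *: "\<exists>u w. 0 < u \<and> w \<in> pts u \<and> n \<notin> tight u w" if "n \<in> A" for n
        using that by blast
      have "\<exists>t z. 0 < t \<and> z \<in> pts t \<and> tight t z \<inter> B = {}" if "finite B" "B \<subseteq> A" for B
        using that
      proof (induction rule: finite_induct)
        case empty
        then show ?case using True by simp
      next
        case (insert n B)
        then obtain t z where "0 < t" "z \<in> pts t" "tight t z \<inter> B = {}" by auto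
        moreover obtain u w where "0 < u" "w \<in> pts u" "n \<notin> tight u w" using *[of n] insert.prems by blast
        ultimately show ?case
          using scaled_add_pts[of z t w u] tight_add[of z t w u] by (intro exI[of _ "t + u"] exI[of _ "z + w"]) auto
      qed
      from this[OF finite_A] obtain t z where "0 < t" "z \<in> pts t" "tight t z \<inter> A = {}" by auto
      then show False using no_interior tight_subset by blast
    qed
    then show ?thesis using coeffs_nonneg_flat by blast
  qed
qed

end

section \<open>Positive coefficients\<close>

text \<open>The cone contains no representative together with its negative; by \<open>pointed_orthogonal\<close> this
  means that it contains no line at all.\<close>

definition pointed :: "vec3 set \<Rightarrow> bool" where
  "pointed T \<longleftrightarrow> (\<forall>d\<in>reps - {(0,0,0)}. face T d \<noteq> T)"

lemma reps_uminus: "d \<in> reps \<Longrightarrow> - d \<in> reps"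
  by (cases d) (auto simp: reps_def bcc_def)

lemma face_eq_iff: "face T d = T \<longleftrightarrow> (\<forall>n\<in>T. ip n d = 0)"
  by (auto simp: face_def)

text \<open>The vector \<open>v\<close> is replaced by a representative with the same signs in the coordinates of maximal
  absolute value and zeros elsewhere. A root that vanishes at \<open>v\<close> is \<open>2e\<^sub>i\<close> or compares two
  coordinates of equal absolute value, so it also vanishes at the representative.\<close>

lemma pointed_orthogonal:
  assumes T: "T \<subseteq> roots" "pointed T" and v: "\<forall>n\<in>T. ip n v = 0"
  shows "v = (0, 0, 0)"
proof (rule ccontr)
  assume "v \<noteq> (0, 0, 0)"
  obtain a b c where abc: "v = (a, b, c)" by (cases v)
  define m where "m = max \<bar>a\<bar> (max \<bar>b\<bar> \<bar>c\<bar>)"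
  have m: "\<bar>a\<bar> \<le> m" "\<bar>b\<bar> \<le> m" "\<bar>c\<bar> \<le> m" "m = \<bar>a\<bar> \<or> m = \<bar>b\<bar> \<or> m = \<bar>c\<bar>"
    unfolding m_def by linarith+
  have "a \<noteq> 0 \<or> b \<noteq> 0 \<or> c \<noteq> 0" using \<open>v \<noteq> (0, 0, 0)\<close> by (simp add: abc)
  with m have m0: "0 < m" by linarith
  define k where "k = (if \<bar>a\<bar> = m \<and> \<bar>b\<bar> = m \<and> \<bar>c\<bar> = m then 1 else 2 :: int)"
  define s where "s x = (if \<bar>x\<bar> = m then k * sgn x else 0)" for x :: int
  have s: "s x = 0 \<longleftrightarrow> \<bar>x\<bar> \<noteq> m" "s (- x) = - s x" for x
    using m0 by (auto simp: s_def k_def sgn_if)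
  have abs_s: "\<bar>s x\<bar> = (if \<bar>x\<bar> = m then k else 0)" for x
    using m0 by (auto simp: s_def k_def sgn_if)
  let ?d = "(s a, s b, s c)"
  have "?d \<in> reps"
  proof -
    have "even (s a - s b)" "even (s b - s c)" "\<bar>s a\<bar> + \<bar>s b\<bar> + \<bar>s c\<bar> \<le> 4"
      by (auto simp: s_def k_def sgn_if)
    then show ?thesis using abs_s by (simp add: reps_def bcc_def k_def)
  qed
  moreover have "?d \<noteq> (0, 0, 0)" using m(4) s(1) by auto
  moreover have "ip n ?d = 0" if "n \<in> T" for n
  proof -
    obtain x y z where n: "n = (x, y, z)" by (cases n)
    have "x * a + y * b + z * c = 0" using v that by (auto simp: n abc)
    moreover have "n \<in> roots" using that T by blast
    moreover have "s 0 = 0" using m0 by (simp add: s_def)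
    ultimately show ?thesis
      unfolding roots_eq positive_roots_def n
      using s(2)[of a] s(2)[of b] s(2)[of c] by (auto simp: eq_neg_iff_add_eq_0[symmetric] add_eq_0_iff)
  qed
  ultimately show False using T(2) unfolding pointed_def face_eq_iff by blast
qed

lemma root_orthogonal:
  assumes "n \<in> roots"
  shows "\<exists>d\<in>reps - {(0,0,0)}. ip n d = 0"
  using assms by (auto simp: roots_eq positive_roots_def reps_eq rays_def)

lemma card_pointed:
  assumes "pointed T" "T \<subseteq> roots"
  shows "2 \<le> card T"
proof (rule ccontr)
  assume "\<not> 2 \<le> card T"
  have "finite T" using assms(2) finite_roots by (rule finite_subset)
  then have "T = {} \<or> (\<exists>n. T = {n})"
  proof -
    have "card T = 0 \<or> card T = 1" using \<open>\<not> 2 \<le> card T\<close> by arith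
    then show ?thesis using \<open>finite T\<close> by (metis card_0_eq card_1_singletonE)
  qed
  then show False
  proof
    assume "T = {}"
    moreover have "(1, 1, 1) \<in> reps - {(0, 0, 0)}" by (simp add: reps_def bcc_def)
    ultimately show False using assms(1) unfolding pointed_def face_eq_iff by blast
  next
    assume "\<exists>n. T = {n}"
    then show False using assms root_orthogonal unfolding pointed_def face_eq_iff by blast
  qed
qed

lemma card_root_plane:
  assumes "n \<in> roots"
  shows "card {d \<in> reps. ip n d = 0} = 9"
proof -
  obtain e f where frame: "plane_frame n e f" using plane_frame_exists[OF assms] .
  then have "{d \<in> reps. ip n d = 0} = set ((0, 0, 0) # plane_rays e f)"
    by (auto simp: reps_eq plane_frame_def)
  moreover have "distinct ((0, 0, 0) # plane_rays e f)"
    using frame distinct_rays by (auto simp: plane_frame_def)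
  ultimately have "card {d \<in> reps. ip n d = 0} = length ((0, 0, 0) # plane_rays e f)"
    by (metis distinct_card)
  then show ?thesis by (simp add: plane_rays_def)
qed

context counting_polynomial
begin

text \<open>Move from \<open>z\<close> along a line in the tangent cone on which \<open>f\<close> does not increase, until a further
  root becomes tight. In the dilate \<open>2t\<close> this happens at a lattice point: the last admissible point
  would miss the new facet by less than one step, and a step changes the value of a root by 2 or
  4.\<close>

lemma push_to_new_facet:
  assumes t: "0 < t" "z \<in> pts t" and np: "\<not> pointed (tight t z)"
  shows "\<exists>t' z'. 0 < t' \<and> z' \<in> pts t' \<and> tight t z \<subset> tight t' z' \<and> ip f z' * int t \<le> ip f z * int t'"
proof -
  let ?T = "tight t z"
  obtain d0 where d0: "d0 \<in> reps" "d0 \<noteq> (0,0,0)" "\<forall>n\<in>?T. ip n d0 = 0"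
    using np by (auto simp: pointed_def face_eq_iff)
  define d where "d = (if ip f d0 \<le> 0 then d0 else - d0)"
  have d: "d \<in> reps" "d \<noteq> (0,0,0)" "\<forall>n\<in>?T. ip n d = 0" "ip f d \<le> 0"
    using d0 reps_uminus by (auto simp: d_def ip_uminus zero_prod_def[symmetric])
  obtain z1 z2 z3 where z: "z = (z1, z2, z3)" by (cases z)
  obtain d1 d2 d3 where dd: "d = (d1, d2, d3)" by (cases d)
  define y where "y s = (2 * z1 + int s * d1, 2 * z2 + int s * d2, 2 * z3 + int s * d3)" for s :: nat
  have ip_y: "ip n (y s) = 2 * ip n z + int s * ip n d" for n s
    by (cases n) (simp add: y_def z dd algebra_simps)
  have y_bcc: "y s \<in> bcc" for s
    using t(2) d(1) by (auto simp: y_def z dd pts_def reps_def bcc_def simp flip: right_diff_distrib)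
  have "inj y" using d(2) by (auto simp: inj_def y_def dd)
  define N where "N = {s. y s \<in> pts (2 * t)}"
  have "finite N"
    using finite_vimageI[OF finite_pts[of "2 * t"] \<open>inj y\<close>] t by (simp add: N_def vimage_def)
  have "0 \<in> N"
    unfolding N_def mem_Collect_eq pts_def using y_bcc t(2) by (auto simp: ip_y pts_def)
  define s where "s = Max N"
  have s: "y s \<in> pts (2 * t)" using Max_in[OF \<open>finite N\<close>] \<open>0 \<in> N\<close> by (auto simp: s_def N_def)
  have "Suc s \<notin> N" using Max_ge[OF \<open>finite N\<close>, of "Suc s"] by (auto simp: s_def)
  then obtain n where n: "n \<in> A" "ip n (y (Suc s)) < int (2 * t) * \<beta> n"
    using y_bcc by (auto simp: N_def pts_def not_le)
  have ge: "int (2 * t) * \<beta> n \<le> ip n (y s)" using s n(1) by (simp add: pts_def)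
  have "n \<in> roots" using n(1) roots by blast
  have step: "ip n (y (Suc s)) = ip n (y s) + ip n d" by (simp add: ip_y algebra_simps)
  obtain i j b where ev: "ip n z = 2 * i" "ip n d = 2 * j" "\<beta> n = 2 * b"
    using even_ip[OF \<open>n \<in> roots\<close>] t(2) pts_bcc d(1) reps_bcc even_\<beta>[OF n(1)] by (meson evenE subsetD)
  have "\<bar>ip n d\<bar> \<le> 4" using abs_ip_reps \<open>n \<in> roots\<close> d(1) by blast
  have eq: "ip n (y s) = int (2 * t) * \<beta> n"
  proof -
    define x where "x = 2 * i + int s * j - 2 * int t * b"
    have "0 \<le> 2 * x" "2 * x + 2 * j < 0" 
      using ge n(2) unfolding step by (simp_all add: ip_y ev x_def algebra_simps)
    moreover have "\<bar>2 * j\<bar> \<le> 4" using \<open>\<bar>ip n d\<bar> \<le> 4\<close> by (simp add: ev)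
    \<comment> \<open>in units of two: a slack of one needs a step of two, but then the slack is even\<close>
    ultimately have "x = 0 \<or> x = 1 \<and> j = - 2" by linarith
    moreover have "x \<noteq> 1" if "j = - 2"
    proof -
      have "even x" by (simp add: x_def that)
      then show ?thesis by auto
    qed
    ultimately have "x = 0" by blast
    then show ?thesis by (simp add: ip_y ev x_def algebra_simps)
  qed
  have "ip n d < 0" using n(2) ge step by linarith
  then have "n \<notin> ?T" using d(3) by auto
  moreover have "n \<in> tight (2 * t) (y s)" using n(1) eq by (simp add: tight_def)
  moreover have "?T \<subseteq> tight (2 * t) (y s)" using d(3) by (auto simp: tight_def ip_y)
  moreover have "ip f (y s) * int t \<le> ip f z * int (2 * t)"
  proof -
    have "int s * ip f d * int t \<le> 0" using d(4) by (simp add: mult_nonneg_nonpos mult_nonpos_nonneg)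
    then show ?thesis by (simp add: ip_y algebra_simps)
  qed
  ultimately show ?thesis using s t(1) by (intro exI[of _ "2 * t"] exI[of _ "y s"]) auto
qed

text \<open>The functional divided by the dilation does not increase along the pushes; the number of tight
  roots does.\<close>

lemma pointed_below:
  assumes "0 < t" "z \<in> pts t"
  shows "\<exists>t' z'. 0 < t' \<and> z' \<in> pts t' \<and> pointed (tight t' z') \<and> ip f z' * int t \<le> ip f z * int t'"
  using assms
proof (induction "card A - card (tight t z)" arbitrary: t z rule: less_induct)
  case less
  show ?case
  proof (cases "pointed (tight t z)")
    case True
    then show ?thesis using less.prems by blast
  next
    case False
    then obtain t1 z1 where 1: "0 < t1" "z1 \<in> pts t1" "tight t z \<subset> tight t1 z1" "ip f z1 * int t \<le> ip f z * int t1"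
      using push_to_new_facet[OF less.prems False] by blast
    have "card (tight t1 z1) \<le> card A" using finite_A tight_subset by (rule card_mono)
    moreover have "card (tight t z) < card (tight t1 z1)"
      using 1(3) finite_subset[OF tight_subset finite_A] by (intro psubset_card_mono)
    ultimately obtain t2 z2 where 2: "0 < t2" "z2 \<in> pts t2" "pointed (tight t2 z2)" "ip f z2 * int t1 \<le> ip f z1 * int t2"
      using less.hyps[OF _ 1(1,2)] by (meson diff_less_mono2 less_le_trans)
    have "(ip f z2 * int t) * int t1 \<le> (ip f z * int t2) * int t1"
    proof -
      have "(ip f z2 * int t1) * int t \<le> (ip f z1 * int t2) * int t" using 2(4) by (intro mult_right_mono) auto
      also have "\<dots> = (ip f z1 * int t) * int t2" by (simp add: algebra_simps)
      also have "\<dots> \<le> (ip f z * int t1) * int t2" using 1(4) by (intro mult_right_mono) auto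
      finally show ?thesis by (simp add: algebra_simps)
    qed
    then have "ip f z2 * int t \<le> ip f z * int t2" using 1(1) by simp
    then show ?thesis using 2 by blast
  qed
qed

text \<open>Vertices are determined by their tight sets, so up to dilation there are finitely many and one
  of them minimises \<open>f\<close>. A direction of the cone on which \<open>f\<close> is negative would lead below the
  minimum by \<open>pointed_below\<close>.\<close>

lemma optimal_vertex:
  assumes "0 < t" "z \<in> pts t"
  shows "\<exists>t z. 0 < t \<and> z \<in> pts t \<and> pointed (tight t z) \<and> (\<forall>d\<in>dirs (tight t z). 0 \<le> ip f d)"
proof -
  define V where "V = {(t, z). 0 < t \<and> z \<in> pts t \<and> pointed (tight t z)}"
  define \<rho> where "\<rho> = (\<lambda>(t, z). of_int (ip f z) / real t)"
  have \<rho>_eq: "\<rho> (t, z) = \<rho> (u, w)" if "(t, z) \<in> V" "(u, w) \<in> V" "tight t z = tight u w" for t z u w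
  proof -
    obtain z1 z2 z3 w1 w2 w3 where zw: "z = (z1, z2, z3)" "w = (w1, w2, w3)" by (cases z; cases w)
    let ?v = "(int u * z1 - int t * w1, int u * z2 - int t * w2, int u * z3 - int t * w3)"
    have ip_v: "ip n ?v = int u * ip n z - int t * ip n w" for n
      by (cases n) (simp add: zw algebra_simps)
    have "\<forall>n\<in>tight t z. ip n ?v = 0"
    proof
      fix n assume n: "n \<in> tight t z"
      then have "ip n z = int t * \<beta> n" by (simp add: tight_def)
      moreover have "n \<in> tight u w" using n that(3) by simp
      then have "ip n w = int u * \<beta> n" by (simp add: tight_def)
      ultimately show "ip n ?v = 0" unfolding ip_v by simp
    qed
    then have "?v = (0, 0, 0)" using that(1) by (intro pointed_orthogonal[OF tight_roots]) (auto simp: V_def)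
    then have "int u * ip f z = int t * ip f w" using ip_v[of f] by simp
    then have "real u * of_int (ip f z) = real t * of_int (ip f w)"
      by (metis of_int_mult of_int_of_nat_eq)
    then show ?thesis using that(1,2) by (simp add: V_def \<rho>_def field_simps)
  qed
  have "finite (\<rho> ` V)"
  proof -
    have "\<rho> ` V \<subseteq> (\<lambda>T. \<rho> (SOME v. v \<in> V \<and> tight (fst v) (snd v) = T)) ` Pow A"
    proof
      fix x assume "x \<in> \<rho> ` V"
      then obtain v where v: "v \<in> V" "x = \<rho> v" by blast
      define w where "w = (SOME w. w \<in> V \<and> tight (fst w) (snd w) = tight (fst v) (snd v))"
      have w: "w \<in> V \<and> tight (fst w) (snd w) = tight (fst v) (snd v)"
        unfolding w_def by (rule someI[of _ v]) (use v in simp)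
      then have "\<rho> v = \<rho> w" using \<rho>_eq[of "fst v" "snd v" "fst w" "snd w"] v(1) by simp
      then show "x \<in> (\<lambda>T. \<rho> (SOME v. v \<in> V \<and> tight (fst v) (snd v) = T)) ` Pow A"
        using v(2) tight_subset unfolding w_def by (intro image_eqI[of _ _ "tight (fst v) (snd v)"]) auto
    qed
    then show ?thesis by (rule finite_subset) (simp add: finite_A)
  qed
  moreover have "V \<noteq> {}" using pointed_below[OF assms, of f] by (auto simp: V_def)
  ultimately obtain v where v: "v \<in> V" "\<And>w. w \<in> V \<Longrightarrow> \<rho> v \<le> \<rho> w"
  proof -
    have "Min (\<rho> ` V) \<in> \<rho> ` V" using \<open>finite (\<rho> ` V)\<close> \<open>V \<noteq> {}\<close> by (intro Min_in) auto
    then obtain v where "v \<in> V" "Min (\<rho> ` V) = \<rho> v" by blast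
    moreover have "Min (\<rho> ` V) \<le> \<rho> w" if "w \<in> V" for w using \<open>finite (\<rho> ` V)\<close> that by (intro Min_le) auto
    ultimately show thesis using that by metis
  qed
  obtain t z where tz: "v = (t, z)" by (cases v)
  have tz': "0 < t" "z \<in> pts t" "pointed (tight t z)" using v(1) by (auto simp: tz V_def)
  have "0 \<le> ip f d" if d: "d \<in> dirs (tight t z)" for d
  proof (rule ccontr)
    assume neg: "\<not> 0 \<le> ip f d"
    have "triple_plus z d \<in> pts (3 * t)"
      using triple_plus_pts[of z d t] d tz' pts_bcc by (auto simp: dirs_def)
    then obtain u w where w: "0 < u" "w \<in> pts u" "pointed (tight u w)"
        "ip f w * int (3 * t) \<le> ip f (triple_plus z d) * int u"
      using pointed_below[of "3 * t" "triple_plus z d" f] tz' by auto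
    have "ip f w * int (3 * t) < 3 * ip f z * int u"
    proof -
      have "ip f d * int u < 0" using neg w(1) by (simp add: mult_neg_pos)
      then show ?thesis using w(4) by (simp add: ip_triple_plus algebra_simps)
    qed
    then have "ip f w * int t < ip f z * int u" by simp
    then have "of_int (ip f w) * real t < of_int (ip f z) * real u"
      by (metis of_int_less_iff of_int_mult of_int_of_nat_eq)
    then have "\<rho> (u, w) < \<rho> (t, z)" using w(1) tz'(1) by (simp add: \<rho>_def field_simps)
    then show False using v(2)[of "(u, w)"] w by (auto simp: V_def tz)
  qed
  then show ?thesis using tz' by blast
qed

lemma sum_growth:
  assumes "\<And>S. m * f S \<le> transfer f S" "0 \<le> m" "0 < t"
  shows "m ^ k * (\<Sum>z\<in>pts t. f (tight t z)) \<le> (\<Sum>z\<in>pts (3 ^ k * t). f (tight (3 ^ k * t) z))"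
proof (induction k)
  case (Suc k)
  have "m ^ Suc k * (\<Sum>z\<in>pts t. f (tight t z)) \<le> m * (\<Sum>z\<in>pts (3 ^ k * t). f (tight (3 ^ k * t) z))"
    using mult_left_mono[OF Suc assms(2)] by (simp add: mult.assoc)
  also have "\<dots> \<le> (\<Sum>z\<in>pts (3 ^ k * t). transfer f (tight (3 ^ k * t) z))"
    unfolding sum_distrib_left by (intro sum_mono assms(1))
  also have "\<dots> = (\<Sum>z\<in>pts (3 ^ Suc k * t). f (tight (3 ^ Suc k * t) z))"
    using sum_transfer[OF finite_pts, of "3 ^ k * t" f] assms(3) by (simp add: mult.assoc)
  finally show ?case .
qed simp

text \<open>Along the dilations \<open>3\<^sup>K t\<close> the sum of \<open>f\<close> grows like \<open>(3\<^sup>m)\<^sup>K\<close> and is bounded by a polynomial of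
  degree \<open>m\<close>.\<close>

lemma coeff_pos_by_growth:
  assumes f: "\<And>S. 3 ^ m * f S \<le> transfer f S" "\<And>S. 0 \<le> f S" and t: "0 < t" "z \<in> pts t" "1 \<le> f (tight t z)"
    and Q: "degree Q \<le> m" "\<And>t. 0 < t \<Longrightarrow> of_int (\<Sum>z\<in>pts t. f (tight t z)) \<le> poly Q (real t)"
  shows "0 < coeff Q m"
proof -
  have start: "1 \<le> (\<Sum>z\<in>pts t. f (tight t z))"
    using t(3) member_le_sum[OF t(2), of "\<lambda>z. f (tight t z)"] f(2) finite_pts[OF t(1)] by force
  have "1 / real t ^ m \<le> coeff Q m"
  proof (rule coeff_ge_limit[OF Q(1)])
    fix K
    have "K \<le> 3 ^ K * t"
    proof -
      have "K \<le> 3 ^ K" by (rule less_imp_le, rule less_le_trans[OF less_exp]) (rule power_mono, simp_all)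
      also have "\<dots> \<le> 3 ^ K * t" using t(1) by simp
      finally show ?thesis .
    qed
    moreover have "1 / real t ^ m * real (3 ^ K * t) ^ m \<le> poly Q (real (3 ^ K * t))"
    proof -
      have "1 / real t ^ m * real (3 ^ K * t) ^ m = of_int ((3 ^ m) ^ K * 1)"
        using t(1) by (simp add: power_mult_distrib power_mult[symmetric] mult.commute)
      also have "\<dots> \<le> of_int ((3 ^ m) ^ K * (\<Sum>z\<in>pts t. f (tight t z)))"
        using start by (intro of_int_le_iff[THEN iffD2] mult_left_mono) auto
      also have "\<dots> \<le> of_int (\<Sum>z\<in>pts (3 ^ K * t). f (tight (3 ^ K * t) z))"
        using sum_growth[OF f(1) _ t(1)] by (intro of_int_le_iff[THEN iffD2]) simp
      also have "\<dots> \<le> poly Q (real (3 ^ K * t))" using t(1) by (intro Q(2)) simp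
      finally show ?thesis .
    qed
    ultimately show "\<exists>n\<ge>K. 1 / real t ^ m * real n ^ m \<le> poly Q (real n)" by blast
  qed
  then show ?thesis using t(1) by (meson divide_pos_pos less_le_trans of_nat_0_less_iff zero_less_one zero_less_power)
qed

theorem coeffs_pos:
  assumes u: "0 < u" "q \<in> pts u" "tight u q = {}" and k: "k \<le> 3"
  shows "0 < coeff P k"
proof -
  have good: "good_cone (tight t z)" if "0 < t" "z \<in> pts t" for t z
    using good_cone_tight[OF u(2,3)] that by blast
  let ?f = "(1, 1, 1) :: vec3"
  obtain t0 z0 where v: "0 < t0" "z0 \<in> pts t0" "pointed (tight t0 z0)" "\<forall>d\<in>dirs (tight t0 z0). 0 \<le> ip ?f d"
    using optimal_vertex[OF u(1,2), of ?f] by blast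
  have two: "2 \<le> card (tight t0 z0)" using v(3) tight_roots by (rule card_pointed)
  \<comment> \<open>the third polynomial is constant and the optimal vertex contributes a positive third defect\<close>
  have c0: "0 < coeff P 0"
  proof -
    have "?f \<in> signs3" by (simp add: signs3_def)
    then have "\<not> (\<forall>f\<in>signs3. \<exists>d\<in>dirs (tight t0 z0). ip f d < 0)" using v(4) by force
    then have "0 < defect3 (tight t0 z0)"
      using good[OF v(1,2)] v(3) unfolding good_cone_def pointed_def by force
    also have "\<dots> \<le> (\<Sum>z\<in>pts t0. defect3 (tight t0 z))"
      using good[OF v(1)] finite_pts[OF v(1)] by (intro member_le_sum[OF v(2)]) (auto simp: good_cone_def)
    finally have "0 < poly Q3 (real t0)" unfolding poly_Q3[OF v(1)] by (simp only: of_int_0_less_iff)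
    moreover have "poly Q3 (real t0) = coeff Q3 0"
    proof -
      obtain a where "Q3 = [:a:]" using degree_Q3 degree_eq_zeroE by blast
      then show ?thesis by simp
    qed
    ultimately show ?thesis by (simp add: coeff_tripling)
  qed
  \<comment> \<open>the second polynomial is linear and its value at \<open>3 t0\<close> exceeds that at \<open>t0\<close>\<close>
  have c1: "0 < coeff P 1"
  proof -
    have lin: "poly Q2 x = coeff Q2 0 + coeff Q2 1 * x" for x
    proof -
      have "Q2 = [:coeff Q2 0, coeff Q2 1:]"
      proof (rule poly_eqI)
        fix i :: nat
        consider "i = 0" | "i = 1" | "1 < i" by (meson less_one nat_neq_iff)
        then show "coeff Q2 i = coeff [:coeff Q2 0, coeff Q2 1:] i"
          using degree_Q2 by cases (auto simp: coeff_eq_0 coeff_pCons split: nat.split)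
      qed
      then have "poly Q2 x = poly [:coeff Q2 0, coeff Q2 1:] x" by (rule arg_cong)
      then show ?thesis by (simp add: mult.commute)
    qed
    have "0 \<le> 2 * defect2 (tight t0 z) - defect3 (tight t0 z)" if "z \<in> pts t0" for z
      using good[OF v(1) that] by (simp add: good_cone_def)
    moreover have "0 < 2 * defect2 (tight t0 z0) - defect3 (tight t0 z0)"
      using good[OF v(1,2)] two by (simp add: good_cone_def)
    ultimately have "0 < (\<Sum>z\<in>pts t0. 2 * defect2 (tight t0 z) - defect3 (tight t0 z))"
      using finite_pts[OF v(1)] v(2) by (intro sum_pos2) auto
    also have "\<dots> = (\<Sum>z\<in>pts t0. transfer defect2 (tight t0 z)) - (\<Sum>z\<in>pts t0. defect2 (tight t0 z))"
      by (simp add: defect3_def sum_subtractf[symmetric])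
    finally have "poly Q2 (real t0) < poly Q2 (real (3 * t0))"
      using v(1) by (simp add: poly_Q2 sum_transfer[OF finite_pts[OF v(1)], of defect2] flip: of_nat_mult of_int_sum
        del: of_nat_mult of_int_sum)
    then have "0 < real t0 * coeff Q2 1" by (simp add: lin)
    then have "0 < coeff Q2 1" using v(1) by (simp add: zero_less_mult_iff)
    then show ?thesis by (simp add: coeff_tripling)
  qed
  have c2: "0 < coeff P 2"
  proof -
    \<comment> \<open>among all points on the boundary take one with as few tight constraints as possible\<close>
    define B where "B = {(t, z). 0 < t \<and> z \<in> pts t \<and> tight t z \<noteq> {}}"
    have "tight t0 z0 \<noteq> {}" using two by force
    then have "(t0, z0) \<in> B" using v by (simp add: B_def)
    then obtain b where b: "b \<in> B" "\<And>b'. b' \<in> B \<Longrightarrow> card (tight (fst b) (snd b)) \<le> card (tight (fst b') (snd b'))"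
      using ex_has_least_nat[of "\<lambda>b. b \<in> B" _ "\<lambda>b. card (tight (fst b) (snd b))"] by blast
    obtain t z where tz: "b = (t, z)" by (cases b)
    have t: "0 < t" "z \<in> pts t" "tight t z \<noteq> {}" using b(1) by (auto simp: B_def tz)
    have fin: "finite (tight t z)" using tight_subset finite_A by (rule finite_subset)
    have "card (tight t z) < 2"
    proof (rule ccontr)
      assume "\<not> card (tight t z) < 2"
      then obtain d where d: "d \<in> dirs (tight t z)" "face (tight t z) d \<noteq> {}" "face (tight t z) d \<noteq> tight t z"
        using good[OF t(1,2)] by (auto simp: good_cone_def)
      have zd: "z \<in> bcc" "d \<in> reps" using t(2) d(1) pts_bcc by (auto simp: dirs_def)
      then have "(3 * t, triple_plus z d) \<in> B"
        using t(1,2) d triple_plus_pts[OF zd] by (simp add: B_def tight_triple_plus)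
      from b(2)[OF this] have "card (tight t z) \<le> card (face (tight t z) d)"
        by (simp add: tz tight_triple_plus zd)
      moreover have "card (face (tight t z) d) < card (tight t z)"
        using d(3) face_subset[of "tight t z" d] fin by (intro psubset_card_mono psubsetI)
      ultimately show False by simp
    qed
    moreover have "card (tight t z) \<noteq> 0" using fin t(3) by simp
    ultimately have "card (tight t z) = 1" by arith
    then obtain n where n: "tight t z = {n}" by (rule card_1_singletonE)
    then have "n \<in> roots" using tight_roots by blast
    \<comment> \<open>points with tangent cone \<open>{n}\<close> reproduce ninefold and have positive first defect\<close>
    let ?g = "\<lambda>S. if S = {n} then 1 else 0 :: int"
    have "0 < coeff Q1 2"
    proof (rule coeff_pos_by_growth[of 2 ?g])
      show "3 ^ 2 * ?g S \<le> transfer ?g S" for S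
      proof (cases "S = {n}")
        case True
        have "9 = card {d \<in> reps. ip n d = 0}" using card_root_plane[OF \<open>n \<in> roots\<close>] by simp
        also have "int \<dots> = (\<Sum>d\<in>{d \<in> reps. ip n d = 0}. ?g (face {n} d))"
        proof -
          have "?g (face {n} d) = 1" if "ip n d = 0" for d using that by (auto simp: face_def)
          then show ?thesis by simp
        qed
        also have "\<dots> \<le> (\<Sum>d\<in>dirs {n}. ?g (face {n} d))"
          by (intro sum_mono2) (auto simp: dirs_def)
        finally show ?thesis by (simp add: True transfer_def)
      qed (simp add: transfer_def sum_nonneg)
      show "of_int (\<Sum>z\<in>pts t. ?g (tight t z)) \<le> poly Q1 (real t)" if "0 < t" for t
      proof -
        have "?g S \<le> defect1 S" for S
          using defect1_nonneg[of S] defect1_pos[of S] \<open>n \<in> roots\<close> by auto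
        then show ?thesis unfolding poly_Q1[OF that] by (intro of_int_le_iff[THEN iffD2] sum_mono) 
      qed
    qed (use t n degree_Q1 in auto)
    then show ?thesis by (simp add: coeff_tripling)
  qed
  have c3: "0 < coeff P 3"
  proof -
    let ?g = "\<lambda>S :: vec3 set. if S = {} then 1 else 0 :: int"
    show ?thesis
    proof (rule coeff_pos_by_growth[of 3 ?g])
      show "3 ^ 3 * ?g S \<le> transfer ?g S" for S
      proof (cases "S = {}")
        case True
        then show ?thesis by (simp add: transfer_def dirs_def face_def card_reps)
      qed (simp add: transfer_def sum_nonneg)
      show "of_int (\<Sum>z\<in>pts t. ?g (tight t z)) \<le> poly P (real t)" if "0 < t" for t
        unfolding poly_P_sum[OF that] by (intro of_int_le_iff[THEN iffD2] sum_mono) auto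
    qed (use u degree_P in auto)
  qed
  have "k = 0 \<or> k = 1 \<or> k = 2 \<or> k = 3" using k by auto
  then show ?thesis using c0 c1 c2 c3 by auto
qed

end

section \<open>Hives of size four\<close>

text \<open>The rhombus inequalities as pairs of a normal and a lower bound, where \<open>L i = h (i, 0)\<close>,
  \<open>N i = h (i, i)\<close> and \<open>M j = h (4, j)\<close> are the border values. The factor 2 comes from the
  coordinates: the root \<open>(1, 1, 0)\<close> takes the value \<open>2u\<close>, and so on. There are six rhombi of each of
  the three types.\<close>

definition rhombi :: "(nat \<Rightarrow> int) \<Rightarrow> (nat \<Rightarrow> int) \<Rightarrow> (nat \<Rightarrow> int) \<Rightarrow> (vec3 \<times> int) list" where
  "rhombi L M N = map (\<lambda>(n, c). (n, 2 * c))
    [((-1, -1, 0), - L 1 - N 1), ((0, 1, -1), L 1 - L 2), ((1, 0, -1), N 1 - N 2),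
     ((1, 0, 1), L 2 + M 1 - L 3), ((0, 0, 2), M 2), ((0, 1, 1), N 2 + M 3 - N 3),
     ((1, 1, 0), L 2 + N 1 - L 1), ((0, -1, 1), L 3 - L 2), ((0, 2, 0), N 2),
     ((-1, 0, -1), L 4 - L 3 - M 1), ((1, -1, 0), M 1 - M 2), ((0, 1, 1), M 2 + N 3 - M 3),
     ((1, 1, 0), N 2 + L 1 - N 1), ((2, 0, 0), L 2), ((-1, 0, 1), N 3 - N 2),
     ((1, 0, 1), M 2 + L 3 - M 1), ((-1, 1, 0), M 3 - M 2), ((0, -1, -1), M 4 - N 3 - M 3)]"

text \<open>In these coordinates of the interior entries \<open>u = h (2, 1)\<close>, \<open>v = h (3, 1)\<close>, \<open>w = h (3, 2)\<close> the
  normals of the rhombus inequalities are roots.\<close>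

definition hive_point :: "int \<Rightarrow> int \<Rightarrow> int \<Rightarrow> vec3" where
  "hive_point u v w = (u + v - w, u + w - v, v + w - u)"

lemma hive_point_rhombi:
  "(\<forall>(n, c)\<in>set (rhombi L M N). c \<le> ip n (hive_point u v w)) \<longleftrightarrow>
    u \<le> L 1 + N 1 \<and> v + L 1 \<le> u + L 2 \<and> w + N 1 \<le> u + N 2 \<and>
    L 2 + M 1 \<le> L 3 + v \<and> M 2 + u \<le> v + w \<and> N 2 + M 3 \<le> N 3 + w \<and>
    L 2 + N 1 \<le> L 1 + u \<and> L 3 + u \<le> L 2 + v \<and> N 2 + v \<le> u + w \<and>
    L 4 + v \<le> L 3 + M 1 \<and> M 1 + w \<le> M 2 + v \<and> M 2 + N 3 \<le> M 3 + w \<and>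
    N 2 + L 1 \<le> N 1 + u \<and> L 2 + w \<le> u + v \<and> N 3 + u \<le> N 2 + w \<and>
    M 2 + L 3 \<le> M 1 + v \<and> M 3 + v \<le> M 2 + w \<and> M 4 + w \<le> N 3 + M 3"
  unfolding rhombi_def hive_point_def list.map list.set ball_simps prod.case ip.simps simp_thms
  by (intro arg_cong2[of _ _ _ _ "(\<and>)"]) (auto simp: algebra_simps)

lemma bcc_hive_point: "z \<in> bcc \<longleftrightarrow> (\<exists>u v w. z = hive_point u v w)"
proof
  assume "z \<in> bcc"
  obtain a b c where z: "z = (a, b, c)" by (cases z)
  have "even (a - b)" "even (b - c)" using \<open>z \<in> bcc\<close> by (simp_all add: bcc_def z)
  then obtain p q where "a - b = 2 * p" "b - c = 2 * q" unfolding dvd_def by blast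
  then have "z = hive_point (b + p) (b + p - q) (b - q)"
    by (simp add: z hive_point_def)
  then show "\<exists>u v w. z = hive_point u v w" by blast
next
  assume "\<exists>u v w. z = hive_point u v w"
  then show "z \<in> bcc" by (auto simp: bcc_def hive_point_def)
qed

lemma hive_point_inject: "hive_point u v w = hive_point u' v' w' \<longleftrightarrow> u = u' \<and> v = v' \<and> w = w'"
  by (auto simp: hive_point_def)

definition psum :: "(nat \<Rightarrow> nat) \<Rightarrow> nat \<Rightarrow> int" where
  "psum \<mu> k = int (\<Sum>m<k. \<mu> m)"

abbreviation border_rhombi :: "(nat \<Rightarrow> nat) \<Rightarrow> (nat \<Rightarrow> nat) \<Rightarrow> (nat \<Rightarrow> nat) \<Rightarrow> (vec3 \<times> int) list" where
  "border_rhombi \<kappa> \<mu> \<nu> \<equiv> rhombi (psum \<kappa>) (\<lambda>k. psum \<kappa> 4 + psum \<mu> k) (psum \<nu>)"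

lemma psum_simps: 
  "psum \<mu> 1 = \<mu> 0" "psum \<mu> 2 = int (\<mu> 0) + \<mu> 1" "psum \<mu> 3 = int (\<mu> 0) + \<mu> 1 + \<mu> 2" "psum \<mu> 4 = int (\<mu> 0) + \<mu> 1 + \<mu> 2 + \<mu> 3"
  by (simp_all add: psum_def eval_nat_numeral)

lemma all_nat_4: "(\<forall>k::nat. Q k) \<longleftrightarrow> Q 0 \<and> Q 1 \<and> Q 2 \<and> Q 3 \<and> (\<forall>k\<ge>4. Q k)"
proof (intro iffI allI)
  fix k assume *: "Q 0 \<and> Q 1 \<and> Q 2 \<and> Q 3 \<and> (\<forall>k\<ge>4. Q k)"
  have "k = 0 \<or> k = 1 \<or> k = 2 \<or> k = 3 \<or> k \<ge> (4::nat)" by arith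
  then show "Q k" using * by auto
qed simp

context
  fixes \<kappa> \<mu> \<nu> :: "nat \<Rightarrow> nat"
  assumes parts: "antimono \<mu>" "antimono \<kappa>"
    and zero: "\<And>k. 4 \<le> k \<Longrightarrow> \<kappa> k = 0" "\<And>k. 4 \<le> k \<Longrightarrow> \<mu> k = 0" "\<And>k. 4 \<le> k \<Longrightarrow> \<nu> k = 0"
begin

definition triangular :: "(nat \<Rightarrow> nat \<Rightarrow> nat) \<Rightarrow> bool" where
  "triangular x \<longleftrightarrow> x 0 = (\<lambda>_. 0) \<and> (\<forall>k\<ge>4. x k = \<mu>) \<and> 
    (\<forall>i\<ge>1. x 1 i = 0) \<and> (\<forall>i\<ge>2. x 2 i = 0) \<and> (\<forall>i\<ge>3. x 3 i = 0)"

text \<open>The conditions on a pattern, separated into the shape of the array, interlacing, the weight, and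
  the row conditions. Interlacing and the row conditions together are the rhombus inequalities,
  and the weight determines the entries \<open>x 1 0\<close>, \<open>x 2 1\<close>, \<open>x 3 2\<close> from the three others.\<close>

lemma lr_patterns_4:
  "x \<in> lr_patterns 4 \<kappa> \<mu> \<nu> \<longleftrightarrow>
    triangular x \<and> (
    x 2 1 \<le> x 1 0 \<and> x 1 0 \<le> x 2 0 \<and> x 3 1 \<le> x 2 0 \<and> x 2 0 \<le> x 3 0 \<and> x 3 2 \<le> x 2 1 \<and> x 2 1 \<le> x 3 1 \<and>
    \<mu> 1 \<le> x 3 0 \<and> x 3 0 \<le> \<mu> 0 \<and> \<mu> 2 \<le> x 3 1 \<and> x 3 1 \<le> \<mu> 1 \<and> \<mu> 3 \<le> x 3 2 \<and> x 3 2 \<le> \<mu> 2) \<and>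
    (\<kappa> 0 + x 1 0 = \<nu> 0 \<and> \<kappa> 1 + x 2 0 + x 2 1 = \<nu> 1 + x 1 0 \<and>
    \<kappa> 2 + x 3 0 + x 3 1 + x 3 2 = \<nu> 2 + x 2 0 + x 2 1 \<and>
    \<kappa> 3 + \<mu> 0 + \<mu> 1 + \<mu> 2 + \<mu> 3 = \<nu> 3 + x 3 0 + x 3 1 + x 3 2) \<and>
    (\<kappa> 1 + x 2 0 \<le> \<kappa> 0 + x 1 0 \<and> \<kappa> 1 + x 2 0 + x 2 1 \<le> \<kappa> 0 + 2 * x 1 0 \<and>
    \<kappa> 2 + x 3 0 \<le> \<kappa> 1 + x 2 0 \<and> \<kappa> 2 + x 3 0 + x 3 1 + x 1 0 \<le> \<kappa> 1 + 2 * x 2 0 + x 2 1 \<and>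
    \<kappa> 2 + x 3 0 + x 3 1 + x 3 2 + x 1 0 \<le> \<kappa> 1 + 2 * x 2 0 + 2 * x 2 1 \<and>
    \<kappa> 3 + \<mu> 0 \<le> \<kappa> 2 + x 3 0 \<and> \<kappa> 3 + \<mu> 0 + \<mu> 1 + x 2 0 \<le> \<kappa> 2 + 2 * x 3 0 + x 3 1 \<and>
    \<kappa> 3 + \<mu> 0 + \<mu> 1 + \<mu> 2 + x 2 0 + x 2 1 \<le> \<kappa> 2 + 2 * x 3 0 + 2 * x 3 1 + x 3 2 \<and>
    \<kappa> 3 + \<mu> 0 + \<mu> 1 + \<mu> 2 + \<mu> 3 + x 2 0 + x 2 1 \<le> \<kappa> 2 + 2 * x 3 0 + 2 * x 3 1 + 2 * x 3 2)"
  (is "_ \<longleftrightarrow> triangular x \<and> ?G \<and> ?W \<and> ?R")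
proof -
  have gt: "x \<in> gt 4 \<mu> \<longleftrightarrow> triangular x \<and> (
    x 2 1 \<le> x 1 0 \<and> x 1 0 \<le> x 2 0 \<and> x 3 1 \<le> x 2 0 \<and> x 2 0 \<le> x 3 0 \<and> x 3 2 \<le> x 2 1 \<and> x 2 1 \<le> x 3 1 \<and>
    \<mu> 1 \<le> x 3 0 \<and> x 3 0 \<le> \<mu> 0 \<and> \<mu> 2 \<le> x 3 1 \<and> x 3 1 \<le> \<mu> 1 \<and> \<mu> 3 \<le> x 3 2 \<and> x 3 2 \<le> \<mu> 2)"
  proof
    assume x: "x \<in> gt 4 \<mu>"
    have "x (Suc k) (Suc i) \<le> x k i" "x k i \<le> x (Suc k) i" for k i
      using gt_interlace[OF x] by auto
    from this[of 1 0] this[of 2 0] this[of 2 1] this[of 3 0] this[of 3 1] this[of 3 2]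
    show "triangular x \<and> ?G" using gt_zero[OF x] gt_top[OF x] x by (simp add: gt_def triangular_def eval_nat_numeral)
  next
    assume G: "triangular x \<and> ?G"
    have "x (Suc k) (Suc i) \<le> x k i \<and> x k i \<le> x (Suc k) i" for k i
    proof -
      have "k = 0 \<or> k = 1 \<and> i = 0 \<or> k = 1 \<and> 1 \<le> i \<or> k = 2 \<and> i = 0 \<or> k = 2 \<and> i = 1 \<or> k = 2 \<and> 2 \<le> i \<or>
        k = 3 \<and> i = 0 \<or> k = 3 \<and> i = 1 \<or> k = 3 \<and> i = 2 \<or> k = 3 \<and> 3 \<le> i \<or> 4 \<le> k"
        by presburger
      then show ?thesis
        by (elim disjE conjE) (use G zero(2) antimonoD[OF parts(1), of i "Suc i"] in \<open>simp_all add: triangular_def eval_nat_numeral\<close>)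
    qed
    then show "x \<in> gt 4 \<mu>" using G by (simp add: gt_def triangular_def)
  qed
  define R where "R k i \<longleftrightarrow> \<kappa> (Suc k) + (\<Sum>m\<le>i. x (Suc (Suc k)) m - x (Suc k) m) \<le> \<kappa> k + (\<Sum>m<i. x (Suc k) m - x k m)" for k i
  have good: "good \<kappa> x \<longleftrightarrow> R 0 0 \<and> R 0 1 \<and> R 1 0 \<and> R 1 1 \<and> R 1 2 \<and> R 2 0 \<and> R 2 1 \<and> R 2 2 \<and> R 2 3" if x: "x \<in> gt 4 \<mu>"
  proof -
    have "R k i" if "3 \<le> k" for k i
      using that zero(1)[of "Suc k"] gt_top[OF x, of "Suc k"] gt_top[OF x, of "Suc (Suc k)"] by (simp add: R_def)
    moreover have "k = 0 \<and> i \<le> Suc k \<longleftrightarrow> k = 0 \<and> (i = 0 \<or> i = 1)" "k = 1 \<and> i \<le> Suc k \<longleftrightarrow> k = 1 \<and> (i = 0 \<or> i = 1 \<or> i = 2)"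
      "k = 2 \<and> i \<le> Suc k \<longleftrightarrow> k = 2 \<and> (i = 0 \<or> i = 1 \<or> i = 2 \<or> i = 3)" "k = 0 \<or> k = 1 \<or> k = 2 \<or> 3 \<le> k" for k i :: nat
      by presburger+
    ultimately have "(\<forall>k. \<forall>i\<le>Suc k. R k i) \<longleftrightarrow> R 0 0 \<and> R 0 1 \<and> R 1 0 \<and> R 1 1 \<and> R 1 2 \<and> R 2 0 \<and> R 2 1 \<and> R 2 2 \<and> R 2 3"
      by metis
    then show ?thesis by (simp add: good_iff_rows[OF x] R_def)
  qed
  have weight: "(\<forall>k. \<kappa> k + wt x k = \<nu> k) \<longleftrightarrow> \<kappa> 0 + wt x 0 = \<nu> 0 \<and> \<kappa> 1 + wt x 1 = \<nu> 1 \<and> \<kappa> 2 + wt x 2 = \<nu> 2 \<and> \<kappa> 3 + wt x 3 = \<nu> 3"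
    if "x \<in> gt 4 \<mu>"
    unfolding all_nat_4[of "\<lambda>k. \<kappa> k + wt x k = \<nu> k"] using zero wt_top[OF that] by auto
  show ?thesis
  proof (cases "triangular x \<and> ?G")
    case True
    then have "x \<in> gt 4 \<mu>" using gt by blast
    have le: "\<mu> 1 \<le> \<mu> 0" "\<mu> 2 \<le> \<mu> 1" "\<mu> 3 \<le> \<mu> 2" using parts(1) by (simp_all add: antimono_def)
    have 0: "x 0 i = 0" "x 1 1 = 0" "x 2 2 = 0" "x 3 3 = 0" "x 4 = \<mu>" for i using True by (simp_all add: triangular_def)
    note ineqs = True[THEN conjunct2] le
    note expand = wt_def R_def eval_nat_numeral lessThan_Suc atMost_Suc
    have w: "wt x 0 = x 1 0" "wt x 1 + x 1 0 = x 2 0 + x 2 1" "wt x 2 + x 2 0 + x 2 1 = x 3 0 + x 3 1 + x 3 2"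
      "wt x 3 + x 3 0 + x 3 1 + x 3 2 = \<mu> 0 + \<mu> 1 + \<mu> 2 + \<mu> 3"
      using ineqs 0 by (simp_all add: expand)
    have r: "R 0 0 \<longleftrightarrow> \<kappa> 1 + x 2 0 \<le> \<kappa> 0 + x 1 0"
      "R 0 1 \<longleftrightarrow> \<kappa> 1 + x 2 0 + x 2 1 \<le> \<kappa> 0 + 2 * x 1 0"
      "R 1 0 \<longleftrightarrow> \<kappa> 2 + x 3 0 \<le> \<kappa> 1 + x 2 0" 
      "R 1 1 \<longleftrightarrow> \<kappa> 2 + x 3 0 + x 3 1 + x 1 0 \<le> \<kappa> 1 + 2 * x 2 0 + x 2 1"
      "R 1 2 \<longleftrightarrow> \<kappa> 2 + x 3 0 + x 3 1 + x 3 2 + x 1 0 \<le> \<kappa> 1 + 2 * x 2 0 + 2 * x 2 1"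
      "R 2 0 \<longleftrightarrow> \<kappa> 3 + \<mu> 0 \<le> \<kappa> 2 + x 3 0" 
      "R 2 1 \<longleftrightarrow> \<kappa> 3 + \<mu> 0 + \<mu> 1 + x 2 0 \<le> \<kappa> 2 + 2 * x 3 0 + x 3 1"
      "R 2 2 \<longleftrightarrow> \<kappa> 3 + \<mu> 0 + \<mu> 1 + \<mu> 2 + x 2 0 + x 2 1 \<le> \<kappa> 2 + 2 * x 3 0 + 2 * x 3 1 + x 3 2"
      "R 2 3 \<longleftrightarrow> \<kappa> 3 + \<mu> 0 + \<mu> 1 + \<mu> 2 + \<mu> 3 + x 2 0 + x 2 1 \<le> \<kappa> 2 + 2 * x 3 0 + 2 * x 3 1 + 2 * x 3 2"
      using ineqs 0 by (auto simp: expand)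
    have w': "\<kappa> 0 + wt x 0 = \<nu> 0 \<longleftrightarrow> \<kappa> 0 + x 1 0 = \<nu> 0" "\<kappa> 1 + wt x 1 = \<nu> 1 \<longleftrightarrow> \<kappa> 1 + x 2 0 + x 2 1 = \<nu> 1 + x 1 0"
      "\<kappa> 2 + wt x 2 = \<nu> 2 \<longleftrightarrow> \<kappa> 2 + x 3 0 + x 3 1 + x 3 2 = \<nu> 2 + x 2 0 + x 2 1"
      "\<kappa> 3 + wt x 3 = \<nu> 3 \<longleftrightarrow> \<kappa> 3 + \<mu> 0 + \<mu> 1 + \<mu> 2 + \<mu> 3 = \<nu> 3 + x 3 0 + x 3 1 + x 3 2"
      using w by linarith+
    have "x \<in> lr_patterns 4 \<kappa> \<mu> \<nu> \<longleftrightarrow> (\<forall>k. \<kappa> k + wt x k = \<nu> k) \<and> good \<kappa> x"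
      using \<open>x \<in> gt 4 \<mu>\<close> unfolding lr_patterns_def by blast
    also have "\<dots> \<longleftrightarrow> ?W \<and> ?R"
      unfolding good[OF \<open>x \<in> gt 4 \<mu>\<close>] weight[OF \<open>x \<in> gt 4 \<mu>\<close>] r w' ..
    finally have *: "x \<in> lr_patterns 4 \<kappa> \<mu> \<nu> \<longleftrightarrow> ?W \<and> ?R" .
    have "(Q \<longleftrightarrow> P') \<Longrightarrow> F \<and> P \<Longrightarrow> (Q \<longleftrightarrow> F \<and> P \<and> P')" for F P P' Q by blast
    from this[OF * True] show ?thesis .
  next
    case False
    then have "x \<notin> lr_patterns 4 \<kappa> \<mu> \<nu>" using gt unfolding lr_patterns_def by blast
    have "\<not> Q \<Longrightarrow> \<not> (F \<and> P) \<Longrightarrow> (Q \<longleftrightarrow> F \<and> P \<and> P')" for F P P' Q by blast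
    from this[OF \<open>x \<notin> lr_patterns 4 \<kappa> \<mu> \<nu>\<close> False] show ?thesis .
  qed
qed

text \<open>The hive entry \<open>h (i, j)\<close> is the sum of the first \<open>i\<close> parts of \<open>\<kappa>\<close> and the first \<open>j\<close> entries of
  row \<open>i\<close> of the pattern.\<close>

definition hive_of :: "(nat \<Rightarrow> nat \<Rightarrow> nat) \<Rightarrow> vec3" where
  "hive_of x = hive_point (psum \<kappa> 2 + x 2 0) (psum \<kappa> 3 + x 3 0) (psum \<kappa> 3 + x 3 0 + x 3 1)"

lemma pattern_ext:
  fixes x y :: "nat \<Rightarrow> nat \<Rightarrow> nat"
  assumes "triangular x"
    and "triangular y"
    and "x 1 0 = y 1 0" "x 2 0 = y 2 0" "x 2 1 = y 2 1" "x 3 0 = y 3 0" "x 3 1 = y 3 1" "x 3 2 = y 3 2"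
  shows "x = y"
proof (intro ext)
  fix k i :: nat
  have "k = 0 \<or> k = 1 \<and> i = 0 \<or> k = 1 \<and> 1 \<le> i \<or> k = 2 \<and> i = 0 \<or> k = 2 \<and> i = 1 \<or> k = 2 \<and> 2 \<le> i \<or>
        k = 3 \<and> i = 0 \<or> k = 3 \<and> i = 1 \<or> k = 3 \<and> i = 2 \<or> k = 3 \<and> 3 \<le> i \<or> 4 \<le> k"
    by presburger
  then show "x k i = y k i"
    by (elim disjE conjE) (use assms in \<open>simp_all add: triangular_def\<close>)
qed

lemma bij_hive_of:
  assumes size: "psum \<kappa> 4 + psum \<mu> 4 = psum \<nu> 4" and \<nu>: "antimono \<nu>"
  shows "bij_betw hive_of (lr_patterns 4 \<kappa> \<mu> \<nu>) {z \<in> bcc. \<forall>(n, c)\<in>set (border_rhombi \<kappa> \<mu> \<nu>). c \<le> ip n z}"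
proof (rule bij_betw_imageI)
  show "inj_on hive_of (lr_patterns 4 \<kappa> \<mu> \<nu>)"
  proof (rule inj_onI)
    fix x y assume x: "x \<in> lr_patterns 4 \<kappa> \<mu> \<nu>" and y: "y \<in> lr_patterns 4 \<kappa> \<mu> \<nu>" and "hive_of x = hive_of y"
    then have eq: "x 2 0 = y 2 0" "x 3 0 = y 3 0" "x 3 1 = y 3 1"
      by (auto simp: hive_of_def hive_point_inject)
    note x = x[unfolded lr_patterns_4] and y = y[unfolded lr_patterns_4]
    note xy = x[THEN conjunct2, THEN conjunct2, THEN conjunct1] y[THEN conjunct2, THEN conjunct2, THEN conjunct1]
    show "x = y"
    proof (rule pattern_ext)
      have W: "\<kappa> 0 + x 1 0 = \<nu> 0" "\<kappa> 1 + x 2 0 + x 2 1 = \<nu> 1 + x 1 0" "\<kappa> 2 + x 3 0 + x 3 1 + x 3 2 = \<nu> 2 + x 2 0 + x 2 1"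
        "\<kappa> 0 + y 1 0 = \<nu> 0" "\<kappa> 1 + y 2 0 + y 2 1 = \<nu> 1 + y 1 0" "\<kappa> 2 + y 3 0 + y 3 1 + y 3 2 = \<nu> 2 + y 2 0 + y 2 1"
        using xy by blast+
      then show "x 1 0 = y 1 0" by linarith
      then show "x 2 1 = y 2 1" using W eq by linarith
      then show "x 3 2 = y 3 2" using W eq by linarith
    qed (use x y eq in \<open>simp_all only: simp_thms\<close>)
  qed
  show "hive_of ` lr_patterns 4 \<kappa> \<mu> \<nu> = {z \<in> bcc. \<forall>(n, c)\<in>set (border_rhombi \<kappa> \<mu> \<nu>). c \<le> ip n z}" (is "_ = ?Z")
  proof
    show "hive_of ` lr_patterns 4 \<kappa> \<mu> \<nu> \<subseteq> ?Z"
    proof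
      fix z assume "z \<in> hive_of ` lr_patterns 4 \<kappa> \<mu> \<nu>"
      then obtain x where z: "z = hive_of x" and x: "x \<in> lr_patterns 4 \<kappa> \<mu> \<nu>" by blast
      have "z \<in> bcc" by (auto simp: z hive_of_def bcc_hive_point)
      moreover have "\<forall>(n, c)\<in>set (border_rhombi \<kappa> \<mu> \<nu>). c \<le> ip n z"
        using x[unfolded lr_patterns_4] unfolding z hive_of_def hive_point_rhombi psum_simps
        by (elim conjE) (intro conjI; linarith)
      ultimately show "z \<in> ?Z" by blast
    qed
    show "?Z \<subseteq> hive_of ` lr_patterns 4 \<kappa> \<mu> \<nu>"
    proof
      fix z assume z: "z \<in> ?Z"
      then obtain u v w where uvw: "z = hive_point u v w" by (auto simp: bcc_hive_point)
      have "\<forall>(n, c)\<in>set (border_rhombi \<kappa> \<mu> \<nu>). c \<le> ip n (hive_point u v w)" using z uvw by blast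
      note ineqs = this[unfolded hive_point_rhombi]
      have "0 \<le> psum \<mu> 4 - psum \<mu> 3" "psum \<kappa> 1 \<le> psum \<kappa> 2" "0 \<le> psum \<mu> 3 - psum \<mu> 2"
        unfolding psum_simps by simp_all
      then have "0 \<le> psum \<nu> 1 - psum \<kappa> 1" "0 \<le> u - psum \<kappa> 2" "0 \<le> psum \<nu> 2 - u"
        "0 \<le> v - psum \<kappa> 3" "0 \<le> w - v" "0 \<le> psum \<nu> 3 - w"
        using ineqs by linarith+
      then obtain a b b' c c' c'' where
        a: "psum \<nu> 1 - psum \<kappa> 1 = int a" and b: "u - psum \<kappa> 2 = int b" "psum \<nu> 2 - u = int b'" and
        c: "v - psum \<kappa> 3 = int c" "w - v = int c'" "psum \<nu> 3 - w = int c''"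
        by (meson zero_le_imp_eq_int)
      define x :: "nat \<Rightarrow> nat \<Rightarrow> nat" where "x = (\<lambda>k. if k = 0 then \<lambda>_. 0 else if k = 1 then (\<lambda>_. 0)(0 := a)
        else if k = 2 then (\<lambda>_. 0)(0 := b, 1 := b')
        else if k = 3 then (\<lambda>_. 0)(0 := c, 1 := c', 2 := c'') else \<mu>)"
      have "triangular x" by (simp add: triangular_def x_def)
      have x: "x 1 0 = a" "x 2 0 = b" "x 2 1 = b'" "x 3 0 = c" "x 3 1 = c'" "x 3 2 = c''"
        by (simp_all add: x_def)
      have u: "u = psum \<kappa> 2 + int b" and v: "v = psum \<kappa> 3 + int c" and w: "w = psum \<kappa> 3 + int c + int c'"
        using b c by simp_all
      have \<nu>': "\<nu> 1 \<le> \<nu> 0" "\<nu> 2 \<le> \<nu> 1" "\<nu> 3 \<le> \<nu> 2" using \<nu> by (simp_all add: antimono_def)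
      have N: "psum \<nu> 1 = psum \<kappa> 1 + int a" "psum \<nu> 2 = psum \<kappa> 2 + int b + int b'" "psum \<nu> 3 = psum \<kappa> 3 + int c + int c' + int c''"
        using a b c by simp_all
      \<comment> \<open>eliminating the border values of \<open>\<nu>\<close> leaves one pattern inequality for each rhombus\<close>
      note I = ineqs[unfolded u v w N, unfolded psum_simps]
      have W: "\<kappa> 0 + a = \<nu> 0" "\<kappa> 1 + b + b' = \<nu> 1 + a" "\<kappa> 2 + c + c' + c'' = \<nu> 2 + b + b'"
        "\<kappa> 3 + \<mu> 0 + \<mu> 1 + \<mu> 2 + \<mu> 3 = \<nu> 3 + c + c' + c''"
        using N size unfolding psum_simps by linarith+
      have G: "b' \<le> a" "a \<le> b" "c' \<le> b" "b \<le> c" "c'' \<le> b'" "b' \<le> c'" "\<mu> 1 \<le> c" "c \<le> \<mu> 0" "\<mu> 2 \<le> c'" "c' \<le> \<mu> 1" "\<mu> 3 \<le> c''" "c'' \<le> \<mu> 2"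
        using I by simp_all
      have R: "\<kappa> 1 + b \<le> \<kappa> 0 + a" "\<kappa> 2 + c \<le> \<kappa> 1 + b" "\<kappa> 2 + c + c' + a \<le> \<kappa> 1 + 2 * b + b'" "\<kappa> 3 + \<mu> 0 \<le> \<kappa> 2 + c"
        "\<kappa> 3 + \<mu> 0 + \<mu> 1 + b \<le> \<kappa> 2 + 2 * c + c'" "\<kappa> 3 + \<mu> 0 + \<mu> 1 + \<mu> 2 + b + b' \<le> \<kappa> 2 + 2 * c + 2 * c' + c''"
        using I by simp_all
      have R': "\<kappa> 1 + b + b' \<le> \<kappa> 0 + 2 * a" "\<kappa> 2 + c + c' + c'' + a \<le> \<kappa> 1 + 2 * b + 2 * b'"
        "\<kappa> 3 + \<mu> 0 + \<mu> 1 + \<mu> 2 + \<mu> 3 + b + b' \<le> \<kappa> 2 + 2 * c + 2 * c' + 2 * c''"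
        \<comment> \<open>the row conditions at the last row say that \<open>\<nu>\<close> decreases\<close>
        using W \<nu>' by linarith+
      have "x \<in> lr_patterns 4 \<kappa> \<mu> \<nu>"
        unfolding lr_patterns_4 x using \<open>triangular x\<close> W G R R' by (intro conjI)
      moreover have "z = hive_of x" unfolding uvw u v w hive_of_def x ..
      ultimately show "z \<in> hive_of ` lr_patterns 4 \<kappa> \<mu> \<nu>" by blast
    qed
  qed
qed

end

section \<open>Interior points\<close>

text \<open>The functional of a root, expressed in the hive entries \<open>u, v, w\<close>.\<close>

fun weight :: "vec3 \<Rightarrow> real ^ 3" where
  "weight (a, b, c) = vector [of_int (a + b - c), of_int (a - b + c), of_int (b + c - a)]"

lemma weight_inner:
  "weight (a, b, c) \<bullet> x = of_int a * (x$1 + x$2 - x$3) + of_int b * (x$1 + x$3 - x$2) + of_int c * (x$2 + x$3 - x$1)"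
  by (simp add: inner_vec_def sum_3 algebra_simps)

lemma weight_nonzero:
  assumes "n \<in> roots"
  shows "weight n \<noteq> 0"
proof
  obtain a b c where n: "n = (a, b, c)" by (cases n)
  assume "weight n = 0"
  then have "real_of_int (a + b - c) = 0" "real_of_int (a - b + c) = 0" "real_of_int (b + c - a) = 0"
    unfolding n by (simp_all add: vec_eq_iff forall_3 del: of_int_add of_int_diff)
  then have "a + b - c = 0" "a - b + c = 0" "b + c - a = 0" unfolding of_int_eq_0_iff .
  then show False using assms by (simp add: roots_def n)
qed

context root_polytope begin

text \<open>Rounding \<open>t * x\<close> changes the value of a root by a bounded amount, while its slack grows linearly
  in \<open>t\<close>. Rounding to even coordinates in the dilate \<open>2t\<close> keeps the point in the lattice.\<close>

lemma strict_real_point: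
  assumes "\<And>n. n \<in> A \<Longrightarrow> of_int (\<beta> n) < weight n \<bullet> x"
  shows "\<exists>u q. 0 < u \<and> q \<in> pts u \<and> tight u q = {}"
proof -
  define a b c where "a = x$1 + x$2 - x$3" and "b = x$1 + x$3 - x$2" and "c = x$2 + x$3 - x$1"
  define q where "q t = (2 * \<lfloor>real t * a\<rfloor>, 2 * \<lfloor>real t * b\<rfloor>, 2 * \<lfloor>real t * c\<rfloor>)" for t
  have "eventually (\<lambda>t. int (2 * t) * \<beta> n < ip n (q t)) sequentially" if n: "n \<in> A" for n
  proof -
    obtain i j k where ijk: "n = (i, j, k)" by (cases n)
    have small: "\<bar>i\<bar> + \<bar>j\<bar> + \<bar>k\<bar> = 2" using n roots by (auto simp: ijk roots_def)
    define s where "s = weight n \<bullet> x - of_int (\<beta> n)"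
    have "0 < s" using assms[OF n] by (simp add: s_def)
    have "int (2 * t) * \<beta> n < ip n (q t)" if "2 < s * real t" for t
    proof -
      have *: "of_int m * y - \<bar>of_int m\<bar> \<le> of_int m * of_int \<lfloor>y\<rfloor>" for m and y :: real
      proof -
        have "\<bar>of_int m\<bar> * (y - of_int \<lfloor>y\<rfloor>) \<le> \<bar>of_int m :: real\<bar> * 1"
          by (rule mult_left_mono) linarith+
        moreover have "of_int m * (y - of_int \<lfloor>y\<rfloor>) \<le> \<bar>of_int m\<bar> * (y - of_int \<lfloor>y\<rfloor>)"
          by (rule mult_right_mono) (use floor_correct[of y] in simp_all)
        ultimately show ?thesis by (simp add: algebra_simps)
      qed
      have "\<bar>of_int i\<bar> + \<bar>of_int j\<bar> + \<bar>of_int k\<bar> = (2::real)"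
        using small by (metis of_int_abs of_int_add of_int_numeral)
      moreover have "real_of_int (ip n (q t)) = 2 * (of_int i * of_int \<lfloor>real t * a\<rfloor> + of_int j * of_int \<lfloor>real t * b\<rfloor> + of_int k * of_int \<lfloor>real t * c\<rfloor>)"
        by (simp add: ijk q_def algebra_simps)
      moreover have "s + of_int (\<beta> n) = of_int i * a + of_int j * b + of_int k * c"
        unfolding s_def ijk weight_inner a_def b_def c_def by simp
      then have "real t * (s + of_int (\<beta> n)) = real t * (of_int i * a + of_int j * b + of_int k * c)" by simp
      then have "real t * s + real t * of_int (\<beta> n) = of_int i * (real t * a) + of_int j * (real t * b) + of_int k * (real t * c)"
        by (simp add: distrib_left mult_ac)
      moreover have "2 * (d + e) - 4 \<le> v" if "p + q + r = 2" "v = 2 * (x + y + z)" "d + e = x' + y' + z'"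
        "x' - p \<le> x" "y' - q \<le> y" "z' - r \<le> z" for d e p q r v x y z x' y' z' :: real
        using that unfolding distrib_left by linarith
      ultimately have "real_of_int (ip n (q t)) \<ge> 2 * (real t * s + real t * of_int (\<beta> n)) - 4"
        using * by blast
      moreover have "real_of_int (int (2 * t) * \<beta> n) = 2 * (real t * of_int (\<beta> n))" by simp
      ultimately have "real_of_int (int (2 * t) * \<beta> n) < of_int (ip n (q t))"
        using that unfolding distrib_left mult.commute[of s] by linarith
      then show ?thesis unfolding of_int_less_iff .
    qed
    moreover have "eventually (\<lambda>t. 2 / s < real t) sequentially"
      using filterlim_real_sequentially by (simp add: filterlim_at_top_dense)
    then have "eventually (\<lambda>t. 2 < s * real t) sequentially"
      by eventually_elim (use \<open>0 < s\<close> in \<open>simp add: field_simps\<close>)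
    ultimately show ?thesis by (rule eventually_mono[rotated])
  qed
  then have "eventually (\<lambda>t. \<forall>n\<in>A. int (2 * t) * \<beta> n < ip n (q t)) sequentially"
    by (intro eventually_ball_finite finite_A ballI)
  then have "eventually (\<lambda>t. 0 < t \<and> (\<forall>n\<in>A. int (2 * t) * \<beta> n < ip n (q t))) sequentially"
    by (intro eventually_conj eventually_gt_at_top)
  from eventually_happens'[OF sequentially_bot this]
  obtain t where "0 < t" and t: "\<forall>n\<in>A. int (2 * t) * \<beta> n < ip n (q t)" by blast
  have "q t \<in> bcc" by (simp add: q_def bcc_def)
  then have "q t \<in> pts (2 * t)" "tight (2 * t) (q t) = {}"
    using t by (auto simp: pts_def tight_def less_imp_le)
  moreover have "0 < 2 * t" using \<open>0 < t\<close> by simp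
  ultimately show ?thesis by blast
qed

text \<open>A convex set of full dimension has interior points, and these satisfy all defining inequalities
  strictly.\<close>

lemma strict_point_if_full_dimensional:
  assumes dim: "aff_dim S = 3" and S: "\<And>x n. x \<in> S \<Longrightarrow> n \<in> A \<Longrightarrow> of_int (\<beta> n) \<le> weight n \<bullet> x"
  shows "\<exists>u q. 0 < u \<and> q \<in> pts u \<and> tight u q = {}"
proof -
  define K where "K = (\<Inter>n\<in>A. {x. weight n \<bullet> x \<ge> of_int (\<beta> n)})"
  have "S \<subseteq> K" using S by (auto simp: K_def)
  have "convex K" unfolding K_def by (intro convex_INT convex_halfspace_ge)
  have "aff_dim K = 3"
    using aff_dim_subset[OF \<open>S \<subseteq> K\<close>] aff_dim_le_DIM[of K] dim by simp
  then have "affine hull K = UNIV" using aff_dim_eq_full[of K] by simp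
  then have "interior K = rel_interior K" by (rule rel_interior_interior[symmetric])
  moreover have "K \<noteq> {}" using \<open>aff_dim K = 3\<close> by auto
  ultimately have "interior K \<noteq> {}" using rel_interior_eq_empty[OF \<open>convex K\<close>] by simp
  then obtain x where x: "x \<in> interior K" by blast
  show ?thesis
  proof (rule strict_real_point)
    fix n assume "n \<in> A"
    then have "x \<in> interior {x. weight n \<bullet> x \<ge> of_int (\<beta> n)}"
      using x interior_mono[of K "{x. weight n \<bullet> x \<ge> of_int (\<beta> n)}"] by (auto simp: K_def)
    then show "of_int (\<beta> n) < weight n \<bullet> x"
      using weight_nonzero[of n] \<open>n \<in> A\<close> roots by (auto simp: interior_halfspace_ge)
  qed
qed

end

section \<open>The hive polytope\<close>

text \<open>Several rhombi have the same normal; only the largest bound counts.\<close>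

definition bound :: "('a \<times> int) list \<Rightarrow> 'a \<Rightarrow> int" where
  "bound L n = Max {c. (n, c) \<in> set L}"

lemma finite_bounds: "finite {c. (n, c) \<in> set L}"
proof -
  have "{c. (n, c) \<in> set L} \<subseteq> snd ` set L" by force
  then show ?thesis by (rule finite_subset) simp
qed

lemma bound_in: "n \<in> fst ` set L \<Longrightarrow> (n, bound L n) \<in> set L"
  unfolding bound_def using Max_in[OF finite_bounds[of n L]] by force

lemma all_bound:
  "(\<forall>n\<in>fst ` set L. int t * bound L n \<le> F n) \<longleftrightarrow> (\<forall>(n, c)\<in>set L. int t * c \<le> F n)"
proof -
  have "int t * c \<le> int t * bound L n" if "(n, c) \<in> set L" for n c
    unfolding bound_def by (intro mult_left_mono Max_ge finite_bounds) (use that in simp_all)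
  then show ?thesis using bound_in[of _ L]
    by (smt (verit, best) case_prodD case_prodI2 image_iff fst_conv)
qed

lemma rhombi_scale: "rhombi (\<lambda>k. t * L k) (\<lambda>k. t * M k) (\<lambda>k. t * N k) = map (\<lambda>(n, c). (n, t * c)) (rhombi L M N)"
  by (simp add: rhombi_def algebra_simps)

lemma rhombi_roots: "fst ` set (rhombi L M N) \<subseteq> roots"
  by (simp add: rhombi_def roots_def)

lemma rhombi_even: "(n, c) \<in> set (rhombi L M N) \<Longrightarrow> even c"
  by (auto simp: rhombi_def)

lemma psum_stretch: "psum (stretch t \<mu>) k = int t * psum \<mu> k"
  by (simp add: psum_def stretch_def sum_distrib_left)

lemma border_rhombi_stretch:
  "border_rhombi (stretch t \<kappa>) (stretch t \<mu>) (stretch t \<nu>) = map (\<lambda>(n, c). (n, int t * c)) (border_rhombi \<kappa> \<mu> \<nu>)"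
  unfolding rhombi_scale[symmetric] psum_stretch distrib_left ..

lemma stretch_partition:
  assumes "is_partition \<mu>"
  shows "is_partition (stretch t \<mu>)"
proof -
  have "{i. stretch t \<mu> i \<noteq> 0} \<subseteq> {i. \<mu> i \<noteq> 0}" by (auto simp: stretch_def)
  then show ?thesis
    using assms finite_subset by (auto simp: is_partition_def stretch_def antimono_def)
qed

lemma part_size_eq_psum:
  assumes "\<And>k. 4 \<le> k \<Longrightarrow> \<mu> k = 0"
  shows "int (part_size \<mu>) = psum \<mu> 4"
  by (simp add: part_size_eq_sum[OF assms] psum_def)

text \<open>Every point of the hive polytope satisfies the inequalities of the root polytope.\<close>

lemma hive_weight:
  assumes h: "hive 4 h" and border: "hive_border 4 \<kappa> \<mu> \<nu> h" and zero: "\<And>k. 4 \<le> k \<Longrightarrow> \<kappa> k = 0"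
    and nc: "(n, c) \<in> set (border_rhombi \<kappa> \<mu> \<nu>)"
  shows "of_int c \<le> weight n \<bullet> vector [h (2, 1), h (3, 1), h (3, 2)]"
proof -
  have size: "real (part_size \<kappa>) = of_int (psum \<kappa> 4)" by (simp flip: part_size_eq_psum[OF zero])
  have "h (int k, 0) = psum \<kappa> k" "h (int k, int k) = psum \<nu> k" "h (4, int k) = psum \<kappa> 4 + psum \<mu> k" if "k \<le> 4" for k
    using border that size by (simp_all add: hive_border_def psum_def)
  note this[of 0] this[of 1] this[of 2] this[of 3] this[of 4]
  note B = this[simplified]
  have 1: "h (i+1, j) + h (i+1, j+1) \<ge> h (i, j) + h (i+2, j+1)" if "0 \<le> j" "j \<le> i" "i \<le> 2" for i j
    using h that by (auto simp: hive_def hive_array_def)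
  have 2: "h (i, j) + h (i+1, j+1) \<ge> h (i+1, j) + h (i, j+1)" if "0 \<le> j" "j < i" "i \<le> 3" for i j
    using h that by (auto simp: hive_def hive_array_def)
  have 3: "h (i, j) + h (i+1, j) \<ge> h (i+1, j+1) + h (i, j-1)" if "0 < j" "j \<le> i" "i \<le> 3" for i j
    using h that by (auto simp: hive_def hive_array_def)
  have size': "real_of_int (psum \<nu> 4) = of_int (psum \<kappa> 4) + of_int (psum \<mu> 4)" using B by linarith
  have psum_0: "psum \<mu> 0 = 0" for \<mu> by (simp add: psum_def)
  note R = 1[of 0 0, simplified] 1[of 0 1, simplified] 1[of 1 1, simplified] 1[of 0 2, simplified] 1[of 1 2, simplified] 1[of 2 2, simplified]
    2[of 0 1, simplified] 2[of 0 2, simplified] 2[of 1 2, simplified] 2[of 0 3, simplified] 2[of 1 3, simplified] 2[of 2 3, simplified]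
    3[of 1 1, simplified] 3[of 1 2, simplified] 3[of 2 2, simplified] 3[of 1 3, simplified] 3[of 2 3, simplified] 3[of 3 3, simplified]
  have "\<forall>(n, c)\<in>set (border_rhombi \<kappa> \<mu> \<nu>). of_int c \<le> weight n \<bullet> vector [h (2, 1), h (3, 1), h (3, 2)]"
    unfolding rhombi_def list.map list.set ball_simps prod.case weight_inner vector_3 simp_thms
    using R unfolding B size' psum_0 of_int_0 of_int_mult of_int_add of_int_diff of_int_minus of_int_numeral of_int_1 One_nat_def
      distrib_left right_diff_distrib
    by (intro conjI; linarith)
  then show ?thesis using nc by blast
qed

theorem theorem3:
  fixes lam mu nu :: "nat \<Rightarrow> nat" and P :: "real poly"
  assumes "is_partition lam" and "is_partition mu" and "is_partition nu"
    and "part_length lam \<le> 4" and "part_length mu \<le> 4" and "part_length nu \<le> 4"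
    and "part_size lam + part_size mu = part_size nu"
    and "\<And>t::nat. t \<ge> 1 \<Longrightarrow>
      poly P (real t) = of_int (lr_coeff (stretch t lam) (stretch t mu) (stretch t nu))"
  shows "(\<forall>k. 0 \<le> coeff P k) \<and>
    (0 < lr_coeff lam mu nu \<and> aff_dim (hive_polytope4 lam mu nu) = 3 \<longrightarrow>
      (\<forall>k\<in>{0, 1, 2, 3}. 0 < coeff P k))"
proof -
  let ?L = "border_rhombi lam mu nu"
  have zero: "lam k = 0" "mu k = 0" "nu k = 0" if "4 \<le> k" for k
    using assms(1-6) part_length_le_iff that by blast+
  interpret root_polytope "fst ` set ?L" "bound ?L"
  proof
    show "fst ` set ?L \<subseteq> roots" by (rule rhombi_roots)
    show "even (bound ?L n)" if "n \<in> fst ` set ?L" for n using rhombi_even[OF bound_in[OF that]] .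
  qed
  have bij: "bij_betw (hive_of (stretch t lam)) (lr_patterns 4 (stretch t lam) (stretch t mu) (stretch t nu)) (pts t)" for t
  proof -
    have "pts t = {z \<in> bcc. \<forall>(n, c)\<in>set (border_rhombi (stretch t lam) (stretch t mu) (stretch t nu)). c \<le> ip n z}"
      unfolding pts_def all_bound border_rhombi_stretch by auto
    moreover have "psum lam 4 + psum mu 4 = psum nu 4"
      using assms(7) part_size_eq_psum[of lam, OF zero(1)] part_size_eq_psum[of mu, OF zero(2)]
        part_size_eq_psum[of nu, OF zero(3)] by linarith
    then have "psum (stretch t lam) 4 + psum (stretch t mu) 4 = psum (stretch t nu) 4"
      unfolding psum_stretch distrib_left[symmetric] by simp
    moreover have "stretch t lam k = 0" "stretch t mu k = 0" "stretch t nu k = 0" if "4 \<le> k" for k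
      using zero[OF that] by (simp_all add: stretch_def)
    ultimately show ?thesis
      using bij_hive_of[of "stretch t mu" "stretch t lam" "stretch t nu"]
        partition_antimono[OF stretch_partition[OF assms(1), of t]]
        partition_antimono[OF stretch_partition[OF assms(2), of t]]
        partition_antimono[OF stretch_partition[OF assms(3), of t]] by simp
  qed
  have lr: "lr_coeff (stretch t lam) (stretch t mu) (stretch t nu) = int (card (pts t))" for t
  proof -
    have size: "part_size (stretch t \<mu>) = t * part_size \<mu>" if "\<And>k. 4 \<le> k \<Longrightarrow> \<mu> k = 0" for \<mu>
      using that by (simp add: part_size_eq_sum[of 4] stretch_def sum_distrib_left)
    have "stretch t nu \<in> partitions_of (part_size (stretch t lam) + part_size (stretch t mu))"
      using stretch_partition[OF assms(3)] size[of lam] size[of mu] size[of nu] zero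
      by (simp add: partitions_of_def assms(7)[symmetric] algebra_simps)
    then have "lr_coeff (stretch t lam) (stretch t mu) (stretch t nu) =
        int (card (lr_patterns 4 (stretch t lam) (stretch t mu) (stretch t nu)))"
      by (rule lr_coeff_eq[OF stretch_partition[OF assms(1)] stretch_partition[OF assms(2)]]) (simp add: stretch_def zero)
    then show ?thesis using bij_betw_same_card[OF bij] by simp
  qed
  interpret counting_polynomial "fst ` set ?L" "bound ?L" P
  proof
    fix t :: nat assume "0 < t"
    have "lr_patterns 4 (stretch t lam) (stretch t mu) (stretch t nu) \<subseteq> gt 4 (stretch t mu)"
      by (auto simp: lr_patterns_def)
    then show "finite (pts t)"
      using bij_betw_finite[OF bij] finite_gt[OF stretch_partition[OF assms(2)]] finite_subset by blast
    show "poly P (real t) = real (card (pts t))" using assms(8)[of t] \<open>0 < t\<close> lr by simp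
  qed
  have "0 < coeff P k" if "aff_dim (hive_polytope4 lam mu nu) = 3" "k \<le> 3" for k
  proof -
    have "\<exists>u q. 0 < u \<and> q \<in> pts u \<and> tight u q = {}"
    proof (rule strict_point_if_full_dimensional[OF that(1)])
      fix x n assume "x \<in> hive_polytope4 lam mu nu" "n \<in> fst ` set ?L"
      then obtain h where "hive 4 h" "hive_border 4 lam mu nu h" "x = vector [h (2, 1), h (3, 1), h (3, 2)]"
        by (auto simp: hive_polytope4_def)
      then show "of_int (bound ?L n) \<le> weight n \<bullet> x"
        using hive_weight[of h lam mu nu n "bound ?L n"] zero(1) bound_in[OF \<open>n \<in> fst ` set ?L\<close>] by simp
    qed
    then show ?thesis using coeffs_pos that(2) by blast
  qed
  then show ?thesis using coeffs_nonneg by auto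
qed

end
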